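(* Let $L\ge 1$ be an integer, let $W>0$, and let $\eta\in\mathbb{R}^+$, $p\in\mathbb{R}$, $q\in\mathbb{R}$. Let $\gamma_1,\gamma_2,\ldots,\gamma_L$ be mutually independent (not necessarily identically distributed) random variables with values in $(0,\infty)$, each having a probability density function. Put $$\gamma_{end}=\eta\left(\frac1L\sum_{\ell=1}^{L}\gamma_\ell^{p}\right)^{q},\qquad \mathcal{C}_{avg}=\mathbb{E}\left[W\log_2(1+\gamma_{end})\right],$$ and for $\ell\in\{1,\ldots,L\}$ and $s>0$ let $\mathcal{M}_{\gamma_\ell^p}(s)=\mathbb{E}\left[\exp\left(-s\gamma_\ell^p\right)\right]$. Then $$\mathcal{C}_{avg}=\frac{W}{\log(2)}\int_0^\infty C_{\eta,q}(s)\sum_{\ell=1}^{L}\left[\frac{\partial}{\partial s}\mathcal{M}_{\gamma_\ell^p}(s)\right]\prod_{\substack{k=1\\ k\ne \ell}}^{L}\mathcal{M}_{\gamma_k^p}(s)\,ds,$$ where, for $s>0$, $$C_{\eta,q}(s)=-H_{3,3}^{1,2}\left[\frac{\eta}{L^q s^q}\;\middle|\;\begin{array}{l}(1,1),(1,1),\left(1,\frac{|q|+q}{2}\right)\\ (1,1),(0,1),\left(0,\frac{|q|-q}{2}\right)\end{array}\right]$$ and $H^{m,n}_{p,q}[\cdot]$ denotes Fox's H function.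
   Context: $\log$ is the natural logarithm and $\log_2$ the logarithm to base 2. The variable $\gamma_\ell$ is the instantaneous signal-to-noise ratio (SNR) of the $\ell$th branch/hop, $\gamma_{end}$ is the overall instantaneous SNR, $W$ is the bandwidth, and $\mathcal{C}_{avg}$ is the ergodic capacity. The parameters $\eta,p,q$ specify the diversity-combining or transmission technique. Fox's H function is defined by the Mellin–Barnes integral $$H^{m,n}_{P,Q}\left[z\;\middle|\;\begin{array}{l}(a_1,A_1),\ldots,(a_P,A_P)\\ (b_1,B_1),\ldots,(b_Q,B_Q)\end{array}\right]=\frac{1}{2\pi i}\int_{\mathcal L}\frac{\prod_{j=1}^{m}\Gamma(b_j+B_jt)\prod_{j=1}^{n}\Gamma(1-a_j-A_jt)}{\prod_{j=n+1}^{P}\Gamma(a_j+A_jt)\prod_{j=m+1}^{Q}\Gamma(1-b_j-B_jt)}\,z^{-t}\,dt,$$ where $\mathcal L$ is a suitable contour (as usual in the definition of the H function: a line from $c-i\infty$ to $c+i\infty$, or a loop beginning and ending at $-\infty$ or at $+\infty$, according to convergence) separating the poles of the factors $\Gamma(b_j+B_jt)$, $1\le j\le m$ (to its left), from the poles of the factors $\Gamma(1-a_j-A_jt)$, $1\le j\le n$ (to its right). A parameter pair with second entry $0$ contributes the corresponding constant Gamma factor (here $\Gamma(1)=1$).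
   Formalization: For |q|>2 the right-hand integral is additionally assumed to converge absolutely (it can diverge, e.g. q=4, L=p=η=1, γ exponential, though the capacity is finite); it is also proved that the capacity is finite iff the integral converges absolutely. *)

theory Defs
  imports "HOL-Probability.Probability"
begin

text \<open>
  Fox's H function. The parameter lists hold the pairs \<open>(a\<^sub>j, A\<^sub>j)\<close> and \<open>(b\<^sub>j, B\<^sub>j)\<close>, indexed from 0.
  A factor in the denominator that sits at a pole of \<open>Gamma\<close> makes the quotient 0, which is the
  value of the entire function \<open>1 / \<Gamma>\<close> there, because \<open>Gamma\<close> is 0 at its poles and \<open>x / 0 = 0\<close>.
\<close>

definition fox_H_integrand ::
    "nat \<Rightarrow> nat \<Rightarrow> (complex \<times> real) list \<Rightarrow> (complex \<times> real) list \<Rightarrow> complex \<Rightarrow> complex \<Rightarrow> complex"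
  where
  "fox_H_integrand m n as bs z t =
     (\<Prod>j<m. Gamma (fst (bs ! j) + of_real (snd (bs ! j)) * t)) *
     (\<Prod>j<n. Gamma (1 - fst (as ! j) - of_real (snd (as ! j)) * t)) /
     ((\<Prod>j=n..<length as. Gamma (fst (as ! j) + of_real (snd (as ! j)) * t)) *
      (\<Prod>j=m..<length bs. Gamma (1 - fst (bs ! j) - of_real (snd (bs ! j)) * t))) *
     z powr (- t)"

definition fox_H_left_poles :: "nat \<Rightarrow> (complex \<times> real) list \<Rightarrow> complex set" where
  "fox_H_left_poles m bs =
     {t. \<exists>j<m. fst (bs ! j) + of_real (snd (bs ! j)) * t \<in> \<int>\<^sub>\<le>\<^sub>0}"

definition fox_H_right_poles :: "nat \<Rightarrow> (complex \<times> real) list \<Rightarrow> complex set" where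
  "fox_H_right_poles n as =
     {t. \<exists>j<n. 1 - fst (as ! j) - of_real (snd (as ! j)) * t \<in> \<int>\<^sub>\<le>\<^sub>0}"

text \<open>
  The contours are the line from \<open>c - \<i>\<infinity>\<close> to \<open>c + \<i>\<infinity>\<close> and the loops made of the segment from
  \<open>c + \<i>u\<close> to \<open>c + \<i>v\<close> (with \<open>u < v\<close>) and two horizontal rays: the left loop runs from
  \<open>-\<infinity> + \<i>u\<close> to \<open>-\<infinity> + \<i>v\<close>, the right loop from \<open>+\<infinity> + \<i>u\<close> to \<open>+\<infinity> + \<i>v\<close>. Seen along the direction
  of travel, the inside of the left loop lies to its left and that of the right loop to its right.
  The argument \<open>f\<close> below is the integrand, \<open>A\<close> the left and \<open>B\<close> the right set of poles.
\<close>

definition line_admissible ::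
    "(complex \<Rightarrow> complex) \<Rightarrow> complex set \<Rightarrow> complex set \<Rightarrow> real \<Rightarrow> bool" where
  "line_admissible f A B c \<longleftrightarrow>
     (\<forall>t\<in>A. Re t < c) \<and> (\<forall>t\<in>B. c < Re t) \<and>
     integrable lborel (\<lambda>y. f (Complex c y))"

definition line_value :: "(complex \<Rightarrow> complex) \<Rightarrow> real \<Rightarrow> complex" where
  "line_value f c = 1 / (2 * of_real pi * \<i>) * (\<i> * (LINT y|lborel. f (Complex c y)))"

definition left_loop_admissible ::
    "(complex \<Rightarrow> complex) \<Rightarrow> complex set \<Rightarrow> complex set \<Rightarrow> real \<times> real \<times> real \<Rightarrow> bool" where
  "left_loop_admissible f A B = (\<lambda>(c, u, v).
     u < v \<and>
     (\<forall>t\<in>A. Re t < c \<and> u < Im t \<and> Im t < v) \<and>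
     (\<forall>t\<in>B. \<not> (Re t \<le> c \<and> u \<le> Im t \<and> Im t \<le> v)) \<and>
     set_integrable lborel {..c} (\<lambda>x. f (Complex x u)) \<and>
     set_integrable lborel {..c} (\<lambda>x. f (Complex x v)))"

definition left_loop_value :: "(complex \<Rightarrow> complex) \<Rightarrow> real \<times> real \<times> real \<Rightarrow> complex" where
  "left_loop_value f = (\<lambda>(c, u, v).
     1 / (2 * of_real pi * \<i>) *
       ((LINT x:{..c}|lborel. f (Complex x u)) +
        \<i> * (LINT y:{u..v}|lborel. f (Complex c y)) -
        (LINT x:{..c}|lborel. f (Complex x v))))"

definition right_loop_admissible ::
    "(complex \<Rightarrow> complex) \<Rightarrow> complex set \<Rightarrow> complex set \<Rightarrow> real \<times> real \<times> real \<Rightarrow> bool" where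
  "right_loop_admissible f A B = (\<lambda>(c, u, v).
     u < v \<and>
     (\<forall>t\<in>A. \<not> (c \<le> Re t \<and> u \<le> Im t \<and> Im t \<le> v)) \<and>
     (\<forall>t\<in>B. c < Re t \<and> u < Im t \<and> Im t < v) \<and>
     set_integrable lborel {c..} (\<lambda>x. f (Complex x u)) \<and>
     set_integrable lborel {c..} (\<lambda>x. f (Complex x v)))"

definition right_loop_value :: "(complex \<Rightarrow> complex) \<Rightarrow> real \<times> real \<times> real \<Rightarrow> complex" where
  "right_loop_value f = (\<lambda>(c, u, v).
     1 / (2 * of_real pi * \<i>) *
       (- (LINT x:{c..}|lborel. f (Complex x u)) +
        \<i> * (LINT y:{u..v}|lborel. f (Complex c y)) +
        (LINT x:{c..}|lborel. f (Complex x v))))"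

text \<open>
  A separating contour on which the integral converges absolutely: a line if there is one, otherwise
  a left loop, otherwise a right loop.
  By Cauchy's theorem the choice within one type of contour does not matter.
  The value is 0 if no contour of these shapes is admissible.
\<close>

definition fox_H ::
    "nat \<Rightarrow> nat \<Rightarrow> (complex \<times> real) list \<Rightarrow> (complex \<times> real) list \<Rightarrow> complex \<Rightarrow> complex" where
  "fox_H m n as bs z =
     (let f = fox_H_integrand m n as bs z;
          A = fox_H_left_poles m bs;
          B = fox_H_right_poles n as
      in if \<exists>c. line_admissible f A B c
           then line_value f (SOME c. line_admissible f A B c)
         else if \<exists>k. left_loop_admissible f A B k
           then left_loop_value f (SOME k. left_loop_admissible f A B k)
         else if \<exists>k. right_loop_admissible f A B k
           then right_loop_value f (SOME k. right_loop_admissible f A B k)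
         else 0)"

definition end_snr ::
    "nat \<Rightarrow> real \<Rightarrow> real \<Rightarrow> real \<Rightarrow> (nat \<Rightarrow> 'a \<Rightarrow> real) \<Rightarrow> 'a \<Rightarrow> real" where
  "end_snr L \<eta> p q \<gamma> \<omega> = \<eta> * (1 / real L * (\<Sum>l=1..L. \<gamma> l \<omega> powr p)) powr q"

definition ergodic_capacity :: "'a measure \<Rightarrow> real \<Rightarrow> ('a \<Rightarrow> real) \<Rightarrow> real" where
  "ergodic_capacity M W X = (\<integral>\<omega>. W * log 2 (1 + X \<omega>) \<partial>M)"

definition mgf :: "'a measure \<Rightarrow> ('a \<Rightarrow> real) \<Rightarrow> real \<Rightarrow> real" where
  "mgf M X s = (\<integral>\<omega>. exp (- s * X \<omega>) \<partial>M)"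

definition capacity_kernel :: "nat \<Rightarrow> real \<Rightarrow> real \<Rightarrow> real \<Rightarrow> complex" where
  "capacity_kernel L \<eta> q s =
     - fox_H 1 2
         [(1, 1), (1, 1), (1, (\<bar>q\<bar> + q) / 2)]
         [(1, 1), (0, 1), (0, (\<bar>q\<bar> - q) / 2)]
         (of_real (\<eta> / (real L powr q * s powr q)))"

end

theory Submission
  imports Defs "HOL-Complex_Analysis.Complex_Analysis" "HOL-Real_Asymp.Real_Asymp"
begin

text \<open>
  By the reflection formula the integrand of the H-function is
  \<open>\<pi> / (t sin (\<pi> t)) \<cdot> z\<^bsup>-t\<^esup> / \<Gamma>(1 + q t)\<close> with \<open>z = \<eta> (L s)\<^bsup>-q\<^esup>\<close>. Integrating it against
  \<open>\<sigma> e\<^bsup>-s\<sigma>\<^esup> ds\<close> cancels \<open>\<Gamma>(1 + q t)\<close> and leaves the inverse Mellin transform of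
  \<open>ln (1 + x)\<close> at \<open>x = \<eta> (\<sigma> / L)\<^bsup>q\<^esup>\<close>, so that
  \<open>\<integral> C(s) \<sigma> e\<^bsup>-s\<sigma>\<^esup> ds = - ln (1 + \<eta> (\<sigma> / L)\<^bsup>q\<^esup>)\<close>. By independence the sum of products of moment
  generating functions is \<open>- E[S e\<^bsup>-sS\<^esup>]\<close> for \<open>S = \<Sum>\<^sub>l \<gamma>\<^sub>l\<^bsup>p\<^esup>\<close>, and the theorem follows by
  exchanging expectation and integral.

  For \<open>\<bar>q\<bar> \<le> 2\<close> the contour is a line, and moving it towards the double pole at 0 gives
  \<open>\<bar>C(s)\<bar> \<le> K (1 + ln (1 + z))\<close>, hence the equivalence of the two integrability conditions. For
  \<open>\<bar>q\<bar> > 2\<close> no line is admissible; the contour is a left loop for \<open>q < 0\<close> and a right loop for \<open>q > 0\<close>,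
  the latter being the mirror image of the former. The Laplace transform can then be evaluated
  directly for large \<open>\<sigma>\<close> only, and analytic continuation extends the result to every \<open>\<sigma>\<close> at which the
  integral converges absolutely.
\<close>

section \<open>Growth of the reciprocal Gamma function\<close>

text \<open>
  By Gauss's product this is \<open>\<Prod>\<^sub>k (1 + (y / (a + k))\<^sup>2)\<^bsup>1/2\<^esup>\<close>, which is decreasing and log-convex in
  \<open>a\<close>, and explicit at \<open>a = 1/2\<close> and \<open>a = 1\<close> by the reflection formula.
\<close>
definition rGamma_ratio :: "real \<Rightarrow> real \<Rightarrow> real" where
  "rGamma_ratio a y = norm (Gamma (complex_of_real a) * rGamma (Complex a y))"

lemma norm_rGamma_eq:
  assumes "a > 0"
  shows "norm (rGamma (Complex a y)) = rGamma_ratio a y / Gamma a"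
  using Gamma_real_pos[OF assms]
  by (simp add: rGamma_ratio_def norm_mult Gamma_complex_of_real)

lemma rGamma_ratio_LIMSEQ:
  assumes "a > 0"
  shows "(\<lambda>n. \<Prod>k\<le>n. sqrt (1 + (y / (a + real k))\<^sup>2)) \<longlonglongrightarrow> rGamma_ratio a y"
proof -
  let ?z = "Complex a y" and ?a = "complex_of_real a"
  have ne: "rGamma ?a \<noteq> 0"
    using assms by (simp add: rGamma_complex_of_real rGamma_eq_zero_iff nonpos_Ints_def)
  have lim: "(\<lambda>n. norm (rGamma_series ?z n / rGamma_series ?a n)) \<longlonglongrightarrow> norm (rGamma ?z / rGamma ?a)"
    using ne by (intro tendsto_norm tendsto_divide rGamma_series_LIMSEQ) 
  have "eventually (\<lambda>n. norm (rGamma_series ?z n / rGamma_series ?a n) =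
      (\<Prod>k\<le>n. sqrt (1 + (y / (a + real k))\<^sup>2))) sequentially"
    using eventually_gt_at_top[of 0]
  proof eventually_elim
    case (elim n)
    have e: "norm (exp (?z * of_real (ln (of_nat n)))) = norm (exp (?a * of_real (ln (of_nat n))))"
      by simp
    have "norm (rGamma_series ?z n / rGamma_series ?a n) =
        norm (pochhammer ?z (Suc n)) / norm (pochhammer ?a (Suc n))"
      using elim by (simp add: rGamma_series_def norm_divide norm_mult)
    also have "\<dots> = (\<Prod>k\<le>n. norm (?z + of_nat k) / norm (?a + of_nat k))"
      unfolding pochhammer_prod atLeast0LessThan lessThan_Suc_atMost prod_norm[symmetric] prod_dividef ..
    also have "\<dots> = (\<Prod>k\<le>n. sqrt (1 + (y / (a + real k))\<^sup>2))"
    proof (intro prod.cong refl)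
      fix k :: nat
      have p: "a + real k > 0" using assms by simp
      have "norm (?z + of_nat k) = sqrt ((a + real k)\<^sup>2 + y\<^sup>2)" by (simp add: cmod_def)
      also have "(a + real k)\<^sup>2 + y\<^sup>2 = (a + real k)\<^sup>2 * (1 + (y / (a + real k))\<^sup>2)"
        using p by (simp add: power_divide distrib_left)
      also have "sqrt \<dots> = (a + real k) * sqrt (1 + (y / (a + real k))\<^sup>2)"
        using p by (simp add: real_sqrt_mult)
      finally have 1: "norm (?z + of_nat k) = (a + real k) * sqrt (1 + (y / (a + real k))\<^sup>2)" .
      have "norm (?a + of_nat k) = norm (complex_of_real (a + real k))" by simp
      also have "\<dots> = a + real k" using p by (simp only: norm_of_real)
      finally show "norm (?z + of_nat k) / norm (?a + of_nat k) = sqrt (1 + (y / (a + real k))\<^sup>2)"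
        using p 1 by simp
    qed
    finally show ?case .
  qed
  from Lim_transform_eventually[OF lim this] show ?thesis
    by (simp add: rGamma_ratio_def Gamma_def norm_mult norm_divide norm_inverse field_simps)
qed

lemma rGamma_ratio_nonneg: "0 \<le> rGamma_ratio a y"
  by (simp add: rGamma_ratio_def)

lemma rGamma_ratio_mono:
  assumes "0 < a" "a \<le> b" "\<bar>y\<bar> \<le> \<bar>y'\<bar>"
  shows "rGamma_ratio b y \<le> rGamma_ratio a y'"
proof (rule LIMSEQ_le[OF rGamma_ratio_LIMSEQ rGamma_ratio_LIMSEQ])
  have *: "(y / (b + real k))\<^sup>2 \<le> (y' / (a + real k))\<^sup>2" for k
  proof -
    have "\<bar>y / (b + real k)\<bar> \<le> \<bar>y' / (a + real k)\<bar>"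
      using assms unfolding abs_divide by (intro frac_le) auto
    then show ?thesis by (simp only: abs_le_square_iff)
  qed
  show "\<exists>N. \<forall>n\<ge>N. (\<Prod>k\<le>n. sqrt (1 + (y / (b + real k))\<^sup>2)) \<le> (\<Prod>k\<le>n. sqrt (1 + (y' / (a + real k))\<^sup>2))"
    by (intro exI allI impI prod_mono) (use * in auto)
qed (use assms in auto)

lemma rGamma_ratio_ge_1:
  assumes "0 < a"
  shows "1 \<le> rGamma_ratio a y"
proof -
  have "rGamma_ratio a 0 = 1"
    using assms by (simp add: rGamma_ratio_def complex_of_real_def[symmetric] Gamma_def
        rGamma_complex_of_real rGamma_eq_zero_iff nonpos_Ints_def norm_mult norm_inverse)
  then show ?thesis
    using rGamma_ratio_mono[of a a 0 y] assms by simp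
qed

lemma midpoint_factor_le:
  fixes a b y :: real
  assumes "0 < a" "0 < b" "m = (a + b) / 2"
  shows "(1 + (y / m)\<^sup>2)\<^sup>2 \<le> (1 + (y / a)\<^sup>2) * (1 + (y / b)\<^sup>2)"
proof -
  have m: "m > 0" using assms by simp
  have ab: "a * b \<le> m\<^sup>2"
    using sum_squares_bound[of a b] unfolding assms(3)
    by (simp add: power2_eq_square field_simps)
  have i: "1 / m\<^sup>2 \<le> 1 / (a * b)"
    using ab assms(1,2) m by (intro divide_left_mono) auto
  have "0 \<le> (1 / a - 1 / b)\<^sup>2" by simp
  then have "2 * (1 / (a * b)) \<le> 1 / a\<^sup>2 + 1 / b\<^sup>2"
    by (simp add: power2_diff power_divide)
  then have j: "2 / m\<^sup>2 \<le> 1 / a\<^sup>2 + 1 / b\<^sup>2" using i by simp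
  have k: "(1 / m\<^sup>2)\<^sup>2 \<le> 1 / a\<^sup>2 * (1 / b\<^sup>2)"
    using power_mono[OF i, of 2] m by (simp add: power_divide power_mult_distrib)
  have "(1 + (y / m)\<^sup>2)\<^sup>2 = 1 + y\<^sup>2 * (2 / m\<^sup>2) + (y\<^sup>2)\<^sup>2 * (1 / m\<^sup>2)\<^sup>2"
    by (simp add: power2_sum power_divide power_mult_distrib)
  also have "\<dots> \<le> 1 + y\<^sup>2 * (1 / a\<^sup>2 + 1 / b\<^sup>2) + (y\<^sup>2)\<^sup>2 * (1 / a\<^sup>2 * (1 / b\<^sup>2))"
    by (intro add_mono mult_left_mono j k) auto
  also have "\<dots> = (1 + (y / a)\<^sup>2) * (1 + (y / b)\<^sup>2)"
    by (simp add: power_divide power2_eq_square[of "y\<^sup>2"] algebra_simps)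
  finally show ?thesis .
qed

lemma rGamma_ratio_midpoint:
  assumes "0 < a" "0 < b"
  shows "(rGamma_ratio ((a + b) / 2) y)\<^sup>2 \<le> rGamma_ratio a y * rGamma_ratio b y"
proof (rule LIMSEQ_le)
  let ?P = "\<lambda>a n. \<Prod>k\<le>n. sqrt (1 + (y / (a + real k))\<^sup>2)"
  show "(\<lambda>n. (?P ((a + b) / 2) n)\<^sup>2) \<longlonglongrightarrow> (rGamma_ratio ((a + b) / 2) y)\<^sup>2"
    using assms by (intro tendsto_power rGamma_ratio_LIMSEQ) auto
  show "(\<lambda>n. ?P a n * ?P b n) \<longlonglongrightarrow> rGamma_ratio a y * rGamma_ratio b y"
    using assms by (intro tendsto_mult rGamma_ratio_LIMSEQ) auto
  show "\<exists>N. \<forall>n\<ge>N. (?P ((a + b) / 2) n)\<^sup>2 \<le> ?P a n * ?P b n"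
  proof (intro exI allI impI)
    fix n :: nat
    have "(?P ((a + b) / 2) n)\<^sup>2 = (\<Prod>k\<le>n. 1 + (y / ((a + b) / 2 + real k))\<^sup>2)"
      by (simp add: prod_power_distrib)
    also have "\<dots> \<le> (\<Prod>k\<le>n. sqrt (1 + (y / (a + real k))\<^sup>2) * sqrt (1 + (y / (b + real k))\<^sup>2))"
    proof (intro prod_mono conjI)
      fix k :: nat
      have "(1 + (y / ((a + b) / 2 + real k))\<^sup>2)\<^sup>2
          \<le> (1 + (y / (a + real k))\<^sup>2) * (1 + (y / (b + real k))\<^sup>2)"
        using assms by (intro midpoint_factor_le) (auto simp: field_simps)
      then show "1 + (y / ((a + b) / 2 + real k))\<^sup>2
          \<le> sqrt (1 + (y / (a + real k))\<^sup>2) * sqrt (1 + (y / (b + real k))\<^sup>2)"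
        by (simp add: real_le_rsqrt flip: real_sqrt_mult)
    qed simp
    finally show "(?P ((a + b) / 2) n)\<^sup>2 \<le> ?P a n * ?P b n"
      by (simp add: prod.distrib)
  qed
qed

lemma norm_sin_complex_squared:
  "(norm (sin (Complex x y)))\<^sup>2 = (sin x)\<^sup>2 + (sinh y)\<^sup>2"
proof -
  have "(norm (sin (Complex x y)))\<^sup>2 = (exp (2 * y) + inverse (exp (2 * y)) - 2 * cos (2 * x)) / 4"
    by (simp add: norm_sin_squared)
  also have "\<dots> = (exp y - exp (- y))\<^sup>2 / 4 + (1 - cos (2 * x)) / 2"
  proof -
    have "exp (2 * y) = (exp y)\<^sup>2" "inverse (exp (2 * y)) = (exp (- y))\<^sup>2" "exp y * exp (- y) = 1"
      by (simp_all add: power2_eq_square flip: exp_minus exp_add)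
    then show ?thesis by (simp add: power2_diff field_simps)
  qed
  also have "\<dots> = (sinh y)\<^sup>2 + (sin x)\<^sup>2"
    by (simp add: sinh_def cos_double_sin power_divide)
  finally show ?thesis by simp
qed


lemma cnj_Complex: "cnj (Complex a b) = Complex a (- b)"
  by (simp add: complex_eq_iff)

lemma rGamma_ratio_half: "rGamma_ratio (1/2) y = sqrt (cosh (pi * y))"
proof -
  let ?z = "Complex (1/2) y"
  have "rGamma ?z * rGamma (1 - ?z) = sin (of_real pi * ?z) / of_real pi"
    by (rule rGamma_reflection_complex)
  also have "1 - ?z = cnj ?z" by (simp add: complex_eq_iff)
  finally have "norm (rGamma ?z * cnj (rGamma ?z)) = norm (sin (of_real pi * ?z)) / pi"
    by (simp add: norm_divide flip: cnj_rGamma)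
  moreover have "norm (sin (of_real pi * ?z)) = cosh (pi * y)"
  proof -
    have "of_real pi * ?z = Complex (pi / 2) (pi * y)" by (simp add: complex_eq_iff)
    then have "(norm (sin (of_real pi * ?z)))\<^sup>2 = (cosh (pi * y))\<^sup>2"
      by (simp add: norm_sin_complex_squared cosh_square_eq)
    then show ?thesis by (simp add: cosh_real_pos less_imp_le power2_eq_iff_nonneg)
  qed
  ultimately have "(norm (rGamma ?z))\<^sup>2 = cosh (pi * y) / pi"
    by (simp add: norm_mult power2_eq_square)
  then have "(rGamma_ratio (1/2) y)\<^sup>2 = cosh (pi * y)"
    unfolding rGamma_ratio_def norm_mult power_mult_distrib Gamma_complex_of_real Gamma_one_half_real
    by simp
  then show ?thesis
    by (metis abs_of_nonneg real_sqrt_abs rGamma_ratio_nonneg)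
qed

lemma rGamma_ratio_one: "(rGamma_ratio 1 y)\<^sup>2 * (pi * \<bar>y\<bar>) = sinh (pi * \<bar>y\<bar>)"
proof (cases "y = 0")
  case False
  let ?z = "Complex 0 y"
  have "rGamma ?z * rGamma (1 - ?z) = sin (of_real pi * ?z) / of_real pi"
    by (rule rGamma_reflection_complex)
  also have "1 - ?z = cnj (Complex 1 y)" by (simp add: complex_eq_iff)
  also have "rGamma ?z = ?z * rGamma (Complex 1 y)"
    using rGamma_plus1[of ?z] by (simp add: plus_complex.code one_complex.code add.commute)
  finally have "norm (?z * rGamma (Complex 1 y) * cnj (rGamma (Complex 1 y))) = norm (sin (of_real pi * ?z)) / pi"
    by (simp add: norm_divide flip: cnj_rGamma)
  moreover have "norm (sin (of_real pi * ?z)) = sinh (pi * \<bar>y\<bar>)"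
  proof -
    have "of_real pi * ?z = Complex 0 (pi * y)" by (simp add: complex_eq_iff)
    then have "(norm (sin (of_real pi * ?z)))\<^sup>2 = (sinh (pi * \<bar>y\<bar>))\<^sup>2"
      by (cases "y \<ge> 0") (simp_all add: norm_sin_complex_squared)
    then show ?thesis by (simp add: power2_eq_iff_nonneg)
  qed
  moreover have "norm ?z = \<bar>y\<bar>" by (simp add: cmod_def)
  ultimately have "\<bar>y\<bar> * (norm (rGamma (Complex 1 y)))\<^sup>2 * pi = sinh (pi * \<bar>y\<bar>)"
    by (simp add: norm_mult power2_eq_square field_simps)
  then show ?thesis
    by (simp add: rGamma_ratio_def mult_ac)
qed simp

lemma rGamma_ratio_half_le: "rGamma_ratio (1/2) y \<le> exp (pi * \<bar>y\<bar> / 2)"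
proof -
  have "cosh (pi * y) = cosh (pi * \<bar>y\<bar>)" by (cases "y \<ge> 0") auto
  also have "\<dots> \<le> exp (pi * \<bar>y\<bar>)" by (simp add: cosh_def)
  also have "\<dots> = (exp (pi * \<bar>y\<bar> / 2))\<^sup>2" by (simp flip: exp_double)
  finally show ?thesis unfolding rGamma_ratio_half by (intro real_le_lsqrt) auto
qed

lemma rGamma_ratio_one_le:
  assumes "\<bar>y\<bar> \<ge> 1"
  shows "rGamma_ratio 1 y \<le> exp (pi * \<bar>y\<bar> / 2) / sqrt \<bar>y\<bar>"
proof (rule power2_le_imp_le)
  have "(rGamma_ratio 1 y)\<^sup>2 * (pi * \<bar>y\<bar>) \<le> exp (pi * \<bar>y\<bar>) / 2"
    unfolding rGamma_ratio_one by (simp add: sinh_def)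
  then have "(rGamma_ratio 1 y)\<^sup>2 \<le> exp (pi * \<bar>y\<bar>) / (2 * pi * \<bar>y\<bar>)"
    using assms by (simp add: field_simps)
  also have "\<dots> \<le> exp (pi * \<bar>y\<bar>) / (1 * \<bar>y\<bar>)"
    using assms pi_gt3 by (intro divide_left_mono mult_right_mono) auto
  also have "\<dots> = (exp (pi * \<bar>y\<bar> / 2) / sqrt \<bar>y\<bar>)\<^sup>2"
    using assms by (simp add: power_divide flip: exp_double)
  finally show "(rGamma_ratio 1 y)\<^sup>2 \<le> (exp (pi * \<bar>y\<bar> / 2) / sqrt \<bar>y\<bar>)\<^sup>2" .
qed simp

lemma sinh_ge_exp: "exp x / 4 \<le> sinh x" if "x \<ge> 1" for x :: real
proof -
  have "exp (- x) \<le> exp (- 1)" "exp 1 \<le> exp x" using that by simp_all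
  moreover have "exp (- 1 :: real) \<le> 1 / 2" "exp 1 \<ge> (2::real)"
    using exp_ge_add_one_self[of "1::real"] by (auto simp: exp_minus field_simps)
  ultimately have "exp (- x) \<le> exp x / 2" by linarith
  then show ?thesis by (simp add: sinh_def)
qed

lemma pi_abs_ge_1: "1 \<le> pi * \<bar>y\<bar>" if "\<bar>y\<bar> \<ge> 1"
proof -
  have "1 * 1 \<le> pi * \<bar>y\<bar>" using that pi_gt3 by (intro mult_mono) auto
  then show ?thesis by simp
qed

lemma rGamma_ratio_one_ge:
  assumes "\<bar>y\<bar> \<ge> 1"
  shows "exp (pi * \<bar>y\<bar> / 2) / (4 * sqrt \<bar>y\<bar>) \<le> rGamma_ratio 1 y"
proof (rule power2_le_imp_le)
  have "exp (pi * \<bar>y\<bar>) / 4 \<le> sinh (pi * \<bar>y\<bar>)" by (intro sinh_ge_exp pi_abs_ge_1 assms)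
  then have "exp (pi * \<bar>y\<bar>) / 4 \<le> (rGamma_ratio 1 y)\<^sup>2 * (pi * \<bar>y\<bar>)"
    unfolding rGamma_ratio_one .
  then have "exp (pi * \<bar>y\<bar>) / (4 * pi * \<bar>y\<bar>) \<le> (rGamma_ratio 1 y)\<^sup>2"
    using assms by (simp add: field_simps)
  moreover have "exp (pi * \<bar>y\<bar>) / (16 * \<bar>y\<bar>) \<le> exp (pi * \<bar>y\<bar>) / (4 * pi * \<bar>y\<bar>)"
    using assms pi_less_4 by (intro divide_left_mono mult_right_mono) auto
  moreover have "(exp (pi * \<bar>y\<bar> / 2) / (4 * sqrt \<bar>y\<bar>))\<^sup>2 = exp (pi * \<bar>y\<bar>) / (16 * \<bar>y\<bar>)"
    using assms by (simp add: power_divide power_mult_distrib flip: exp_double)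
  ultimately show "(exp (pi * \<bar>y\<bar> / 2) / (4 * sqrt \<bar>y\<bar>))\<^sup>2 \<le> (rGamma_ratio 1 y)\<^sup>2" by simp
qed (rule rGamma_ratio_nonneg)

lemma rGamma_ratio_three_quarters_le:
  assumes "\<bar>y\<bar> \<ge> 1"
  shows "rGamma_ratio (3/4) y \<le> exp (pi * \<bar>y\<bar> / 2) * \<bar>y\<bar> powr (- 1/4)"
proof (rule power2_le_imp_le)
  have "(rGamma_ratio (3/4) y)\<^sup>2 \<le> rGamma_ratio (1/2) y * rGamma_ratio 1 y"
    using rGamma_ratio_midpoint[of "1/2" 1 y] by simp
  also have "\<dots> \<le> exp (pi * \<bar>y\<bar> / 2) * (exp (pi * \<bar>y\<bar> / 2) / sqrt \<bar>y\<bar>)"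
    by (intro mult_mono rGamma_ratio_half_le rGamma_ratio_one_le assms rGamma_ratio_nonneg) auto
  also have "\<dots> = (exp (pi * \<bar>y\<bar> / 2) * \<bar>y\<bar> powr (- 1/4))\<^sup>2"
    using assms by (simp add: power_mult_distrib power2_eq_square powr_minus powr_half_sqrt field_simps
        flip: powr_add)
  finally show "(rGamma_ratio (3/4) y)\<^sup>2 \<le> (exp (pi * \<bar>y\<bar> / 2) * \<bar>y\<bar> powr (- 1/4))\<^sup>2" .
qed simp

lemma inverse_Gamma_bounded:
  fixes a b :: real
  assumes "0 < a"
  obtains K where "K > 0" "\<And>x. a \<le> x \<Longrightarrow> x \<le> b \<Longrightarrow> 1 / Gamma x \<le> K"
proof -
  have "compact (rGamma ` {a..b::real})"
    by (intro compact_continuous_image continuous_intros) auto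
  then obtain B where B: "B > 0" "\<And>x. x \<in> {a..b} \<Longrightarrow> \<bar>rGamma x\<bar> \<le> B"
    by (auto dest!: compact_imp_bounded simp: bounded_pos)
  show ?thesis
    using B(1) B(2)[unfolded rGamma_inverse_Gamma] by (intro that[of B]) (force simp: divide_simps)+
qed

lemma rGamma_Complex_recurrence: "rGamma (Complex a y) = Complex a y * rGamma (Complex (a + 1) y)"
  using rGamma_plus1[of "Complex a y"] by (simp add: plus_complex.code one_complex.code)

lemma sqrt_le_self: "sqrt x \<le> x" if "x \<ge> 1" for x :: real
  using that mult_left_mono[of 1 x x] by (intro real_le_lsqrt) (auto simp: power2_eq_square)

lemma norm_rGamma_le_nonneg:
  fixes A :: real
  obtains K where "K > 0"
    "\<And>a y. 0 \<le> a \<Longrightarrow> a \<le> A \<Longrightarrow> \<bar>y\<bar> \<ge> 1 \<Longrightarrow>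
      norm (rGamma (Complex a y)) \<le> K * (sqrt \<bar>y\<bar> * exp (pi * \<bar>y\<bar> / 2))"
proof -
  obtain K where K: "K > 0" "\<And>x. 1 \<le> x \<Longrightarrow> x \<le> A + 1 \<Longrightarrow> 1 / Gamma x \<le> K"
    using inverse_Gamma_bounded[of 1 "A + 1"] by auto
  show ?thesis
  proof (rule that[of "(\<bar>A\<bar> + 1) * K"])
    fix a y :: real assume a: "0 \<le> a" "a \<le> A" and y: "\<bar>y\<bar> \<ge> 1"
    have "norm (rGamma (Complex (a + 1) y)) = rGamma_ratio (a + 1) y * (1 / Gamma (a + 1))"
      using a by (subst norm_rGamma_eq) auto
    also have "\<dots> \<le> rGamma_ratio 1 y * K"
      using a K Gamma_real_pos[of "a + 1"] by (intro mult_mono rGamma_ratio_mono rGamma_ratio_nonneg) auto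
    also have "\<dots> \<le> exp (pi * \<bar>y\<bar> / 2) / sqrt \<bar>y\<bar> * K"
      using K y by (intro mult_right_mono rGamma_ratio_one_le) auto
    finally have 1: "norm (rGamma (Complex (a + 1) y)) \<le> exp (pi * \<bar>y\<bar> / 2) / sqrt \<bar>y\<bar> * K" .
    have "norm (Complex a y) \<le> \<bar>a\<bar> + \<bar>y\<bar>" using cmod_le[of "Complex a y"] by simp
    also have "\<dots> \<le> \<bar>A\<bar> * \<bar>y\<bar> + 1 * \<bar>y\<bar>" using a y mult_left_mono[of 1 "\<bar>y\<bar>" "\<bar>A\<bar>"] by linarith
    finally have 2: "norm (Complex a y) \<le> (\<bar>A\<bar> + 1) * \<bar>y\<bar>" by (simp add: distrib_right)
    have "norm (rGamma (Complex a y)) \<le> ((\<bar>A\<bar> + 1) * \<bar>y\<bar>) * (exp (pi * \<bar>y\<bar> / 2) / sqrt \<bar>y\<bar> * K)"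
      unfolding rGamma_Complex_recurrence[of a] norm_mult by (intro mult_mono 1 2) auto
    also have "\<dots> = (\<bar>A\<bar> + 1) * K * (sqrt \<bar>y\<bar> * exp (pi * \<bar>y\<bar> / 2))"
    proof -
      have "((\<bar>A\<bar> + 1) * \<bar>y\<bar>) * (exp (pi * \<bar>y\<bar> / 2) / sqrt \<bar>y\<bar> * K)
          = (\<bar>A\<bar> + 1) * K * (\<bar>y\<bar> / sqrt \<bar>y\<bar> * exp (pi * \<bar>y\<bar> / 2))" by simp
      then show ?thesis by (simp only: real_div_sqrt abs_ge_zero)
    qed
    finally show "norm (rGamma (Complex a y)) \<le> (\<bar>A\<bar> + 1) * K * (sqrt \<bar>y\<bar> * exp (pi * \<bar>y\<bar> / 2))" .
  qed (use K in auto)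
qed

lemma norm_rGamma_le_ge_minus_one:
  fixes A :: real
  obtains K where "K > 0"
    "\<And>a y. -1 \<le> a \<Longrightarrow> a \<le> A \<Longrightarrow> \<bar>y\<bar> \<ge> 1 \<Longrightarrow>
      norm (rGamma (Complex a y)) \<le> K * (\<bar>y\<bar>\<^sup>2 * exp (pi * \<bar>y\<bar> / 2))"
proof -
  obtain K where K: "K > 0" "\<And>a y. 0 \<le> a \<Longrightarrow> a \<le> A + 1 \<Longrightarrow> \<bar>y\<bar> \<ge> 1 \<Longrightarrow>
      norm (rGamma (Complex a y)) \<le> K * (sqrt \<bar>y\<bar> * exp (pi * \<bar>y\<bar> / 2))"
    by (rule norm_rGamma_le_nonneg[of "A + 1"]) blast
  show ?thesis
  proof (rule that[of "(\<bar>A\<bar> + 2) * K"])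
    fix a y :: real assume a: "-1 \<le> a" "a \<le> A" and y: "\<bar>y\<bar> \<ge> 1"
    have "norm (Complex a y) \<le> \<bar>a\<bar> + \<bar>y\<bar>" using cmod_le[of "Complex a y"] by simp
    also have "\<dots> \<le> (\<bar>A\<bar> + 1) * \<bar>y\<bar> + 1 * \<bar>y\<bar>"
      using a y mult_left_mono[of 1 "\<bar>y\<bar>" "\<bar>A\<bar> + 1"] by (simp add: distrib_right)
    finally have 2: "norm (Complex a y) \<le> (\<bar>A\<bar> + 2) * \<bar>y\<bar>" by (simp add: distrib_right)
    have 3: "sqrt \<bar>y\<bar> \<le> \<bar>y\<bar>" using y by (rule sqrt_le_self)
    have "norm (rGamma (Complex a y)) \<le> ((\<bar>A\<bar> + 2) * \<bar>y\<bar>) * (K * (sqrt \<bar>y\<bar> * exp (pi * \<bar>y\<bar> / 2)))"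
      unfolding rGamma_Complex_recurrence[of a] norm_mult using a y by (intro mult_mono K 2) auto
    also have "\<dots> \<le> ((\<bar>A\<bar> + 2) * \<bar>y\<bar>) * (K * (\<bar>y\<bar> * exp (pi * \<bar>y\<bar> / 2)))"
      using 3 K by (intro mult_left_mono mult_right_mono) auto
    finally show "norm (rGamma (Complex a y)) \<le> (\<bar>A\<bar> + 2) * K * (\<bar>y\<bar>\<^sup>2 * exp (pi * \<bar>y\<bar> / 2))"
      by (simp add: power2_eq_square mult_ac)
  qed (use K in auto)
qed

lemma norm_rGamma_ge_nat:
  assumes "m \<ge> 1"
  shows "\<exists>K>0. \<exists>n. \<forall>y. \<bar>y\<bar> \<ge> 1 \<longrightarrow> K * (exp (pi * \<bar>y\<bar> / 2) / \<bar>y\<bar> ^ n) \<le> norm (rGamma (Complex (real m) y))"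
  using assms
proof (induction m rule: dec_induct)
  case base
  show ?case
  proof (rule exI[of _ "1/4"], intro conjI exI[of _ 1] allI impI)
    fix y :: real assume y: "\<bar>y\<bar> \<ge> 1"
    have "sqrt \<bar>y\<bar> \<le> \<bar>y\<bar>" using y by (rule sqrt_le_self)
    then have "1/4 * (exp (pi * \<bar>y\<bar> / 2) / \<bar>y\<bar>) \<le> exp (pi * \<bar>y\<bar> / 2) / (4 * sqrt \<bar>y\<bar>)"
      using y by (simp add: frac_le)
    also have "\<dots> \<le> rGamma_ratio 1 y" by (rule rGamma_ratio_one_ge[OF y])
    finally show "1/4 * (exp (pi * \<bar>y\<bar> / 2) / \<bar>y\<bar> ^ 1) \<le> norm (rGamma (Complex (real 1) y))"
      by (simp add: norm_rGamma_eq)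
  qed simp
next
  case (step m)
  then obtain K n where K: "K > 0" and le:
    "\<And>y. \<bar>y\<bar> \<ge> 1 \<Longrightarrow> K * (exp (pi * \<bar>y\<bar> / 2) / \<bar>y\<bar> ^ n) \<le> norm (rGamma (Complex (real m) y))" by blast
  show ?case
  proof (rule exI[of _ "K / (real m + 1)"], intro conjI exI[of _ "Suc n"] allI impI)
    fix y :: real assume y: "\<bar>y\<bar> \<ge> 1"
    have "norm (Complex (real m) y) \<le> real m + \<bar>y\<bar>" using cmod_le[of "Complex (real m) y"] by simp
    also have "\<dots> \<le> real m * \<bar>y\<bar> + 1 * \<bar>y\<bar>"
      using y mult_left_mono[of 1 "\<bar>y\<bar>" "real m"] by linarith
    finally have "norm (Complex (real m) y) \<le> (real m + 1) * \<bar>y\<bar>" by (simp add: distrib_right)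
    then have "norm (rGamma (Complex (real m) y)) \<le> (real m + 1) * \<bar>y\<bar> * norm (rGamma (Complex (real m + 1) y))"
      unfolding rGamma_Complex_recurrence[of "real m"] norm_mult by (intro mult_right_mono) auto
    with le[OF y] have "K * (exp (pi * \<bar>y\<bar> / 2) / \<bar>y\<bar> ^ n) \<le> (real m + 1) * \<bar>y\<bar> * norm (rGamma (Complex (real m + 1) y))"
      by linarith
    then have "K * (exp (pi * \<bar>y\<bar> / 2) / \<bar>y\<bar> ^ n) / ((real m + 1) * \<bar>y\<bar>) \<le> norm (rGamma (Complex (real m + 1) y))"
      using y by (subst pos_divide_le_eq) (auto simp: mult_ac)
    then show "K / (real m + 1) * (exp (pi * \<bar>y\<bar> / 2) / \<bar>y\<bar> ^ Suc n) \<le> norm (rGamma (Complex (real (Suc m)) y))"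
      by (simp add: field_simps)
  qed (use K in auto)
qed

lemma norm_rGamma_ge_pos:
  assumes "a > 0"
  shows "\<exists>K>0. \<exists>n. \<forall>y. \<bar>y\<bar> \<ge> 1 \<longrightarrow> K * (exp (pi * \<bar>y\<bar> / 2) / \<bar>y\<bar> ^ n) \<le> norm (rGamma (Complex a y))"
proof -
  define m where "m = Suc (nat \<lceil>a\<rceil>)"
  have m: "m \<ge> 1" "a \<le> real m" by (auto simp: m_def) linarith
  obtain K n where K: "K > 0" and le:
    "\<And>y. \<bar>y\<bar> \<ge> 1 \<Longrightarrow> K * (exp (pi * \<bar>y\<bar> / 2) / \<bar>y\<bar> ^ n) \<le> norm (rGamma (Complex (real m) y))"
    using norm_rGamma_ge_nat[OF m(1)] by blast
  have G: "Gamma a > 0" "Gamma (real m) > 0" using assms m by (auto intro!: Gamma_real_pos)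
  show ?thesis
  proof (rule exI[of _ "K * (Gamma (real m) / Gamma a)"], intro conjI exI[of _ n] allI impI)
    fix y :: real assume y: "\<bar>y\<bar> \<ge> 1"
    have "K * (exp (pi * \<bar>y\<bar> / 2) / \<bar>y\<bar> ^ n) * Gamma (real m) \<le> rGamma_ratio (real m) y"
      using le[OF y] G m by (simp add: norm_rGamma_eq field_simps)
    also have "\<dots> \<le> rGamma_ratio a y" using assms m by (intro rGamma_ratio_mono) auto
    finally have "K * (exp (pi * \<bar>y\<bar> / 2) / \<bar>y\<bar> ^ n) * Gamma (real m) / Gamma a \<le> rGamma_ratio a y / Gamma a"
      using G by (intro divide_right_mono) auto
    then show "K * (Gamma (real m) / Gamma a) * (exp (pi * \<bar>y\<bar> / 2) / \<bar>y\<bar> ^ n) \<le> norm (rGamma (Complex a y))"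
      using assms by (simp add: norm_rGamma_eq mult_ac)
  qed (use K G in auto)
qed

lemma norm_rGamma_ge:
  "\<exists>K>0. \<exists>n. \<forall>y. \<bar>y\<bar> \<ge> 1 \<longrightarrow> K * (exp (pi * \<bar>y\<bar> / 2) / \<bar>y\<bar> ^ n) \<le> norm (rGamma (Complex a y))"
proof -
  have "\<exists>K>0. \<exists>n. \<forall>y. \<bar>y\<bar> \<ge> 1 \<longrightarrow> K * (exp (pi * \<bar>y\<bar> / 2) / \<bar>y\<bar> ^ n) \<le> norm (rGamma (Complex a y))"
    if "a + real k > 0" for k
    using that
  proof (induction k arbitrary: a)
    case 0
    then show ?case using norm_rGamma_ge_pos[of a] by simp
  next
    case (Suc k)
    from Suc.IH[of "a + 1"] Suc.prems obtain K n where K: "K > 0" and le: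
      "\<And>y. \<bar>y\<bar> \<ge> 1 \<Longrightarrow> K * (exp (pi * \<bar>y\<bar> / 2) / \<bar>y\<bar> ^ n) \<le> norm (rGamma (Complex (a + 1) y))"
      by (auto simp: add_ac)
    show ?case
    proof (rule exI[of _ K], intro conjI exI[of _ n] allI impI)
      fix y :: real assume y: "\<bar>y\<bar> \<ge> 1"
      have "1 \<le> norm (Complex a y)" using y abs_Im_le_cmod[of "Complex a y"] by simp
      then have "1 * norm (rGamma (Complex (a + 1) y)) \<le> norm (rGamma (Complex a y))"
        unfolding rGamma_Complex_recurrence[of a] norm_mult by (intro mult_right_mono) auto
      with le[OF y] show "K * (exp (pi * \<bar>y\<bar> / 2) / \<bar>y\<bar> ^ n) \<le> norm (rGamma (Complex a y))" by simp
    qed (rule K)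
  qed
  moreover have "a + real (nat \<lceil>- a\<rceil> + 1) > 0" by linarith
  ultimately show ?thesis by blast
qed

lemma norm_rGamma_ge_neg:
  assumes "-1 < a" "a < 0"
  shows "\<exists>K>0. \<forall>y. \<bar>y\<bar> \<ge> 1 \<longrightarrow> K * (sqrt \<bar>y\<bar> * exp (pi * \<bar>y\<bar> / 2)) \<le> norm (rGamma (Complex a y))"
proof (rule exI[of _ "1 / (4 * Gamma (a + 1))"], intro conjI allI impI)
  have G: "Gamma (a + 1) > 0" using assms by (intro Gamma_real_pos) auto
  then show "0 < 1 / (4 * Gamma (a + 1))" by simp
  fix y :: real assume y: "\<bar>y\<bar> \<ge> 1"
  have "1 / (4 * Gamma (a + 1)) * (sqrt \<bar>y\<bar> * exp (pi * \<bar>y\<bar> / 2))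
      = \<bar>y\<bar> * (exp (pi * \<bar>y\<bar> / 2) / (4 * sqrt \<bar>y\<bar>) / Gamma (a + 1))"
  proof -
    have "\<bar>y\<bar> * (exp (pi * \<bar>y\<bar> / 2) / (4 * sqrt \<bar>y\<bar>) / Gamma (a + 1))
        = 1 / (4 * Gamma (a + 1)) * (\<bar>y\<bar> / sqrt \<bar>y\<bar> * exp (pi * \<bar>y\<bar> / 2))" by simp
    then show ?thesis by (simp only: real_div_sqrt abs_ge_zero)
  qed
  also have "\<dots> \<le> \<bar>y\<bar> * (rGamma_ratio 1 y / Gamma (a + 1))"
    using rGamma_ratio_one_ge[OF y] G by (intro mult_left_mono divide_right_mono) auto
  also have "\<dots> \<le> \<bar>y\<bar> * (rGamma_ratio (a + 1) y / Gamma (a + 1))"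
    using assms G by (intro mult_left_mono divide_right_mono rGamma_ratio_mono) auto
  also have "\<dots> = \<bar>y\<bar> * norm (rGamma (Complex (a + 1) y))"
    using assms by (subst norm_rGamma_eq) auto
  also have "\<dots> \<le> norm (rGamma (Complex a y))"
    unfolding rGamma_Complex_recurrence[of a] norm_mult
    using abs_Im_le_cmod[of "Complex a y"] by (intro mult_right_mono) auto
  finally show "1 / (4 * Gamma (a + 1)) * (sqrt \<bar>y\<bar> * exp (pi * \<bar>y\<bar> / 2)) \<le> norm (rGamma (Complex a y))" .
qed

section \<open>The integrand of the H-function\<close>

lemma borel_measurable_Complex [measurable (raw)]:
  assumes "f \<in> borel_measurable M" "g \<in> borel_measurable M"
  shows "(\<lambda>x. Complex (f x) (g x)) \<in> borel_measurable M"
  using assms unfolding Complex_eq by measurable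

lemma borel_measurable_rGamma [measurable (raw)]:
  assumes "f \<in> borel_measurable M"
  shows "(\<lambda>x. rGamma (f x :: complex)) \<in> borel_measurable M"
  using assms by (rule measurable_compose)
    (rule borel_measurable_continuous_onI, rule holomorphic_on_imp_continuous_on, rule holomorphic_rGamma)

lemma borel_measurable_sin_complex [measurable (raw)]:
  assumes "f \<in> borel_measurable M"
  shows "(\<lambda>x. sin (f x :: complex)) \<in> borel_measurable M"
  using assms by (rule measurable_compose) (intro borel_measurable_continuous_onI continuous_intros)

definition mellin_log :: "complex \<Rightarrow> complex" where
  "mellin_log t = of_real pi / (t * sin (of_real pi * t))"

text \<open>For \<open>q = 0\<close> this is the Mellin--Barnes integrand of \<open>ln (1 + z)\<close>.\<close>
definition capacity_integrand :: "real \<Rightarrow> real \<Rightarrow> complex \<Rightarrow> complex" where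
  "capacity_integrand q z t = mellin_log t * rGamma (1 + of_real q * t) * exp (- t * of_real (ln z))"

lemma borel_measurable_capacity_integrand [measurable (raw)]:
  assumes "f \<in> borel_measurable M" "g \<in> borel_measurable M"
  shows "(\<lambda>x. capacity_integrand q (g x) (f x)) \<in> borel_measurable M"
  using assms unfolding capacity_integrand_def mellin_log_def by measurable

lemma capacity_integrand_uminus:
  assumes "z > 0"
  shows "capacity_integrand q z (- t) = capacity_integrand (- q) (1 / z) t"
  using assms by (simp add: capacity_integrand_def mellin_log_def ln_div)

lemma sin_pi_eq_0_iff: "sin (complex_of_real pi * t) = 0 \<longleftrightarrow> t \<in> \<int>"
proof -
  have "complex_of_real pi * t = of_real (of_int n * pi) \<longleftrightarrow> t = of_int n" for n
    unfolding of_real_mult of_real_of_int_eq mult.commute[of "complex_of_int n"] by simp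
  then have "sin (complex_of_real pi * t) = 0 \<longleftrightarrow> (\<exists>n::int. t = of_int n)"
    unfolding sin_eq_0 by blast
  then show ?thesis by (metis Ints_cases Ints_of_int)
qed

lemma mellin_log_eq_Gamma:
  assumes "t \<notin> \<int>"
  shows "mellin_log t = Gamma (1 + t) * Gamma (- t) * Gamma (- t) / Gamma (1 - t)"
proof -
  have t: "t \<noteq> 0" "- t \<noteq> 0" "Gamma (- t) \<noteq> 0"
    using assms nonpos_Ints_Int[of "- t"] Ints_0 by (auto simp only: Gamma_eq_zero_iff minus_in_Ints_iff neg_equal_0_iff_equal)
  have "t \<notin> \<int>\<^sub>\<le>\<^sub>0" "- t \<notin> \<int>\<^sub>\<le>\<^sub>0"
    using assms nonpos_Ints_Int[of t] nonpos_Ints_Int[of "- t"] by (metis minus_in_Ints_iff)+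
  then have "Gamma (t + 1) = t * Gamma t" "Gamma (- t + 1) = - t * Gamma (- t)"
    by (simp_all only: Gamma_plus1 not_False_eq_True)
  then have "Gamma (1 + t) * Gamma (- t) * Gamma (- t) / Gamma (1 - t) = - (Gamma t * Gamma (- t))"
    using t by (simp add: add.commute[of 1] divide_simps)
  also have "\<dots> = mellin_log t"
    by (simp add: Gamma_reflection_complex' mellin_log_def)
  finally show ?thesis ..
qed

lemma fox_H_integrand_eq:
  assumes "z > 0" "t \<notin> \<int>"
  shows "fox_H_integrand 1 2 [(1, 1), (1, 1), (1, (\<bar>q\<bar> + q) / 2)] [(1, 1), (0, 1), (0, (\<bar>q\<bar> - q) / 2)]
      (of_real z) t = capacity_integrand q z t"
proof -
  have p: "of_real z powr (- t) = exp (- t * of_real (ln z))"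
    using assms(1) by (simp add: powr_def Ln_of_real)
  have P: "(\<Prod>j<1. F j) = F 0" "(\<Prod>j<2. F j) = F 0 * F 1"
    "(\<Prod>j=2..<length [a, b, c]. F j) = F 2" "(\<Prod>j=1..<length [a, b, c]. F j) = F 1 * F 2"
    for F :: "nat \<Rightarrow> complex" and a b c :: "complex \<times> real"
    by (simp_all add: numeral_2_eq_2 numeral_3_eq_3 atLeastLessThanSuc)
  have N: "[a, b, c] ! 0 = a" "[a, b, c] ! 1 = b" "[a, b, c] ! 2 = c" for a b c :: "complex \<times> real"
    by simp_all
  have G: "Gamma (1 + of_real ((\<bar>q\<bar> + q) / 2) * t) * Gamma (1 - of_real ((\<bar>q\<bar> - q) / 2) * t)
      = Gamma (1 + of_real q * t)"
    by (cases "q \<ge> 0") auto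
  have "fox_H_integrand 1 2 [(1, 1), (1, 1), (1, (\<bar>q\<bar> + q) / 2)] [(1, 1), (0, 1), (0, (\<bar>q\<bar> - q) / 2)]
      (of_real z) t =
     Gamma (1 + t) * Gamma (- t) * Gamma (- t) / Gamma (1 - t) *
      inverse (Gamma (1 + of_real ((\<bar>q\<bar> + q) / 2) * t) * Gamma (1 - of_real ((\<bar>q\<bar> - q) / 2) * t)) *
      of_real z powr (- t)"
    unfolding fox_H_integrand_def P N fst_conv snd_conv
    by simp (simp only: divide_inverse inverse_mult_distrib mult_ac)
  also have "\<dots> = capacity_integrand q z t"
    by (simp only: G p capacity_integrand_def mellin_log_eq_Gamma[OF assms(2)] rGamma_inverse_Gamma)
  finally show ?thesis .
qed

lemma fox_H_left_poles_eq: "fox_H_left_poles 1 [(1, 1), (0, 1), (0, r)] = {t. 1 + t \<in> \<int>\<^sub>\<le>\<^sub>0}"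
  by (simp add: fox_H_left_poles_def)

lemma fox_H_right_poles_eq: "fox_H_right_poles 2 [(1, 1), (1, 1), (1, r)] = {t. - t \<in> \<int>\<^sub>\<le>\<^sub>0}"
  by (auto simp: fox_H_right_poles_def less_2_cases_iff)

lemma fox_H_poles_cases:
  obtains "-1 \<in> fox_H_left_poles 1 [(1, 1), (0, 1), (0, r)]"
    "0 \<in> fox_H_right_poles 2 [(1, 1), (1, 1), (1, r')]"
    "\<And>t. t \<in> fox_H_left_poles 1 [(1, 1), (0, 1), (0, r)] \<Longrightarrow> Re t \<le> -1 \<and> Im t = 0"
    "\<And>t. t \<in> fox_H_right_poles 2 [(1, 1), (1, 1), (1, r')] \<Longrightarrow> Re t \<ge> 0 \<and> Im t = 0"
proof (rule that)
  fix t assume "t \<in> fox_H_left_poles 1 [(1, 1), (0, 1), (0, r)]"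
  then obtain n where "1 + t = - of_nat n" unfolding fox_H_left_poles_eq by (auto elim: nonpos_Ints_cases')
  then have "t = of_real (- real n - 1)" by (simp add: algebra_simps eq_neg_iff_add_eq_0)
  then show "Re t \<le> -1 \<and> Im t = 0" by simp
next
  fix t assume "t \<in> fox_H_right_poles 2 [(1, 1), (1, 1), (1, r')]"
  then obtain n where "- t = - of_nat n" unfolding fox_H_right_poles_eq by (auto elim: nonpos_Ints_cases')
  then have "t = of_real (real n)" by simp
  then show "Re t \<ge> 0 \<and> Im t = 0" by simp
qed (simp_all only: fox_H_left_poles_eq fox_H_right_poles_eq, simp_all)

lemma Complex_notin_Ints: "y \<noteq> 0 \<or> x \<notin> \<int> \<Longrightarrow> Complex x y \<notin> \<int>"
  by (auto elim!: Ints_cases simp: complex_eq_iff)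

lemma abs_sinh: "\<bar>sinh (x::real)\<bar> = sinh \<bar>x\<bar>"
  by (cases "x \<ge> 0") auto

lemma norm_sin_pi_ge_sinh: "sinh (pi * \<bar>y\<bar>) \<le> norm (sin (of_real pi * Complex x y))"
proof (rule power2_le_imp_le)
  have "of_real pi * Complex x y = Complex (pi * x) (pi * y)" by (simp add: complex_eq_iff)
  then show "(sinh (pi * \<bar>y\<bar>))\<^sup>2 \<le> (norm (sin (of_real pi * Complex x y)))\<^sup>2"
    using abs_sinh[of "pi * y"] by (simp add: norm_sin_complex_squared abs_mult) (metis le_add_same_cancel2 power2_abs zero_le_power2)
qed simp

lemma norm_sin_pi_ge_cosh: "\<bar>sin (pi * x)\<bar> * cosh (pi * y) \<le> norm (sin (of_real pi * Complex x y))"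
proof (rule power2_le_imp_le)
  have "of_real pi * Complex x y = Complex (pi * x) (pi * y)" by (simp add: complex_eq_iff)
  moreover have "(sin (pi * x))\<^sup>2 * (sinh (pi * y))\<^sup>2 \<le> 1 * (sinh (pi * y))\<^sup>2"
    by (intro mult_right_mono) (auto simp: abs_square_le_1)
  ultimately show "(\<bar>sin (pi * x)\<bar> * cosh (pi * y))\<^sup>2 \<le> (norm (sin (of_real pi * Complex x y)))\<^sup>2"
    by (simp add: norm_sin_complex_squared power_mult_distrib cosh_square_eq distrib_left)
qed simp

lemma norm_sin_pi_le_cosh: "norm (sin (of_real pi * Complex x y)) \<le> cosh (pi * y)"
proof (rule power2_le_imp_le)
  have "of_real pi * Complex x y = Complex (pi * x) (pi * y)" by (simp add: complex_eq_iff)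
  moreover have "(sin (pi * x))\<^sup>2 \<le> 1" by (auto simp: abs_square_le_1)
  ultimately show "(norm (sin (of_real pi * Complex x y)))\<^sup>2 \<le> (cosh (pi * y))\<^sup>2"
    by (simp add: norm_sin_complex_squared cosh_square_eq)
qed simp

lemma abs_sin_ge_third: "\<bar>x\<bar> / 3 \<le> \<bar>sin x\<bar>" if "\<bar>x\<bar> \<le> pi / 2" for x :: real
proof -
  have *: "x / 3 \<le> sin x" if x: "0 \<le> x" "x \<le> pi / 2" for x :: real
  proof -
    have d: "((\<lambda>x. sin x - x / 3) has_real_derivative cos x - 1 / 3) (at x)" for x :: real
      by (auto intro!: derivative_eq_intros)
    show ?thesis
    proof (cases "x \<le> pi / 3")
      case True
      have "sin 0 - 0 / 3 \<le> sin x - x / 3"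
      proof (rule DERIV_nonneg_imp_nondecreasing[OF x(1)])
        fix u assume u: "0 \<le> u" "u \<le> x"
        have "cos (pi / 3) \<le> cos u" using u True by (intro cos_monotone_0_pi_le) auto
        then show "\<exists>y. ((\<lambda>x. sin x - x / 3) has_real_derivative y) (at u) \<and> 0 \<le> y"
          using d[of u] by (auto simp: cos_60)
      qed
      then show ?thesis by simp
    next
      case False
      have "sin (pi / 3) \<le> sin x" using x False by (intro sin_monotone_2pi_le) auto
      moreover have "x / 3 \<le> 2 / 3" using x pi_less_4 by linarith
      moreover have "2 / 3 \<le> sqrt 3 / (2::real)" by (rule power2_le_imp_le) (auto simp: power_divide)
      ultimately show ?thesis by (simp add: sin_60)
    qed
  qed
  show ?thesis using *[of x] *[of "-x"] that by (cases "x \<ge> 0") auto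
qed

lemma sinh_ge_self: "x \<le> sinh x" if "x \<ge> 0" for x :: real
proof -
  have "sinh 0 - 0 \<le> sinh x - x"
  proof (rule DERIV_nonneg_imp_nondecreasing[OF that])
    fix u :: real
    have "((\<lambda>x. sinh x - x) has_real_derivative cosh u - 1) (at u)"
      by (auto intro!: derivative_eq_intros)
    then show "\<exists>y. ((\<lambda>x. sinh x - x) has_real_derivative y) (at u) \<and> 0 \<le> y"
      using cosh_real_ge_1[of u] by auto
  qed
  then show ?thesis by simp
qed

lemma norm_sin_pi_ge_linear:
  assumes "\<bar>x\<bar> \<le> 1 / 2"
  shows "norm (Complex x y) \<le> norm (sin (of_real pi * Complex x y))"
proof (rule power2_le_imp_le)
  have e: "of_real pi * Complex x y = Complex (pi * x) (pi * y)" by (simp add: complex_eq_iff)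
  have "\<bar>pi * x\<bar> \<le> pi / 2" using assms by (simp add: abs_mult)
  from abs_sin_ge_third[OF this] have "pi / 3 * \<bar>x\<bar> \<le> \<bar>sin (pi * x)\<bar>" by (simp add: abs_mult)
  moreover have "1 * \<bar>x\<bar> \<le> pi / 3 * \<bar>x\<bar>" using pi_gt3 by (intro mult_right_mono) auto
  ultimately have 1: "\<bar>x\<bar> \<le> \<bar>sin (pi * x)\<bar>" by simp
  have "1 * \<bar>y\<bar> \<le> pi * \<bar>y\<bar>" using pi_gt3 by (intro mult_right_mono) auto
  also have "\<dots> \<le> sinh (pi * \<bar>y\<bar>)" by (intro sinh_ge_self) auto
  also have "\<dots> = \<bar>sinh (pi * y)\<bar>" by (simp add: abs_sinh abs_mult)
  finally have 2: "\<bar>y\<bar> \<le> \<bar>sinh (pi * y)\<bar>" by simp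
  show "(norm (Complex x y))\<^sup>2 \<le> (norm (sin (of_real pi * Complex x y)))\<^sup>2"
    unfolding e norm_sin_complex_squared
    using 1 2 by (simp add: cmod_power2 abs_le_square_iff add_mono)
qed simp

lemma norm_mellin_log_le_sinh:
  assumes "y \<noteq> 0"
  shows "norm (mellin_log (Complex x y)) \<le> pi / (\<bar>y\<bar> * sinh (pi * \<bar>y\<bar>))"
proof -
  have "\<bar>y\<bar> * sinh (pi * \<bar>y\<bar>) \<le> norm (Complex x y) * norm (sin (of_real pi * Complex x y))"
    using abs_Im_le_cmod[of "Complex x y"] by (intro mult_mono norm_sin_pi_ge_sinh) auto
  moreover have "0 < \<bar>y\<bar> * sinh (pi * \<bar>y\<bar>)" using assms by simp
  ultimately have "pi / (norm (Complex x y) * norm (sin (of_real pi * Complex x y))) \<le> pi / (\<bar>y\<bar> * sinh (pi * \<bar>y\<bar>))"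
    by (intro frac_le) auto
  then show ?thesis
    by (simp add: mellin_log_def norm_divide norm_mult)
qed

lemma holomorphic_mellin_log [holomorphic_intros]:
  "S \<inter> \<int> = {} \<Longrightarrow> mellin_log holomorphic_on S"
  unfolding mellin_log_def
  by (intro holomorphic_intros) (auto simp: sin_pi_eq_0_iff)

lemma holomorphic_capacity_integrand:
  "S \<inter> \<int> = {} \<Longrightarrow> capacity_integrand q z holomorphic_on S"
  unfolding capacity_integrand_def by (intro holomorphic_intros)

section \<open>Shifting lines of integration\<close>

lemma integral_horizontal_segment:
  assumes F: "\<And>t. t \<in> S \<Longrightarrow> (F has_field_derivative f t) (at t)"
    and "continuous_on S f" "a \<le> b" "\<And>x. a \<le> x \<Longrightarrow> x \<le> b \<Longrightarrow> Complex x y \<in> S"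
  shows "(LINT x:{a..b}|lborel. f (Complex x y)) = F (Complex b y) - F (Complex a y)"
  unfolding set_lebesgue_integral_def
proof (rule integral_FTC_atLeastAtMost[OF assms(3), of "\<lambda>x. F (Complex x y)"])
  fix x assume x: "a \<le> x" "x \<le> b"
  have "((\<lambda>x. Complex x y) has_vector_derivative 1) (at x within {a..b})"
    unfolding Complex_eq by (auto intro!: derivative_eq_intros)
  from field_vector_diff_chain_within[OF this, of F "f (Complex x y)"]
  show "((\<lambda>x. F (Complex x y)) has_vector_derivative f (Complex x y)) (at x within {a..b})"
    using F[OF assms(4)[OF x]] by (simp add: o_def has_field_derivative_at_within)
next
  show "continuous_on {a..b} (\<lambda>x. f (Complex x y))"
    using assms(4) by (intro continuous_on_compose2[OF assms(2)]) (auto simp: Complex_eq intro!: continuous_intros)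
qed

lemma integral_vertical_segment:
  assumes F: "\<And>t. t \<in> S \<Longrightarrow> (F has_field_derivative f t) (at t)"
    and "continuous_on S f" "u \<le> v" "\<And>y. u \<le> y \<Longrightarrow> y \<le> v \<Longrightarrow> Complex x y \<in> S"
  shows "\<i> * (LINT y:{u..v}|lborel. f (Complex x y)) = F (Complex x v) - F (Complex x u)"
proof -
  have "(LINT y:{u..v}|lborel. \<i> * f (Complex x y)) = F (Complex x v) - F (Complex x u)"
    unfolding set_lebesgue_integral_def
  proof (rule integral_FTC_atLeastAtMost[OF assms(3), of "\<lambda>y. F (Complex x y)"])
    fix y assume y: "u \<le> y" "y \<le> v"
    have "((\<lambda>y. Complex x y) has_vector_derivative \<i>) (at y within {u..v})"
      unfolding Complex_eq by (auto intro!: derivative_eq_intros)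
    from field_vector_diff_chain_within[OF this, of F "f (Complex x y)"]
    show "((\<lambda>y. F (Complex x y)) has_vector_derivative \<i> * f (Complex x y)) (at y within {u..v})"
      using F[OF assms(4)[OF y]] by (simp add: o_def has_field_derivative_at_within)
  next
    show "continuous_on {u..v} (\<lambda>y. \<i> * f (Complex x y))"
      using assms(4) by (intro continuous_intros continuous_on_compose2[OF assms(2)]) (auto simp: Complex_eq intro!: continuous_intros)
  qed
  then show ?thesis by simp
qed

lemma rectangle_integral:
  assumes "f holomorphic_on S" "convex S" "open S" "a \<le> b" "u \<le> v"
    and S: "\<And>x y. a \<le> x \<Longrightarrow> x \<le> b \<Longrightarrow> u \<le> y \<Longrightarrow> y \<le> v \<Longrightarrow> Complex x y \<in> S"
  shows "(LINT x:{a..b}|lborel. f (Complex x u)) + \<i> * (LINT y:{u..v}|lborel. f (Complex b y)) =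
    \<i> * (LINT y:{u..v}|lborel. f (Complex a y)) + (LINT x:{a..b}|lborel. f (Complex x v))"
proof -
  obtain F where F: "\<And>t. t \<in> S \<Longrightarrow> (F has_field_derivative f t) (at t)"
    using holomorphic_convex_primitive'[OF assms(2,3,1)] at_within_open[OF _ assms(3)] by metis
  note c = holomorphic_on_imp_continuous_on[OF assms(1)]
  show ?thesis
    using S assms(4,5)
    by (simp add: integral_horizontal_segment[OF F c] integral_vertical_segment[OF F c])
qed

lemma set_integrable_continuous_segment:
  fixes g :: "real \<Rightarrow> 'b::euclidean_space"
  assumes "continuous_on {a..b} g"
  shows "set_integrable lborel {a..b} g"
  using borel_integrable_atLeastAtMost'[OF assms] .

lemma norm_set_integral_le_const:
  fixes g :: "real \<Rightarrow> complex"
  assumes "\<And>x. x \<in> {a..b} \<Longrightarrow> norm (g x) \<le> B" "a \<le> b"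
  shows "norm (LINT x:{a..b}|lborel. g x) \<le> (b - a) * B"
proof -
  have B: "0 \<le> B" using order_trans[OF norm_ge_zero assms(1)[of a]] assms(2) by simp
  have "norm (LINT x:{a..b}|lborel. g x) \<le> (\<integral>x. norm (indicator {a..b} x *\<^sub>R g x) \<partial>lborel)"
    unfolding set_lebesgue_integral_def by (rule integral_norm_bound)
  also have "\<dots> \<le> (LINT x:{a..b}|lborel. B)"
    unfolding set_lebesgue_integral_def
  proof (rule integral_mono')
    show "integrable lborel (\<lambda>x. indicat_real {a..b} x *\<^sub>R B)"
      by (rule set_integrable_continuous_segment[unfolded set_integrable_def]) (rule continuous_on_const)
    show "norm (indicat_real {a..b} x *\<^sub>R g x) \<le> indicat_real {a..b} x *\<^sub>R B" for x
      using assms(1)[of x] by (simp add: indicator_def)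
    show "0 \<le> indicat_real {a..b} x *\<^sub>R B" for x using B by simp
  qed
  finally have "norm (LINT x:{a..b}|lborel. g x) \<le> (LINT x:{a..b}|lborel. B)" .
  then show ?thesis using assms(2) by (simp add: set_lebesgue_integral_def)
qed

lemma integrable_inverse_one_plus_square:
  shows "integrable lborel (\<lambda>y::real. inverse (1 + y\<^sup>2))"
    and "(LINT y|lborel. inverse (1 + y\<^sup>2)) = pi"
proof -
  have e: "einterval (-\<infinity>) \<infinity> = (UNIV::real set)" by (auto simp: einterval_def)
  show "integrable lborel (\<lambda>y::real. inverse (1 + y\<^sup>2))"
    using integrable_inverse_1_plus_square by (simp add: e set_integrable_def)
  show "(LINT y|lborel. inverse (1 + y\<^sup>2)) = pi"
    using LBINT_inverse_1_plus_square
    by (simp add: e interval_lebesgue_integral_def set_lebesgue_integral_def)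
qed

lemma integrable_inverse_square_plus_square:
  fixes c :: real
  assumes "c > 0"
  shows "integrable lborel (\<lambda>y. inverse (c\<^sup>2 + y\<^sup>2))"
    and "(LINT y|lborel. inverse (c\<^sup>2 + y\<^sup>2)) = pi / c"
proof -
  have e: "inverse (c\<^sup>2 + y\<^sup>2) = inverse (c\<^sup>2) * inverse (1 + (0 + (1 / c) * y)\<^sup>2)" for y
    using assms by (simp add: field_simps)
  show "integrable lborel (\<lambda>y. inverse (c\<^sup>2 + y\<^sup>2))"
    unfolding e using assms
    by (intro integrable_mult_right lborel_integrable_real_affine integrable_inverse_one_plus_square) auto
  have "pi = 1 / c * (LINT y|lborel. inverse (1 + (0 + (1 / c) * y)\<^sup>2))"
    unfolding integrable_inverse_one_plus_square(2)[symmetric]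
    using assms by (subst lborel_integral_real_affine[where c = "1 / c" and t = 0]) auto
  then have "(LINT y|lborel. inverse (1 + (0 + (1 / c) * y)\<^sup>2)) = c * pi"
  proof -
    have "I = c * pi" if "pi = 1 / c * I" for I using that assms by (simp add: field_simps)
    then show "?thesis" if "pi = 1 / c * (LINT y|lborel. inverse (1 + (0 + (1 / c) * y)\<^sup>2))" using that .
  qed
  moreover have "inverse (c\<^sup>2) * (c * pi) = pi / c"
    using assms by (simp add: power2_eq_square field_simps)
  ultimately show "(LINT y|lborel. inverse (c\<^sup>2 + y\<^sup>2)) = pi / c"
    unfolding e integral_mult_right_zero by simp
qed

lemma integrable_exp_minus_abs:
  fixes a :: real
  assumes "a > 0"
  shows "integrable lborel (\<lambda>y. exp (- (a * \<bar>y\<bar>)))"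
proof (rule Bochner_Integration.integrable_bound)
  show "integrable lborel (\<lambda>y::real. (1 + 2 / a\<^sup>2) * inverse (1 + y\<^sup>2))"
    by (intro integrable_mult_right integrable_inverse_one_plus_square)
  have "exp (- (a * \<bar>y\<bar>)) \<le> (1 + 2 / a\<^sup>2) * inverse (1 + y\<^sup>2)" for y
  proof -
    have "0 \<le> a * \<bar>y\<bar>" using assms by simp
    then have "1 + a * \<bar>y\<bar> + (a * \<bar>y\<bar>)\<^sup>2 / 2 \<le> exp (a * \<bar>y\<bar>)" by (rule exp_lower_Taylor_quadratic)
    with \<open>0 \<le> a * \<bar>y\<bar>\<close> have 1: "1 + a\<^sup>2 * y\<^sup>2 / 2 \<le> exp (a * \<bar>y\<bar>)"
      unfolding power_mult_distrib power2_abs by linarith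
    have "2 / a\<^sup>2 * (a\<^sup>2 * y\<^sup>2 / 2) = y\<^sup>2" using assms by simp
    then have "1 + y\<^sup>2 \<le> (1 + 2 / a\<^sup>2) * (1 + a\<^sup>2 * y\<^sup>2 / 2)"
      by (simp only: distrib_left distrib_right mult_1 mult_1_right) simp
    also have "\<dots> \<le> (1 + 2 / a\<^sup>2) * exp (a * \<bar>y\<bar>)" using 1 by (intro mult_left_mono) auto
    finally have "1 / exp (a * \<bar>y\<bar>) \<le> (1 + 2 / a\<^sup>2) / (1 + y\<^sup>2)"
      by (subst divide_le_eq, simp) (simp add: pos_le_divide_eq add_pos_nonneg mult.commute)
    then show ?thesis by (simp add: exp_minus divide_inverse)
  qed
  then show "AE y in lborel. norm (exp (- (a * \<bar>y\<bar>))) \<le> norm ((1 + 2 / a\<^sup>2) * inverse (1 + y\<^sup>2))"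
    by (intro AE_I2) (simp add: order_trans[OF _ abs_ge_self])
qed simp

lemma tendsto_truncated_integral:
  fixes f :: "real \<Rightarrow> complex"
  assumes "integrable lborel f"
  shows "((\<lambda>T. LINT y:{-T..T}|lborel. f y) \<longlongrightarrow> (LINT y|lborel. f y)) at_top"
  unfolding set_lebesgue_integral_def
proof (rule integral_dominated_convergence_at_top[where w = "\<lambda>y. norm (f y)"])
  show "AE y in lborel. ((\<lambda>T. indicat_real {-T..T} y *\<^sub>R f y) \<longlongrightarrow> f y) at_top"
  proof (rule AE_I2)
    fix y :: real
    have "eventually (\<lambda>T. indicat_real {-T..T} y *\<^sub>R f y = f y) at_top"
      using eventually_ge_at_top[of "\<bar>y\<bar>"] by eventually_elim (auto simp: indicator_def)
    then show "((\<lambda>T. indicat_real {-T..T} y *\<^sub>R f y) \<longlongrightarrow> f y) at_top"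
      by (rule tendsto_eventually)
  qed
  show "\<forall>\<^sub>F T in at_top. AE y in lborel. norm (indicat_real {-T..T} y *\<^sub>R f y) \<le> norm (f y)"
    by (intro always_eventually allI AE_I2) (auto simp: indicator_def)
qed (use assms in auto)

lemma tendsto_line_integral_diff:
  assumes f: "f holomorphic_on S" "convex S" "open S" "c \<le> c'"
    and S: "\<And>x y. c \<le> x \<Longrightarrow> x \<le> c' \<Longrightarrow> Complex x y \<in> S"
    and b: "\<And>x y. c \<le> x \<Longrightarrow> x \<le> c' \<Longrightarrow> \<bar>y\<bar> \<ge> 1 \<Longrightarrow> norm (f (Complex x y)) \<le> b \<bar>y\<bar>"
    and lim: "(b \<longlongrightarrow> 0) at_top"
  shows "((\<lambda>T. (LINT y:{-T..T}|lborel. f (Complex c' y)) - (LINT y:{-T..T}|lborel. f (Complex c y))) \<longlongrightarrow> 0) at_top"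
proof (rule Lim_null_comparison)
  show "((\<lambda>T. 2 * ((c' - c) * b T)) \<longlongrightarrow> 0) at_top"
    using tendsto_mult[OF tendsto_const[of "2 * (c' - c)"] lim] by (simp only: mult_zero_right mult.assoc)
  show "\<forall>\<^sub>F T in at_top. norm ((LINT y:{-T..T}|lborel. f (Complex c' y)) - (LINT y:{-T..T}|lborel. f (Complex c y)))
      \<le> 2 * ((c' - c) * b T)"
    using eventually_ge_at_top[of 1]
  proof eventually_elim
    case (elim T)
    define V V' H H' where "V = (LINT y:{-T..T}|lborel. f (Complex c y))"
      and "V' = (LINT y:{-T..T}|lborel. f (Complex c' y))"
      and "H = (LINT x:{c..c'}|lborel. f (Complex x (-T)))"
      and "H' = (LINT x:{c..c'}|lborel. f (Complex x T))"
    have "H + \<i> * V' = \<i> * V + H'"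
      unfolding V_def V'_def H_def H'_def using elim S f by (intro rectangle_integral[of f S]) auto
    then have "\<i> * (V' - V) = H' - H" by (simp add: algebra_simps)
    then have "norm (V' - V) = norm (H' - H)" by (metis norm_ii norm_mult mult_1)
    also have "\<dots> \<le> norm H' + norm H" by (rule norm_triangle_ineq4)
    also have "\<dots> \<le> (c' - c) * b T + (c' - c) * b T"
      unfolding H_def H'_def
      using b[of _ T] b[of _ "-T"] elim f(4) by (intro add_mono norm_set_integral_le_const) auto
    finally show ?case unfolding V_def V'_def mult_2 .
  qed
qed

lemma line_integral_shift:
  assumes "f holomorphic_on S" "convex S" "open S" "c \<le> c'"
    and "\<And>x y. c \<le> x \<Longrightarrow> x \<le> c' \<Longrightarrow> Complex x y \<in> S"
    and "\<And>x y. c \<le> x \<Longrightarrow> x \<le> c' \<Longrightarrow> \<bar>y\<bar> \<ge> 1 \<Longrightarrow> norm (f (Complex x y)) \<le> b \<bar>y\<bar>"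
    and "(b \<longlongrightarrow> 0) at_top"
    and "integrable lborel (\<lambda>y. f (Complex c y))" "integrable lborel (\<lambda>y. f (Complex c' y))"
  shows "(LINT y|lborel. f (Complex c' y)) = (LINT y|lborel. f (Complex c y))"
proof -
  have "(LINT y|lborel. f (Complex c' y)) - (LINT y|lborel. f (Complex c y)) = 0"
    by (rule tendsto_unique[OF _ tendsto_diff[OF tendsto_truncated_integral tendsto_truncated_integral]
        tendsto_line_integral_diff]) (use assms in auto)
  then show ?thesis by simp
qed

lemma convex_Re_strip: "convex {t. a < Re t \<and> Re t < b}" and open_Re_strip: "open {t. a < Re t \<and> Re t < b}"
proof -
  have e: "{t. a < Re t \<and> Re t < b} = {t. a < Re t} \<inter> {t. Re t < b}" by auto
  show "convex {t. a < Re t \<and> Re t < b}"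
    unfolding e by (intro convex_Int convex_halfspace_Re_gt convex_halfspace_Re_lt)
  show "open {t. a < Re t \<and> Re t < b}"
    unfolding e by (intro open_Int open_halfspace_Re_gt open_halfspace_Re_lt)
qed

lemma Re_strip_Ints: "{t. real_of_int n < Re t \<and> Re t < real_of_int n + 1} \<inter> \<int> = {}"
  by (auto elim!: Ints_cases)

section \<open>The inverse Mellin transform of the logarithm\<close>

definition csc_integrand :: "real \<Rightarrow> complex \<Rightarrow> complex" where
  "csc_integrand x t = of_real pi / sin (of_real pi * t) * exp (- t * of_real (ln x))"

lemma borel_measurable_csc_integrand [measurable (raw)]:
  assumes "f \<in> borel_measurable M" "g \<in> borel_measurable M"
  shows "(\<lambda>x. csc_integrand (g x) (f x)) \<in> borel_measurable M"
  using assms unfolding csc_integrand_def by measurable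

lemma inverse_cosh_le: "1 / cosh (pi * y) \<le> 2 * exp (- (pi * \<bar>y\<bar>))"
proof -
  have "cosh (pi * y) = cosh (pi * \<bar>y\<bar>)" by (cases "y \<ge> 0") auto
  also have "\<dots> \<ge> exp (pi * \<bar>y\<bar>) / 2" by (simp add: cosh_def)
  finally have "1 / cosh (pi * y) \<le> 1 / (exp (pi * \<bar>y\<bar>) / 2)" by (intro divide_left_mono) auto
  also have "\<dots> = 2 * exp (- (pi * \<bar>y\<bar>))" by (simp add: exp_minus field_simps)
  finally show ?thesis .
qed

lemma norm_csc_integrand_half_le:
  "norm (csc_integrand x (Complex (-1/2) y)) \<le> 2 * pi * exp (ln x / 2) * exp (- (pi * \<bar>y\<bar>))"
proof -
  have "cosh (pi * y) \<le> norm (sin (of_real pi * Complex (-1/2) y))"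
    using norm_sin_pi_ge_cosh[of "-1/2" y] by simp
  moreover have "0 < cosh (pi * y)" by (rule cosh_real_pos)
  ultimately have "1 / norm (sin (of_real pi * Complex (-1/2) y)) \<le> 1 / cosh (pi * y)"
    by (intro frac_le) auto
  also note inverse_cosh_le
  finally have "pi * exp (ln x / 2) * (1 / norm (sin (of_real pi * Complex (-1/2) y))) \<le>
      pi * exp (ln x / 2) * (2 * exp (- (pi * \<bar>y\<bar>)))"
    by (intro mult_left_mono) auto
  then show ?thesis by (simp add: csc_integrand_def norm_mult norm_divide mult_ac)
qed

lemma integrable_csc_integrand: "integrable lborel (\<lambda>y. csc_integrand x (Complex (-1/2) y))"
proof (rule Bochner_Integration.integrable_bound)
  show "integrable lborel (\<lambda>y. 2 * pi * exp (ln x / 2) * exp (- (pi * \<bar>y\<bar>)))"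
    by (intro integrable_mult_right integrable_exp_minus_abs) auto
  show "AE y in lborel. norm (csc_integrand x (Complex (-1/2) y)) \<le> norm (2 * pi * exp (ln x / 2) * exp (- (pi * \<bar>y\<bar>)))"
    using norm_csc_integrand_half_le by (intro AE_I2) simp
qed measurable

text \<open>
  Moving the line to the left by 1 multiplies the integral by \<open>-x\<close> and crosses the simple pole at \<open>-1\<close>.
\<close>
lemma csc_line_integral:
  assumes "x > 0"
  shows "(LINT y|lborel. csc_integrand x (Complex (-1/2) y)) = of_real (- 2 * pi * x / (1 + x))"
proof -
  define S where "S = {t. -2 < Re t \<and> Re t < 0}"
  define G where "G = (\<lambda>t::complex. - Gamma (t + 2) * Gamma (- t) * exp (- t * of_real (ln x)))"
  define P where "P = (\<lambda>t. if t = -1 then deriv G (-1) else csc_integrand x t - G (-1) / (t - (-1)))"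
  have Sint: "t \<notin> \<int>" if "t \<in> S" "t \<noteq> -1" for t
  proof
    assume "t \<in> \<int>"
    then obtain n where "t = of_int n" by (auto elim: Ints_cases)
    moreover from this that have "-2 < real_of_int n" "real_of_int n < 0" by (auto simp: S_def)
    then have "n = -1" by linarith
    ultimately show False using that by simp
  qed
  have G: "G holomorphic_on S"
    unfolding G_def S_def
    by (intro holomorphic_intros) (auto elim!: nonpos_Ints_cases' simp: complex_eq_iff)
  have Geq: "G t = (t - (-1)) * csc_integrand x t" if "t \<in> S - {-1}" for t
  proof -
    have t: "t \<notin> \<int>" using Sint that by auto
    have n: "t \<notin> \<int>\<^sub>\<le>\<^sub>0" "t + 1 \<notin> \<int>\<^sub>\<le>\<^sub>0"
      using t nonpos_Ints_Int[of t] nonpos_Ints_Int[of "t + 1"] Ints_diff[of "t + 1" 1] by auto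
    have "Gamma (t + 2) = Gamma ((t + 1) + 1)" by (simp add: add.assoc)
    also have "\<dots> = (t + 1) * (t * Gamma t)" by (simp only: Gamma_plus1[OF n(2)] Gamma_plus1[OF n(1)])
    finally have "- Gamma (t + 2) * Gamma (- t) = - ((t + 1) * t * (Gamma t * Gamma (- t)))" by simp
    also have "\<dots> = (t + 1) * (of_real pi / sin (of_real pi * t))"
    proof -
      have "t \<noteq> 0" using t by auto
      then show ?thesis by (simp add: Gamma_reflection_complex')
    qed
    finally have F: "- Gamma (t + 2) * Gamma (- t) = (t + 1) * (of_real pi / sin (of_real pi * t))" .
    have "G t = ((t + 1) * (of_real pi / sin (of_real pi * t))) * exp (- t * of_real (ln x))"
      unfolding G_def F by (rule refl)
    then show ?thesis by (simp only: csc_integrand_def mult.assoc diff_minus_eq_add)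
  qed
  have ex: "exp (complex_of_real (ln x)) = of_real x" using assms by (metis exp_ln exp_of_real)
  then have G1: "G (-1) = of_real (- x)" by (simp add: G_def)
  have P: "P holomorphic_on S"
    unfolding P_def using pole_theorem_open[OF G _ Geq] open_Re_strip by (simp add: S_def)
  define E where "E = exp (2 * \<bar>ln x\<bar>)"
  have bound: "norm (P (Complex a y)) \<le> (E + x) / \<bar>y\<bar>" if a: "-3/2 \<le> a" "a \<le> -1/2" and y: "\<bar>y\<bar> \<ge> 1" for a y
  proof -
    have ne: "Complex a y \<noteq> -1" using y by (auto simp: complex_eq_iff)
    have "pi * \<bar>y\<bar> \<le> sinh (pi * \<bar>y\<bar>)" by (intro sinh_ge_self) auto
    also have "\<dots> \<le> norm (sin (of_real pi * Complex a y))" by (rule norm_sin_pi_ge_sinh)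
    finally have s: "pi * \<bar>y\<bar> \<le> norm (sin (of_real pi * Complex a y))" .
    have "- a * ln x \<le> \<bar>a\<bar> * \<bar>ln x\<bar>" by (metis abs_ge_self abs_minus abs_mult)
    also have "\<dots> \<le> 2 * \<bar>ln x\<bar>" using a by (intro mult_right_mono) auto
    finally have e: "exp (- a * ln x) \<le> E" by (simp add: E_def)
    have "norm (csc_integrand x (Complex a y)) = pi / norm (sin (of_real pi * Complex a y)) * exp (- a * ln x)"
      by (simp add: csc_integrand_def norm_mult norm_divide)
    also have "\<dots> \<le> pi / (pi * \<bar>y\<bar>) * E"
    proof (intro mult_mono e)
      have "0 < pi * \<bar>y\<bar>" using y by simp
      with s show "pi / norm (sin (of_real pi * Complex a y)) \<le> pi / (pi * \<bar>y\<bar>)"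
        by (intro frac_le) auto
    qed auto
    finally have 1: "norm (csc_integrand x (Complex a y)) \<le> E / \<bar>y\<bar>" by simp
    have "\<bar>y\<bar> \<le> norm (Complex a y - (-1))" using abs_Im_le_cmod[of "Complex a y - (-1)"] by simp
    then have 2: "norm (G (-1) / (Complex a y - (-1))) \<le> x / \<bar>y\<bar>"
      unfolding G1 norm_divide using assms y by (intro frac_le) auto
    have "norm (P (Complex a y)) \<le> norm (csc_integrand x (Complex a y)) + norm (G (-1) / (Complex a y - (-1)))"
      unfolding P_def using ne by (simp only: if_False norm_triangle_ineq4)
    also have "\<dots> \<le> (E + x) / \<bar>y\<bar>" using 1 2 by (simp add: add_divide_distrib)
    finally show ?thesis .
  qed
  have lim: "((\<lambda>y. (E + x) / y) \<longlongrightarrow> 0) at_top" by real_asymp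
  have L1: "((\<lambda>T. (LINT y:{-T..T}|lborel. P (Complex (-1/2) y)) - (LINT y:{-T..T}|lborel. P (Complex (-3/2) y))) \<longlongrightarrow> 0) at_top"
    using P convex_Re_strip open_Re_strip bound lim
    by (intro tendsto_line_integral_diff[of P S _ _ "\<lambda>y. (E + x) / y"]) (auto simp: S_def)
  define Q where "Q = (\<lambda>y. (1 + of_real x) * csc_integrand x (Complex (-1/2) y) + of_real x * of_real (inverse ((1/2)\<^sup>2 + y\<^sup>2)))"
  have PQ: "P (Complex (-1/2) y) - P (Complex (-3/2) y) = Q y" for y
  proof -
    define t where "t = Complex (-1/2) y"
    have t': "Complex (-3/2) y = t - 1" by (simp add: t_def complex_eq_iff)
    have ne: "t \<noteq> -1" "t - 1 \<noteq> -1" by (auto simp: t_def complex_eq_iff)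
    have "sin (of_real pi * (t - 1)) = - sin (of_real pi * t)"
      by (simp add: right_diff_distrib sin_diff flip: cos_of_real sin_of_real)
    moreover have "exp (- (t - 1) * of_real (ln x)) = exp (- t * of_real (ln x)) * of_real x"
    proof -
      have "- (t - 1) * of_real (ln x) = - t * of_real (ln x) + of_real (ln x)" by (simp add: algebra_simps)
      then show ?thesis by (simp only: exp_add ex)
    qed
    ultimately have c: "csc_integrand x (t - 1) = - of_real x * csc_integrand x t"
      by (simp add: csc_integrand_def)
    have "1 / (t + 1) - 1 / t = of_real (inverse ((1/2)\<^sup>2 + y\<^sup>2))"
    proof -
      have nz: "t + 1 \<noteq> 0" "t \<noteq> 0" by (auto simp: t_def complex_eq_iff)
      have "(t + 1) * t = - of_real ((1/2)\<^sup>2 + y\<^sup>2)"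
        by (simp add: t_def complex_eq_iff power2_eq_square)
      moreover have "1 / (t + 1) - 1 / t = - (1 / ((t + 1) * t))" using nz by (simp add: field_simps)
      ultimately show ?thesis by (simp only: of_real_inverse divide_minus_right minus_minus inverse_eq_divide of_real_divide of_real_1)
    qed
    have "P t - P (t - 1) = csc_integrand x t - of_real (- x) / (t + 1) - (- of_real x * csc_integrand x t - of_real (- x) / t)"
      using ne by (simp add: P_def c G1)
    also have "\<dots> = (1 + of_real x) * csc_integrand x t + of_real x * (1 / (t + 1) - 1 / t)"
      by (simp add: ring_distribs)
    finally show ?thesis
      unfolding t' Q_def \<open>1 / (t + 1) - 1 / t = _\<close> by (simp only: t_def)
  qed
  have cont: "continuous_on {-T..T} (\<lambda>y. P (Complex c y))" if "-2 < c" "c < 0" for c T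
    using that by (intro continuous_on_compose2[OF holomorphic_on_imp_continuous_on[OF P]])
      (auto simp: S_def Complex_eq intro!: continuous_intros)
  have "(LINT y:{-T..T}|lborel. P (Complex (-1/2) y)) - (LINT y:{-T..T}|lborel. P (Complex (-3/2) y)) =
      (LINT y:{-T..T}|lborel. Q y)" for T
    unfolding PQ[symmetric]
    by (intro set_integral_diff(2)[symmetric] set_integrable_continuous_segment cont) auto
  with L1 have L2: "((\<lambda>T. LINT y:{-T..T}|lborel. Q y) \<longlongrightarrow> 0) at_top" by simp
  have i1: "integrable lborel (\<lambda>y. (1 + of_real x) * csc_integrand x (Complex (-1/2) y))"
    by (intro integrable_mult_right integrable_csc_integrand)
  have i2: "integrable lborel (\<lambda>y. of_real x * complex_of_real (inverse ((1/2)\<^sup>2 + y\<^sup>2)))"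
    by (intro integrable_mult_right integrable_of_real integrable_inverse_square_plus_square) auto
  have "(LINT y|lborel. Q y) = 0"
    using tendsto_unique[OF _ tendsto_truncated_integral L2] i1 i2 by (simp add: Q_def)
  also have "(LINT y|lborel. Q y) = (1 + of_real x) * (LINT y|lborel. csc_integrand x (Complex (-1/2) y)) + of_real (x * (2 * pi))"
    using integrable_inverse_square_plus_square(2)[of "1/2"] unfolding Q_def
    by (subst Bochner_Integration.integral_add[OF i1 i2]) (simp only: integral_mult_right_zero integral_complex_of_real, simp)
  finally have "(1 + of_real x) * (LINT y|lborel. csc_integrand x (Complex (-1/2) y)) = - of_real (x * (2 * pi))"
    by (simp add: eq_neg_iff_add_eq_0)
  moreover have nz: "1 + complex_of_real x \<noteq> 0" using assms by (metis add_pos_pos less_numeral_extra(1,3) of_real_1 of_real_add of_real_eq_0_iff)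
  ultimately have "(LINT y|lborel. csc_integrand x (Complex (-1/2) y)) = - of_real (x * (2 * pi)) / (1 + of_real x)"
    by (subst nonzero_eq_divide_eq[OF nz]) (simp only: mult.commute)
  then show ?thesis by (simp add: mult.commute mult.left_commute)
qed

lemma integrable_pair_product_bound:
  fixes f :: "'a \<times> 'b \<Rightarrow> 'c::{banach, second_countable_topology}"
  assumes "sigma_finite_measure M" "sigma_finite_measure N"
    and [measurable]: "f \<in> borel_measurable (M \<Otimes>\<^sub>M N)"
    and a: "integrable M a" and b: "integrable N b"
    and le: "\<And>x y. norm (f (x, y)) \<le> a x * b y"
  shows "integrable (M \<Otimes>\<^sub>M N) f"
proof -
  interpret pair_sigma_finite M N using assms by (simp add: pair_sigma_finite_def)
  have [measurable]: "a \<in> borel_measurable M" "b \<in> borel_measurable N" using a b by auto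
  have "integrable (M \<Otimes>\<^sub>M N) (\<lambda>(x, y). a x * b y)"
    using a b by (intro Fubini_integrable) (auto simp: abs_mult)
  then show ?thesis
    by (rule Bochner_Integration.integrable_bound) (use le in \<open>auto intro!: AE_I2 intro: order_trans[OF _ abs_ge_self]\<close>)
qed

lemma has_vector_derivative_capacity_integrand_zero:
  assumes "r > 0" "t \<noteq> 0"
  shows "((\<lambda>r. capacity_integrand 0 r t) has_vector_derivative (- csc_integrand r t / of_real r)) (at r within A)"
proof -
  have "((\<lambda>r. exp (- t * of_real (ln r))) has_vector_derivative (exp (- t * of_real (ln r)) * (- t * of_real (1 / r)))) (at r within A)"
  proof -
    have "((\<lambda>r. - t * of_real (ln r)) has_vector_derivative (- t * of_real (1 / r))) (at r within A)"
      using assms(1) by (auto intro!: derivative_eq_intros simp: divide_inverse)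
    from field_vector_diff_chain_within[OF this, of exp "exp (- t * of_real (ln r))"]
    show ?thesis by (simp add: o_def DERIV_exp has_field_derivative_at_within mult.commute)
  qed
  from has_vector_derivative_mult_right[OF this, of "mellin_log t"]
  have "((\<lambda>r. capacity_integrand 0 r t) has_vector_derivative
      (mellin_log t * (exp (- t * of_real (ln r)) * (- t * of_real (1 / r))))) (at r within A)"
    by (simp add: capacity_integrand_def)
  also have "mellin_log t * (exp (- t * of_real (ln r)) * (- t * of_real (1 / r))) = - csc_integrand r t / of_real r"
    using assms(2) by (simp add: mellin_log_def csc_integrand_def)
  finally show ?thesis .
qed

lemma norm_mellin_log_le_exp:
  assumes "c \<notin> \<int>"
  shows "norm (mellin_log (Complex c y)) \<le> 2 * pi / (\<bar>c\<bar> * \<bar>sin (pi * c)\<bar>) * exp (- (pi * \<bar>y\<bar>))"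
proof -
  have "sin (pi * c) \<noteq> 0"
  proof
    assume "sin (pi * c) = 0"
    then obtain n :: int where "pi * c = real_of_int n * pi" by (auto simp: sin_zero_iff_int2)
    then have "c = real_of_int n" by simp
    with assms show False by simp
  qed
  then have s: "\<bar>sin (pi * c)\<bar> > 0" by simp
  have c: "\<bar>c\<bar> > 0" using assms by auto
  have "\<bar>c\<bar> * (\<bar>sin (pi * c)\<bar> * cosh (pi * y)) \<le> norm (Complex c y) * norm (sin (of_real pi * Complex c y))"
    using abs_Re_le_cmod[of "Complex c y"] by (intro mult_mono norm_sin_pi_ge_cosh) auto
  moreover have "0 < \<bar>c\<bar> * (\<bar>sin (pi * c)\<bar> * cosh (pi * y))" using s c cosh_real_pos[of "pi * y"] by (intro mult_pos_pos) auto
  ultimately have "norm (mellin_log (Complex c y)) \<le> pi / (\<bar>c\<bar> * (\<bar>sin (pi * c)\<bar> * cosh (pi * y)))"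
    unfolding mellin_log_def norm_divide norm_mult by (simp add: frac_le)
  also have "\<dots> = pi / (\<bar>c\<bar> * \<bar>sin (pi * c)\<bar>) * (1 / cosh (pi * y))" by simp
  also have "\<dots> \<le> pi / (\<bar>c\<bar> * \<bar>sin (pi * c)\<bar>) * (2 * exp (- (pi * \<bar>y\<bar>)))"
    using s c by (intro mult_left_mono inverse_cosh_le) auto
  finally show ?thesis by (simp add: mult_ac)
qed

lemma norm_capacity_integrand_zero:
  "norm (capacity_integrand 0 x t) = norm (mellin_log t) * exp (- Re t * ln x)"
  by (simp add: capacity_integrand_def norm_mult)

lemma integrable_capacity_integrand_zero:
  assumes "c \<notin> \<int>"
  shows "integrable lborel (\<lambda>y. capacity_integrand 0 x (Complex c y))"
proof (rule Bochner_Integration.integrable_bound)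
  let ?K = "2 * pi / (\<bar>c\<bar> * \<bar>sin (pi * c)\<bar>)"
  show "integrable lborel (\<lambda>y. exp (- c * ln x) * ?K * exp (- (pi * \<bar>y\<bar>)))"
    by (intro integrable_mult_right integrable_exp_minus_abs) auto
  show "AE y in lborel. norm (capacity_integrand 0 x (Complex c y)) \<le> norm (exp (- c * ln x) * ?K * exp (- (pi * \<bar>y\<bar>)))"
  proof (rule AE_I2)
    fix y
    have "norm (capacity_integrand 0 x (Complex c y)) = exp (- c * ln x) * norm (mellin_log (Complex c y))"
      by (simp add: norm_capacity_integrand_zero)
    also have "\<dots> \<le> exp (- c * ln x) * (?K * exp (- (pi * \<bar>y\<bar>)))"
      by (intro mult_left_mono norm_mellin_log_le_exp assms) simp
    also have "\<dots> \<le> norm (exp (- c * ln x) * ?K * exp (- (pi * \<bar>y\<bar>)))" by simp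
    finally show "norm (capacity_integrand 0 x (Complex c y)) \<le> norm (exp (- c * ln x) * ?K * exp (- (pi * \<bar>y\<bar>)))" .
  qed
qed measurable

lemma half_notin_Ints: "(-1/2 :: real) \<notin> \<int>"
proof
  assume "(-1/2 :: real) \<in> \<int>"
  then obtain n :: int where "-1/2 = real_of_int n" by (auto elim: Ints_cases)
  then have "2 * n = -1" by linarith
  then show False by presburger
qed

lemma log_line_integral_diff:
  assumes "0 < e" "e < x"
  shows "(LINT y|lborel. capacity_integrand 0 x (Complex (-1/2) y)) - (LINT y|lborel. capacity_integrand 0 e (Complex (-1/2) y))
    = of_real (2 * pi * (ln (1 + x) - ln (1 + e)))"
proof -
  define F where "F = (\<lambda>(r, y). indicat_real {e..x} r *\<^sub>R (- csc_integrand r (Complex (-1/2) y) / of_real r))"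
  define B where "B = exp (\<bar>ln e\<bar> + \<bar>ln x\<bar>)"
  have ne: "Complex (-1/2) y \<noteq> 0" for y by (simp add: complex_eq_iff)
  have [measurable]: "F \<in> borel_measurable (lborel \<Otimes>\<^sub>M lborel)"
    unfolding F_def by measurable
  have int: "integrable (lborel \<Otimes>\<^sub>M lborel) F"
  proof (rule integrable_pair_product_bound[where a = "\<lambda>r. indicat_real {e..x} r *\<^sub>R (2 * pi * B / e)" and b = "\<lambda>y. exp (- (pi * \<bar>y\<bar>))"])
    show "integrable lborel (\<lambda>r. indicat_real {e..x} r *\<^sub>R (2 * pi * B / e))"
      by (rule set_integrable_continuous_segment[unfolded set_integrable_def]) (rule continuous_on_const)
    show "integrable lborel (\<lambda>y. exp (- (pi * \<bar>y\<bar>)))" by (rule integrable_exp_minus_abs) simp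
    show "norm (F (r, y)) \<le> indicat_real {e..x} r *\<^sub>R (2 * pi * B / e) * exp (- (pi * \<bar>y\<bar>))" for r y
    proof (cases "r \<in> {e..x}")
      case True
      then have r: "e \<le> r" "r \<le> x" by auto
      have "ln r \<le> ln x" using assms r by simp
      then have "exp (ln r / 2) \<le> B" unfolding B_def by simp
      then have "norm (csc_integrand r (Complex (-1/2) y)) / r \<le> 2 * pi * B * exp (- (pi * \<bar>y\<bar>)) / e"
        using assms r by (intro frac_le order_trans[OF norm_csc_integrand_half_le] mult_right_mono mult_left_mono) (auto simp: B_def)
      then show ?thesis using r assms by (simp add: F_def norm_divide)
    qed (simp add: F_def)
  qed (auto intro: sigma_finite_lborel)
  have "(LINT y|lborel. LINT r|lborel. F (r, y)) = (LINT r|lborel. LINT y|lborel. F (r, y))"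
    using lborel_pair.Fubini_integral[of "\<lambda>r y. F (r, y)"] int by simp
  also have "(\<lambda>r. LINT y|lborel. F (r, y)) = (\<lambda>r. indicat_real {e..x} r *\<^sub>R complex_of_real (2 * pi / (1 + r)))"
  proof
    fix r :: real
    show "(LINT y|lborel. F (r, y)) = indicat_real {e..x} r *\<^sub>R complex_of_real (2 * pi / (1 + r))"
    proof (cases "r \<in> {e..x}")
      case True
      then have "r > 0" using assms by simp
      have "(LINT y|lborel. F (r, y)) = - (LINT y|lborel. csc_integrand r (Complex (-1/2) y)) / of_real r"
        using True by (simp add: F_def)
      also have "\<dots> = of_real (2 * pi / (1 + r))"
        unfolding csc_line_integral[OF \<open>r > 0\<close>] using \<open>r > 0\<close> by (simp flip: of_real_divide of_real_minus)
      finally show ?thesis using True by simp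
    qed (simp add: F_def)
  qed
  also have "(LINT r|lborel. indicat_real {e..x} r *\<^sub>R complex_of_real (2 * pi / (1 + r))) =
      of_real (2 * pi * ln (1 + x)) - of_real (2 * pi * ln (1 + e))"
  proof (rule integral_FTC_atLeastAtMost)
    fix r assume "e \<le> r" "r \<le> x"
    then show "((\<lambda>r. complex_of_real (2 * pi * ln (1 + r))) has_vector_derivative of_real (2 * pi / (1 + r))) (at r within {e..x})"
      using assms by (auto intro!: derivative_eq_intros simp: divide_inverse)
  next
    show "continuous_on {e..x} (\<lambda>r. complex_of_real (2 * pi / (1 + r)))"
      using assms by (intro continuous_on_of_real continuous_intros) auto
  qed (use assms in auto)
  also have "(\<lambda>y. LINT r|lborel. F (r, y)) = (\<lambda>y. capacity_integrand 0 x (Complex (-1/2) y) - capacity_integrand 0 e (Complex (-1/2) y))"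
  proof
    fix y :: real
    show "(LINT r|lborel. F (r, y)) = capacity_integrand 0 x (Complex (-1/2) y) - capacity_integrand 0 e (Complex (-1/2) y)"
      unfolding F_def prod.case
    proof (rule integral_FTC_atLeastAtMost)
      fix r assume "e \<le> r" "r \<le> x"
      then show "((\<lambda>r. capacity_integrand 0 r (Complex (-1/2) y)) has_vector_derivative - csc_integrand r (Complex (-1/2) y) / of_real r) (at r within {e..x})"
        using assms ne by (intro has_vector_derivative_capacity_integrand_zero) auto
    next
      have "sin (of_real pi * Complex (-1/2) y) \<noteq> 0"
        unfolding sin_pi_eq_0_iff by (intro Complex_notin_Ints disjI2 half_notin_Ints)
      then show "continuous_on {e..x} (\<lambda>r. - csc_integrand r (Complex (-1/2) y) / of_real r)"
        unfolding csc_integrand_def using assms by (intro continuous_intros) auto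
    qed (use assms in auto)
  qed
  also have "(LINT y|lborel. capacity_integrand 0 x (Complex (-1/2) y) - capacity_integrand 0 e (Complex (-1/2) y)) =
    (LINT y|lborel. capacity_integrand 0 x (Complex (-1/2) y)) - (LINT y|lborel. capacity_integrand 0 e (Complex (-1/2) y))"
    by (intro Bochner_Integration.integral_diff integrable_capacity_integrand_zero half_notin_Ints)
  finally show ?thesis by (simp add: right_diff_distrib)
qed

lemma log_line_integral:
  assumes "x > 0"
  shows "(LINT y|lborel. capacity_integrand 0 x (Complex (-1/2) y)) = of_real (2 * pi * ln (1 + x))"
proof -
  define J where "J = (\<lambda>x. LINT y|lborel. capacity_integrand 0 x (Complex (-1/2) y))"
  define B where "B = (LINT y|lborel. norm (mellin_log (Complex (-1/2) y)))"
  have J0: "(J \<longlongrightarrow> 0) (at_right 0)"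
  proof (rule Lim_null_comparison)
    show "((\<lambda>e. exp (ln e / 2) * B) \<longlongrightarrow> 0) (at_right 0)" by real_asymp
    show "\<forall>\<^sub>F e in at_right 0. norm (J e) \<le> exp (ln e / 2) * B"
    proof (rule always_eventually, rule allI)
      fix e
      have "norm (J e) \<le> (LINT y|lborel. norm (capacity_integrand 0 e (Complex (-1/2) y)))"
        unfolding J_def by (rule integral_norm_bound)
      then show "norm (J e) \<le> exp (ln e / 2) * B"
        by (simp add: norm_capacity_integrand_zero B_def mult.commute)
    qed
  qed
  have "((\<lambda>e. of_real (2 * pi * (ln (1 + x) - ln (1 + e)))) \<longlongrightarrow> complex_of_real (2 * pi * (ln (1 + x) - ln (1 + 0)))) (at_right 0)"
    by (intro tendsto_intros) auto
  moreover have "\<forall>\<^sub>F e in at_right 0. complex_of_real (2 * pi * (ln (1 + x) - ln (1 + e))) = J x - J e"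
    using eventually_at_right_less[of 0] eventually_at_right_real[OF assms]
    by eventually_elim (auto simp only: J_def greaterThanLessThan_iff log_line_integral_diff)
  ultimately have "((\<lambda>e. J x - J e) \<longlongrightarrow> complex_of_real (2 * pi * (ln (1 + x) - ln (1 + 0)))) (at_right 0)"
    by (rule Lim_transform_eventually)
  moreover have "((\<lambda>e. J x - J e) \<longlongrightarrow> J x - 0) (at_right 0)"
    by (intro tendsto_intros J0)
  ultimately have "complex_of_real (2 * pi * (ln (1 + x) - ln (1 + 0))) = J x - 0"
    by (rule tendsto_unique[rotated]) simp
  then show ?thesis by (simp add: J_def)
qed


lemma norm_capacity_integrand_zero_le:
  assumes "\<bar>a\<bar> \<le> A" "y \<noteq> 0"
  shows "norm (capacity_integrand 0 x (Complex a y)) \<le> exp (A * \<bar>ln x\<bar>) / y\<^sup>2"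
proof -
  have "- a * ln x \<le> \<bar>a\<bar> * \<bar>ln x\<bar>" by (metis abs_ge_self abs_minus abs_mult)
  also have "\<dots> \<le> A * \<bar>ln x\<bar>" using assms by (intro mult_right_mono) auto
  finally have e: "exp (- a * ln x) \<le> exp (A * \<bar>ln x\<bar>)" by simp
  have "norm (mellin_log (Complex a y)) \<le> pi / (\<bar>y\<bar> * sinh (pi * \<bar>y\<bar>))"
    using assms by (intro norm_mellin_log_le_sinh)
  also have "\<dots> \<le> pi / (\<bar>y\<bar> * (pi * \<bar>y\<bar>))"
    using assms sinh_ge_self[of "pi * \<bar>y\<bar>"] by (intro frac_le mult_left_mono) auto
  also have "\<dots> = 1 / y\<^sup>2" by (simp add: power2_eq_square abs_mult_self_eq)
  finally have "norm (mellin_log (Complex a y)) * exp (- a * ln x) \<le> 1 / y\<^sup>2 * exp (A * \<bar>ln x\<bar>)"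
    using e by (intro mult_mono) auto
  then show ?thesis by (simp add: norm_capacity_integrand_zero)
qed

lemma notin_Ints_unit: "-1 < c \<Longrightarrow> c < 0 \<Longrightarrow> c \<notin> \<int>" "0 < c \<Longrightarrow> c < 1 \<Longrightarrow> c \<notin> \<int>" for c :: real
  by (auto elim!: Ints_cases)

lemma line_value_log_neg:
  assumes x: "x > 0" and c: "-1 < c" "c < 0"
  shows "line_value (capacity_integrand 0 x) c = of_real (ln (1 + x))"
proof -
  let ?f = "capacity_integrand 0 x" and ?S = "{t. -1 < Re t \<and> Re t < 0}"
  have S: "?f holomorphic_on ?S"
    using Re_strip_Ints[of "-1"] by (intro holomorphic_capacity_integrand) simp
  have shift: "(LINT y|lborel. ?f (Complex b y)) = (LINT y|lborel. ?f (Complex a y))"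
    if "a \<le> b" "-1 < a" "b < 0" for a b
  proof (rule line_integral_shift[OF S convex_Re_strip open_Re_strip \<open>a \<le> b\<close>])
    show "norm (?f (Complex u y)) \<le> exp (1 * \<bar>ln x\<bar>) / \<bar>y\<bar>\<^sup>2" if "a \<le> u" "u \<le> b" "1 \<le> \<bar>y\<bar>" for u y
      unfolding power2_abs using that \<open>-1 < a\<close> \<open>b < 0\<close> by (intro norm_capacity_integrand_zero_le) auto
    show "((\<lambda>y. exp (1 * \<bar>ln x\<bar>) / y\<^sup>2) \<longlongrightarrow> 0) at_top" by real_asymp
  qed (use that notin_Ints_unit in \<open>auto intro!: integrable_capacity_integrand_zero\<close>)
  have "(LINT y|lborel. ?f (Complex c y)) = of_real (2 * pi * ln (1 + x))"
    using shift[of c "-1/2"] shift[of "-1/2" c] log_line_integral[OF x] c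
    by (cases "c \<le> -1/2") auto
  then show ?thesis by (simp add: line_value_def)
qed

lemma line_value_uminus: "line_value (\<lambda>t. f (- t)) (- c) = line_value f c"
proof -
  have "(LINT y|lborel. f (Complex c y)) = (LINT y|lborel. f (Complex c (- y)))"
    by (subst lborel_integral_real_affine[where c = "-1" and t = 0]) auto
  also have "\<dots> = (LINT y|lborel. f (- Complex (- c) y))"
    by (simp add: complex_eq_iff cong: Bochner_Integration.integral_cong) (simp add: uminus_complex.code)
  finally show ?thesis by (simp add: line_value_def)
qed

lemma line_value_log_pos:
  assumes x: "x > 0" and c: "0 < c" "c < 1"
  shows "line_value (capacity_integrand 0 x) c = of_real (ln (1 + 1 / x))"
proof -
  have "line_value (capacity_integrand 0 x) c = line_value (\<lambda>t. capacity_integrand 0 x (- t)) (- c)"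
    by (simp add: line_value_uminus)
  also have "(\<lambda>t. capacity_integrand 0 x (- t)) = capacity_integrand 0 (1 / x)"
    using capacity_integrand_uminus[OF x, of 0] by auto
  finally show ?thesis using assms by (simp add: line_value_log_neg)
qed

section \<open>Loops and lines\<close>

lemma set_integrable_exp_atMost:
  fixes a :: real
  assumes "a > 0"
  shows "set_integrable lborel {..c} (\<lambda>s. exp (a * s))"
  unfolding set_integrable_def
proof (rule Bochner_Integration.integrable_bound)
  show "integrable lborel (\<lambda>s. exp (2 * a * \<bar>c\<bar>) * exp (- (a * \<bar>s\<bar>)))"
    by (intro integrable_mult_right integrable_exp_minus_abs assms)
  have "exp (a * s) \<le> exp (2 * a * \<bar>c\<bar>) * exp (- (a * \<bar>s\<bar>))" if "s \<le> c" for s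
  proof -
    have "a * (s + \<bar>s\<bar>) \<le> a * (2 * \<bar>c\<bar>)" using that assms by (intro mult_left_mono) auto
    then show ?thesis by (simp add: exp_add[symmetric] algebra_simps)
  qed
  then show "AE s in lborel. norm (indicat_real {..c} s *\<^sub>R exp (a * s)) \<le> norm (exp (2 * a * \<bar>c\<bar>) * exp (- (a * \<bar>s\<bar>)))"
    by (intro AE_I2) (auto simp: indicator_def)
qed simp

lemma quarter_plane_log_integral:
  assumes x: "0 < x" "x < 1" and v: "v > 0"
  defines "f \<equiv> capacity_integrand 0 x"
  shows "set_integrable lborel {..c} (\<lambda>s. f (Complex s v))"
    and "set_integrable lborel {v..} (\<lambda>y. f (Complex c y))"
    and "(LINT s:{..c}|lborel. f (Complex s v)) + \<i> * (LINT y:{v..}|lborel. f (Complex c y)) = 0"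
proof -
  have [measurable]: "f \<in> borel_measurable borel" unfolding f_def by measurable
  define K where "K = pi / (v * sinh (pi * v))"
  have K: "K > 0" using v by (simp add: K_def)
  have hK: "norm (mellin_log (Complex s y)) \<le> K" if "v \<le> y" for s y
  proof -
    have "norm (mellin_log (Complex s y)) \<le> pi / (\<bar>y\<bar> * sinh (pi * \<bar>y\<bar>))"
      using that v by (intro norm_mellin_log_le_sinh) auto
    also have "\<dots> \<le> K" unfolding K_def using that v by (intro frac_le mult_mono) auto
    finally show ?thesis .
  qed
  have fK: "norm (f (Complex s y)) \<le> K * exp (\<bar>ln x\<bar> * s)" if "v \<le> y" for s y
    using hK[OF that, of s] x unfolding f_def norm_capacity_integrand_zero by (simp add: mult.commute)
  show i1: "set_integrable lborel {..c} (\<lambda>s. f (Complex s v))"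
  proof (rule set_integrable_bound)
    show "set_integrable lborel {..c} (\<lambda>s. K * exp (\<bar>ln x\<bar> * s))"
      using x by (intro set_integrable_mult_right set_integrable_exp_atMost) auto
    show "AE s in lborel. s \<in> {..c} \<longrightarrow> norm (f (Complex s v)) \<le> norm (K * exp (\<bar>ln x\<bar> * s))"
      using fK[of v] K by (intro AE_I2) (auto simp: abs_mult)
  qed (simp add: set_borel_measurable_def)
  define E where "E = exp (\<bar>c\<bar> * \<bar>ln x\<bar>)"
  show i2: "set_integrable lborel {v..} (\<lambda>y. f (Complex c y))"
  proof (rule set_integrable_bound)
    show "set_integrable lborel {v..} (\<lambda>y. E * (1 + 1 / v\<^sup>2) * inverse (1 + y\<^sup>2))"
      unfolding set_integrable_def
      by (intro integrable_mult_indicator integrable_mult_right integrable_inverse_one_plus_square) auto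
    have "norm (f (Complex c y)) \<le> E * (1 + 1 / v\<^sup>2) * inverse (1 + y\<^sup>2)" if "v \<le> y" for y
    proof -
      have "norm (f (Complex c y)) \<le> E / y\<^sup>2"
        unfolding f_def E_def using that v by (intro norm_capacity_integrand_zero_le) auto
      moreover have "1 / y\<^sup>2 \<le> (1 + 1 / v\<^sup>2) * inverse (1 + y\<^sup>2)"
      proof -
        have "v\<^sup>2 \<le> y\<^sup>2" using that v by (intro power_mono) auto
        then have "1 + y\<^sup>2 \<le> (1 + 1 / v\<^sup>2) * y\<^sup>2" using v by (simp add: field_simps)
        moreover have "0 < y\<^sup>2" "0 < 1 + y\<^sup>2" using that v by (auto simp: add_pos_nonneg)
        ultimately show ?thesis by (simp add: divide_simps)
      qed
      then have "E * (1 / y\<^sup>2) \<le> E * ((1 + 1 / v\<^sup>2) * inverse (1 + y\<^sup>2))"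
        by (intro mult_left_mono) (auto simp: E_def)
      ultimately show ?thesis by (simp add: mult.assoc)
    qed
    then show "AE y in lborel. y \<in> {v..} \<longrightarrow> norm (f (Complex c y)) \<le> norm (E * (1 + 1 / v\<^sup>2) * inverse (1 + y\<^sup>2))"
      by (intro AE_I2) (auto intro: order_trans[OF _ abs_ge_self])
  qed (simp add: set_borel_measurable_def)
  define A where "A = (\<lambda>T. LINT s:{-T..c}|lborel. f (Complex s v))"
  define B where "B = (\<lambda>T. LINT y:{v..T}|lborel. f (Complex c y))"
  have limA: "(A \<longlongrightarrow> (LINT s:{..c}|lborel. f (Complex s v))) at_top"
  proof (rule Lim_transform_eventually)
    show "((\<lambda>T. LINT s:{-T..T}|lborel. indicat_real {..c} s *\<^sub>R f (Complex s v)) \<longlongrightarrow> (LINT s:{..c}|lborel. f (Complex s v))) at_top"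
      using tendsto_truncated_integral[OF i1[unfolded set_integrable_def]] unfolding set_lebesgue_integral_def .
    show "\<forall>\<^sub>F T in at_top. (LINT s:{-T..T}|lborel. indicat_real {..c} s *\<^sub>R f (Complex s v)) = A T"
      using eventually_ge_at_top[of "\<bar>c\<bar>"]
      by eventually_elim (auto simp: A_def set_lebesgue_integral_def indicator_def intro!: Bochner_Integration.integral_cong)
  qed
  have limB: "(B \<longlongrightarrow> (LINT y:{v..}|lborel. f (Complex c y))) at_top"
  proof (rule Lim_transform_eventually)
    show "((\<lambda>T. LINT y:{-T..T}|lborel. indicat_real {v..} y *\<^sub>R f (Complex c y)) \<longlongrightarrow> (LINT y:{v..}|lborel. f (Complex c y))) at_top"
      using tendsto_truncated_integral[OF i2[unfolded set_integrable_def]] unfolding set_lebesgue_integral_def .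
    show "\<forall>\<^sub>F T in at_top. (LINT y:{-T..T}|lborel. indicat_real {v..} y *\<^sub>R f (Complex c y)) = B T"
      using eventually_ge_at_top[of "v"]
      by eventually_elim (use v in \<open>auto simp: B_def set_lebesgue_integral_def indicator_def intro!: Bochner_Integration.integral_cong\<close>)
  qed
  have lim0: "((\<lambda>T. A T + \<i> * B T) \<longlongrightarrow> 0) at_top"
  proof (rule Lim_null_comparison)
    show "((\<lambda>T. (T - v) * (K * exp (\<bar>ln x\<bar> * (- T))) + (c + T) * (exp (\<bar>ln x\<bar> * \<bar>c\<bar>) / T\<^sup>2)) \<longlongrightarrow> 0) at_top"
    proof -
      have l: "\<bar>ln x\<bar> > 0" using x by simp
      have "((\<lambda>T. (T - v) * (K * exp (b * (- T))) + (c + T) * (exp (b * \<bar>c\<bar>) / T\<^sup>2)) \<longlongrightarrow> 0) at_top" if "b > 0" for b :: real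
        using that by real_asymp
      from this[OF l] show ?thesis .
    qed
    show "\<forall>\<^sub>F T in at_top. norm (A T + \<i> * B T) \<le> (T - v) * (K * exp (\<bar>ln x\<bar> * (- T))) + (c + T) * (exp (\<bar>ln x\<bar> * \<bar>c\<bar>) / T\<^sup>2)"
      using eventually_ge_at_top[of "v"] eventually_ge_at_top[of "\<bar>c\<bar>"]
    proof eventually_elim
      case (elim T)
      have hol: "f holomorphic_on {t. Im t > 0}"
        unfolding f_def by (intro holomorphic_capacity_integrand) (auto elim!: Ints_cases)
      have "A T + \<i> * B T = \<i> * (LINT y:{v..T}|lborel. f (Complex (-T) y)) + (LINT s:{-T..c}|lborel. f (Complex s T))"
        unfolding A_def B_def using elim v
        by (intro rectangle_integral[OF hol convex_halfspace_Im_gt open_halfspace_Im_gt]) auto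
      then have "norm (A T + \<i> * B T) \<le> norm (LINT y:{v..T}|lborel. f (Complex (-T) y)) + norm (LINT s:{-T..c}|lborel. f (Complex s T))"
        using norm_triangle_ineq[of "\<i> * (LINT y:{v..T}|lborel. f (Complex (-T) y))"] by (simp add: norm_mult)
      also have "\<dots> \<le> (T - v) * (K * exp (\<bar>ln x\<bar> * (- T))) + (c + T) * (exp (\<bar>ln x\<bar> * \<bar>c\<bar>) / T\<^sup>2)"
      proof (rule add_mono)
        show "norm (LINT y:{v..T}|lborel. f (Complex (-T) y)) \<le> (T - v) * (K * exp (\<bar>ln x\<bar> * (- T)))"
          using elim fK[of _ "-T"] by (intro norm_set_integral_le_const) auto
        have "norm (f (Complex s T)) \<le> exp (\<bar>ln x\<bar> * \<bar>c\<bar>) / T\<^sup>2" if "s \<le> c" for s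
        proof -
          have T: "T > 0" using v elim by simp
          have "norm (mellin_log (Complex s T)) \<le> pi / (\<bar>T\<bar> * sinh (pi * \<bar>T\<bar>))"
            using T by (intro norm_mellin_log_le_sinh) auto
          also have "\<dots> \<le> pi / (T * (pi * T))"
            using T sinh_ge_self[of "pi * T"] by (intro frac_le mult_mono) auto
          also have "\<dots> = 1 / T\<^sup>2" by (simp add: power2_eq_square)
          finally have 1: "norm (mellin_log (Complex s T)) \<le> 1 / T\<^sup>2" .
          have "\<bar>ln x\<bar> * s \<le> \<bar>ln x\<bar> * \<bar>c\<bar>" using that by (intro mult_left_mono) auto
          then have "- s * ln x \<le> \<bar>ln x\<bar> * \<bar>c\<bar>" using x by (simp add: mult.commute)
          then have "norm (mellin_log (Complex s T)) * exp (- s * ln x) \<le> 1 / T\<^sup>2 * exp (\<bar>ln x\<bar> * \<bar>c\<bar>)"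
            using 1 by (intro mult_mono) auto
          then show ?thesis by (simp add: f_def norm_capacity_integrand_zero)
        qed
        then show "norm (LINT s:{-T..c}|lborel. f (Complex s T)) \<le> (c + T) * (exp (\<bar>ln x\<bar> * \<bar>c\<bar>) / T\<^sup>2)"
          using norm_set_integral_le_const[of "-T" c "\<lambda>s. f (Complex s T)" "exp (\<bar>ln x\<bar> * \<bar>c\<bar>) / T\<^sup>2"] elim by simp
      qed
      finally show ?case .
    qed
  qed
  show "(LINT s:{..c}|lborel. f (Complex s v)) + \<i> * (LINT y:{v..}|lborel. f (Complex c y)) = 0"
    by (rule tendsto_unique[OF _ tendsto_add[OF limA tendsto_mult[OF tendsto_const limB]] lim0]) simp
qed

lemma set_integral_split:
  fixes f :: "real \<Rightarrow> complex"
  assumes "set_integrable lborel A f" "set_integrable lborel B f" "A \<in> sets borel" "B \<in> sets borel"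
    and "A \<inter> B \<subseteq> {c}"
  shows "(LINT x:A \<union> B|lborel. f x) = (LINT x:A|lborel. f x) + (LINT x:B|lborel. f x)"
proof (rule set_integral_Un_AE)
  show "AE x in lborel. \<not> (x \<in> A \<and> x \<in> B)"
    using AE_lborel_singleton[of c] by eventually_elim (use assms in auto)
qed (use assms in auto)

lemma set_integrable_combine:
  fixes f :: "real \<Rightarrow> complex"
  assumes "set_integrable lborel A f" "set_integrable lborel B f" "A \<in> sets borel" "B \<in> sets borel"
  shows "set_integrable lborel (A \<union> B) f"
  using assms by (intro set_integrable_Un) auto

lemma capacity_integrand_zero_cnj: "capacity_integrand 0 x (cnj t) = cnj (capacity_integrand 0 x t)"
proof -
  have "sin (of_real pi * cnj t) = cnj (sin (of_real pi * t))"
    by (simp add: sin_exp_eq exp_cnj field_simps)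
  moreover have "exp (- cnj t * of_real (ln x)) = cnj (exp (- t * of_real (ln x)))"
    by (simp add: exp_cnj)
  ultimately show ?thesis by (simp add: capacity_integrand_def mellin_log_def)
qed

lemma left_loop_value_log:
  assumes x: "0 < x" "x < 1" and c: "c \<notin> \<int>" and uv: "u < 0" "0 < v"
  shows "left_loop_value (capacity_integrand 0 x) (c, u, v) = line_value (capacity_integrand 0 x) c"
proof -
  define f where "f = capacity_integrand 0 x"
  have cnj: "f (Complex s (- y)) = cnj (f (Complex s y))" for s y
    unfolding f_def capacity_integrand_zero_cnj[symmetric] cnj_Complex ..
  note up = quarter_plane_log_integral[OF x uv(2), folded f_def]
  have u': "- u > 0" using uv by simp
  note lo = quarter_plane_log_integral[OF x u', folded f_def]
  have 1: "(LINT s:{..c}|lborel. f (Complex s u)) = cnj (LINT s:{..c}|lborel. f (Complex s (- u)))"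
  proof -
    have "(LINT s:{..c}|lborel. f (Complex s u)) = (LINT s:{..c}|lborel. cnj (f (Complex s (- u))))"
      using cnj[of _ "- u"] by simp
    also have "\<dots> = (LINT s|lborel. cnj (indicat_real {..c} s *\<^sub>R f (Complex s (- u))))"
      unfolding set_lebesgue_integral_def by (intro Bochner_Integration.integral_cong) auto
    also have "\<dots> = cnj (LINT s:{..c}|lborel. f (Complex s (- u)))"
      unfolding set_lebesgue_integral_def by (rule Bochner_Integration.integral_cnj)
    finally show ?thesis .
  qed
  have 2: "(LINT y:{..u}|lborel. f (Complex c y)) = cnj (LINT y:{-u..}|lborel. f (Complex c y))"
  proof -
    have "(LINT y:{..u}|lborel. f (Complex c y)) = (LINT y|lborel. indicat_real {..u} (- y) *\<^sub>R f (Complex c (- y)))"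
      unfolding set_lebesgue_integral_def by (subst lborel_integral_real_affine[where c = "-1" and t = 0]) auto
    also have "\<dots> = (LINT y|lborel. cnj (indicat_real {-u..} y *\<^sub>R f (Complex c y)))"
      by (intro Bochner_Integration.integral_cong) (auto simp: cnj indicator_def)
    also have "\<dots> = cnj (LINT y:{-u..}|lborel. f (Complex c y))"
      unfolding set_lebesgue_integral_def by (rule Bochner_Integration.integral_cnj)
    finally show ?thesis .
  qed
  have "cnj ((LINT s:{..c}|lborel. f (Complex s (- u))) + \<i> * (LINT y:{-u..}|lborel. f (Complex c y))) = 0"
    using lo(3)[of c] by simp
  then have low: "(LINT s:{..c}|lborel. f (Complex s u)) = \<i> * (LINT y:{..u}|lborel. f (Complex c y))"
    by (simp add: 1 2)
  have upp: "(LINT s:{..c}|lborel. f (Complex s v)) = - (\<i> * (LINT y:{v..}|lborel. f (Complex c y)))"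
    using up(3)[of c] by (simp add: add_eq_0_iff2)
  have int: "integrable lborel (\<lambda>y. f (Complex c y))"
    unfolding f_def by (rule integrable_capacity_integrand_zero[OF c])
  have i: "set_integrable lborel A (\<lambda>y. f (Complex c y))" if "A \<in> sets borel" for A
    unfolding set_integrable_def using int that by (intro integrable_mult_indicator) auto
  have "(LINT y|lborel. f (Complex c y)) = (LINT y:({..u} \<union> {u..v}) \<union> {v..}|lborel. f (Complex c y))"
  proof -
    have "({..u} \<union> {u..v}) \<union> {v..} = UNIV" by auto
    then show ?thesis by (simp add: set_lebesgue_integral_def)
  qed
  also have "\<dots> = (LINT y:{..u}|lborel. f (Complex c y)) + (LINT y:{u..v}|lborel. f (Complex c y)) + (LINT y:{v..}|lborel. f (Complex c y))"
    using uv by (subst set_integral_split[where c = v]; (subst set_integral_split[where c = u])?) (auto intro!: i)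
  finally show ?thesis
    unfolding left_loop_value_def line_value_def f_def[symmetric] prod.case low upp
    by (simp add: algebra_simps)
qed

lemma norm_capacity_integrand:
  "norm (capacity_integrand q z (Complex a y)) =
    norm (mellin_log (Complex a y)) * norm (rGamma (Complex (1 + q * a) (q * y))) * exp (- a * ln z)"
proof -
  have "1 + of_real q * Complex a y = Complex (1 + q * a) (q * y)" by (simp add: complex_eq_iff)
  then show ?thesis by (simp add: capacity_integrand_def norm_mult)
qed

lemma Gamma_ge_exp:
  fixes b c :: real
  assumes "b \<ge> 0"
  shows "exp (c * b) \<le> exp (exp c + 1) * Gamma (1 + b)"
proof -
  define A where "A = exp c"
  have A: "A > 0" by (simp add: A_def)
  have hi: "((\<lambda>t. t powr (1 + b - 1) / exp t) has_integral Gamma (1 + b)) {0..}"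
    using assms by (intro Gamma_integral_real) auto
  have "A powr b * exp (- (A + 1)) = integral {A..A+1} (\<lambda>t. A powr b * exp (- (A + 1)))" by simp
  also have "\<dots> \<le> integral {0..} (\<lambda>t. t powr (1 + b - 1) / exp t)"
  proof -
    have io: "(\<lambda>t. t powr (1 + b - 1) / exp t) integrable_on {A..A+1}"
      using A by (intro integrable_continuous_interval continuous_intros) auto
    have "integral {A..A+1} (\<lambda>t. A powr b * exp (- (A + 1))) \<le> integral {A..A+1} (\<lambda>t. t powr (1 + b - 1) / exp t)"
    proof (rule integral_le)
      fix t assume t: "t \<in> {A..A+1}"
      have "A powr b * exp (- (A + 1)) \<le> t powr b * exp (- t)"
        using t A assms by (intro mult_mono powr_mono2) auto
      then show "A powr b * exp (- (A + 1)) \<le> t powr (1 + b - 1) / exp t"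
        by (simp add: exp_minus divide_inverse)
    qed (use io in auto)
    also have "\<dots> \<le> integral {0..} (\<lambda>t. t powr (1 + b - 1) / exp t)"
      using A hi io by (intro integral_subset_le) (auto simp: has_integral_integrable)
    finally show ?thesis .
  qed
  also have "\<dots> = Gamma (1 + b)" using hi by (rule integral_unique)
  finally have le: "A powr b * exp (- (A + 1)) * exp (A + 1) \<le> Gamma (1 + b) * exp (A + 1)" by (intro mult_right_mono) auto
  have e: "A powr b * exp (- (A + 1)) * exp (A + 1) = exp (c * b)"
    by (simp add: A_def powr_def mult.assoc flip: exp_add)
  show ?thesis using le[unfolded e] by (simp only: A_def mult.commute)
qed

lemma exp_over_Gamma_bound:
  fixes q c0 z :: real
  assumes q: "q < 0" and c0: "1 + q * c0 > 0"
  shows "\<exists>K>0. \<forall>s\<le>c0. exp (- s * ln z) / Gamma (1 + q * s) \<le> K * exp s"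
proof -
  obtain K1 where K1: "K1 > 0" "\<And>x. 1 + q * c0 \<le> x \<Longrightarrow> x \<le> 1 \<Longrightarrow> 1 / Gamma x \<le> K1"
    using inverse_Gamma_bounded[OF c0, of 1] by auto
  define c where "c = (1 + ln z) / (- q)"
  define K where "K = exp (exp c + 1) + exp (\<bar>c0\<bar> * \<bar>ln z\<bar>) * K1"
  show ?thesis
  proof (rule exI[of _ K], intro conjI allI impI)
    show "K > 0" using K1 unfolding K_def by (intro add_pos_pos mult_pos_pos) auto
    fix s assume s: "s \<le> c0"
    show "exp (- s * ln z) / Gamma (1 + q * s) \<le> K * exp s"
    proof (cases "s \<le> 0")
      case True
      have b: "q * s \<ge> 0" using True q by (simp add: mult_nonpos_nonpos)
      have G: "Gamma (1 + q * s) > 0" using b by (intro Gamma_real_pos) auto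
      have "c * (q * s) = - s - s * ln z" using q by (simp add: c_def field_simps)
      then have "exp (- s - s * ln z) \<le> exp (exp c + 1) * Gamma (1 + q * s)" using Gamma_ge_exp[OF b, of c] by simp
      then have "exp (- s - s * ln z) / Gamma (1 + q * s) \<le> exp (exp c + 1)" using G by (simp add: pos_divide_le_eq)
      also have "\<dots> \<le> K" using K1 unfolding K_def by simp
      finally have le: "exp (- s - s * ln z) / Gamma (1 + q * s) * exp s \<le> K * exp s" by (intro mult_right_mono) auto
      have e: "exp (- s - s * ln z) * exp s = exp (- s * ln z)" by (simp flip: exp_add)
      show ?thesis using le unfolding times_divide_eq_left e .
    next
      case False
      have r: "1 + q * c0 \<le> 1 + q * s" "1 + q * s \<le> 1" using False s q by (auto intro!: mult_left_mono_neg mult_nonpos_nonneg)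
      have "- s * ln z \<le> \<bar>s\<bar> * \<bar>ln z\<bar>" by (metis abs_ge_self abs_minus abs_mult)
      also have "\<dots> \<le> \<bar>c0\<bar> * \<bar>ln z\<bar>" using False s by (intro mult_right_mono) auto
      finally have "exp (- s * ln z) * (1 / Gamma (1 + q * s)) \<le> exp (\<bar>c0\<bar> * \<bar>ln z\<bar>) * K1"
        using K1(1) K1(2)[OF r] Gamma_real_pos[of "1 + q * s"] r c0 by (intro mult_mono) auto
      also have "\<dots> \<le> K" unfolding K_def by simp
      also have "K \<le> K * exp s" using False \<open>K > 0\<close> by simp
      finally show ?thesis by simp
    qed
  qed
qed

lemma capacity_integrand_strip_bound:
  fixes q c0 z m M :: real
  assumes q: "q < 0" and c0: "1 + q * c0 > 0" and m: "0 < m"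
  shows "\<exists>K>0. \<forall>s\<le>c0. \<forall>y. m \<le> \<bar>y\<bar> \<longrightarrow> \<bar>y\<bar> \<le> M \<longrightarrow> norm (capacity_integrand q z (Complex s y)) \<le> K * exp s"
proof -
  obtain K1 where K1: "K1 > 0" "\<And>s. s \<le> c0 \<Longrightarrow> exp (- s * ln z) / Gamma (1 + q * s) \<le> K1 * exp s"
    using exp_over_Gamma_bound[OF q c0] by blast
  define K2 where "K2 = pi / (m * sinh (pi * m))"
  define K3 where "K3 = rGamma_ratio (1 + q * c0) (q * M)"
  have K2: "K2 > 0" using m by (simp add: K2_def)
  have K3: "K3 > 0" using rGamma_ratio_ge_1[OF c0, of "q * M"] by (simp add: K3_def)
  show ?thesis
  proof (rule exI[of _ "K2 * K3 * K1"], intro conjI allI impI)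
    show "K2 * K3 * K1 > 0" using K1 K2 K3 by simp
    fix s y assume s: "s \<le> c0" and y: "m \<le> \<bar>y\<bar>" "\<bar>y\<bar> \<le> M"
    have a: "1 + q * c0 \<le> 1 + q * s" using s q by (simp add: mult_left_mono_neg)
    have G: "Gamma (1 + q * s) > 0" using a c0 by (intro Gamma_real_pos) auto
    have "norm (mellin_log (Complex s y)) \<le> pi / (\<bar>y\<bar> * sinh (pi * \<bar>y\<bar>))"
      using y m by (intro norm_mellin_log_le_sinh) auto
    also have "\<dots> \<le> K2" unfolding K2_def using y m by (intro frac_le mult_mono) auto
    finally have 1: "norm (mellin_log (Complex s y)) \<le> K2" .
    have "\<bar>q * y\<bar> \<le> \<bar>q * M\<bar>" using y by (simp add: abs_mult mult_left_mono)
    then have "rGamma_ratio (1 + q * s) (q * y) \<le> K3" unfolding K3_def using a c0 by (intro rGamma_ratio_mono) auto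
    then have 2: "norm (rGamma (Complex (1 + q * s) (q * y))) \<le> K3 / Gamma (1 + q * s)"
      using a c0 G by (subst norm_rGamma_eq) (auto intro!: divide_right_mono)
    have "norm (capacity_integrand q z (Complex s y)) \<le> K2 * (K3 / Gamma (1 + q * s)) * exp (- s * ln z)"
      unfolding norm_capacity_integrand using 1 2 K2 K3 G by (intro mult_mono mult_nonneg_nonneg divide_nonneg_nonneg) auto
    also have "\<dots> = K2 * K3 * (exp (- s * ln z) / Gamma (1 + q * s))" by simp
    also have "\<dots> \<le> K2 * K3 * (K1 * exp s)" using K1(2)[OF s] K2 K3 by (intro mult_left_mono) auto
    finally show "norm (capacity_integrand q z (Complex s y)) \<le> K2 * K3 * K1 * exp s" by (simp add: mult_ac)
  qed
qed

lemma set_integrable_exp_bound: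
  fixes f :: "real \<Rightarrow> complex"
  assumes [measurable]: "f \<in> borel_measurable borel" and le: "\<And>s. s \<le> c \<Longrightarrow> norm (f s) \<le> K * exp s"
  shows "set_integrable lborel {..c} f"
proof (rule set_integrable_bound)
  show "set_integrable lborel {..c} (\<lambda>s. K * exp (1 * s))"
    by (intro set_integrable_mult_right set_integrable_exp_atMost) auto
  show "AE s in lborel. s \<in> {..c} \<longrightarrow> norm (f s) \<le> norm (K * exp (1 * s))"
    using le by (intro AE_I2) (auto intro: order_trans[OF _ abs_ge_self])
qed (simp add: set_borel_measurable_def)

lemma half_strip_integral:
  assumes hol: "f holomorphic_on S" "convex S" "open S" and v: "v \<le> v'"
    and S: "\<And>s y. s \<le> c \<Longrightarrow> v \<le> y \<Longrightarrow> y \<le> v' \<Longrightarrow> Complex s y \<in> S"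
    and le: "\<And>s y. s \<le> c \<Longrightarrow> v \<le> y \<Longrightarrow> y \<le> v' \<Longrightarrow> norm (f (Complex s y)) \<le> K * exp s"
    and [measurable]: "f \<in> borel_measurable borel"
  shows "(LINT s:{..c}|lborel. f (Complex s v)) + \<i> * (LINT y:{v..v'}|lborel. f (Complex c y)) =
    (LINT s:{..c}|lborel. f (Complex s v'))"
proof -
  define H where "H = (\<lambda>y T. LINT s:{-T..c}|lborel. f (Complex s y))"
  have lim: "(H y \<longlongrightarrow> (LINT s:{..c}|lborel. f (Complex s y))) at_top" if "v \<le> y" "y \<le> v'" for y
  proof (rule Lim_transform_eventually)
    have i: "set_integrable lborel {..c} (\<lambda>s. f (Complex s y))"
      by (rule set_integrable_exp_bound[where K = K]) (use le that in auto)
    show "((\<lambda>T. LINT s:{-T..T}|lborel. indicat_real {..c} s *\<^sub>R f (Complex s y)) \<longlongrightarrow> (LINT s:{..c}|lborel. f (Complex s y))) at_top"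
      using tendsto_truncated_integral[OF i[unfolded set_integrable_def]] unfolding set_lebesgue_integral_def .
    show "\<forall>\<^sub>F T in at_top. (LINT s:{-T..T}|lborel. indicat_real {..c} s *\<^sub>R f (Complex s y)) = H y T"
      using eventually_ge_at_top[of "\<bar>c\<bar>"]
      by eventually_elim (auto simp: H_def set_lebesgue_integral_def indicator_def intro!: Bochner_Integration.integral_cong)
  qed
  let ?V = "\<i> * (LINT y:{v..v'}|lborel. f (Complex c y))"
  have l0: "((\<lambda>T. H v T + ?V - H v' T) \<longlongrightarrow> 0) at_top"
  proof (rule Lim_null_comparison)
    show "((\<lambda>T. (v' - v) * (K * exp (- T))) \<longlongrightarrow> 0) at_top" by real_asymp
    show "\<forall>\<^sub>F T in at_top. norm (H v T + ?V - H v' T) \<le> (v' - v) * (K * exp (- T))"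
      using eventually_ge_at_top[of "\<bar>c\<bar>"]
    proof eventually_elim
      case (elim T)
      have "H v T + ?V = \<i> * (LINT y:{v..v'}|lborel. f (Complex (-T) y)) + H v' T"
        unfolding H_def using elim v S by (intro rectangle_integral[OF hol]) auto
      then have "norm (H v T + ?V - H v' T) = norm (LINT y:{v..v'}|lborel. f (Complex (-T) y))" by (simp add: norm_mult)
      also have "\<dots> \<le> (v' - v) * (K * exp (- T))"
        using le[of "-T"] elim v by (intro norm_set_integral_le_const) auto
      finally show ?case .
    qed
  qed
  have l1: "((\<lambda>T. H v T + ?V - H v' T) \<longlongrightarrow>
      (LINT s:{..c}|lborel. f (Complex s v)) + ?V - (LINT s:{..c}|lborel. f (Complex s v'))) at_top"
    using v by (intro tendsto_intros lim) auto
  have "(LINT s:{..c}|lborel. f (Complex s v)) + ?V - (LINT s:{..c}|lborel. f (Complex s v')) = 0"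
    by (rule tendsto_unique[OF _ l1 l0]) simp
  then show ?thesis by simp
qed

lemma continuous_on_capacity_integrand_vertical:
  assumes "c \<notin> \<int>"
  shows "continuous_on A (\<lambda>y. capacity_integrand q z (Complex c y))"
proof (rule continuous_on_compose2[where g = "capacity_integrand q z" and f = "\<lambda>y. Complex c y" and t = "- \<int>"])
  show "continuous_on (- \<int>) (capacity_integrand q z)"
    by (intro holomorphic_on_imp_continuous_on holomorphic_capacity_integrand) auto
  show "continuous_on A (\<lambda>y. Complex c y)" by (auto simp: Complex_eq intro!: continuous_intros)
qed (use assms Complex_notin_Ints in auto)

lemma continuous_on_capacity_integrand_horizontal:
  assumes "y \<noteq> 0"
  shows "continuous_on A (\<lambda>s. capacity_integrand q z (Complex s y))"
proof (rule continuous_on_compose2[where g = "capacity_integrand q z" and f = "\<lambda>s. Complex s y" and t = "- \<int>"])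
  show "continuous_on (- \<int>) (capacity_integrand q z)"
    by (intro holomorphic_on_imp_continuous_on holomorphic_capacity_integrand) auto
  show "continuous_on A (\<lambda>s. Complex s y)" by (auto simp: Complex_eq intro!: continuous_intros)
qed (use assms Complex_notin_Ints in auto)

lemma set_integrable_capacity_integrand_ray:
  assumes q: "q < 0" and y: "y \<noteq> 0"
  shows "set_integrable lborel {..c} (\<lambda>s. capacity_integrand q z (Complex s y))"
proof -
  define b where "b = min c 0"
  have "1 + q * b > 0" using q by (simp add: b_def min_def mult_nonpos_nonpos add_pos_nonneg)
  from capacity_integrand_strip_bound[OF q this, of "\<bar>y\<bar>" "\<bar>y\<bar>" z] y
  obtain K where "\<And>s. s \<le> b \<Longrightarrow> norm (capacity_integrand q z (Complex s y)) \<le> K * exp s" by auto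
  then have "set_integrable lborel {..b} (\<lambda>s. capacity_integrand q z (Complex s y))"
    by (intro set_integrable_exp_bound) auto
  moreover have "set_integrable lborel {b..c} (\<lambda>s. capacity_integrand q z (Complex s y))"
    by (intro set_integrable_continuous_segment continuous_on_capacity_integrand_horizontal y)
  ultimately have "set_integrable lborel ({..b} \<union> {b..c}) (\<lambda>s. capacity_integrand q z (Complex s y))"
    by (intro set_integrable_combine) auto
  moreover have "{..b} \<union> {b..c} = {..c}" by (auto simp: b_def)
  ultimately show ?thesis by simp
qed

lemma left_loop_value_shift_abscissa:
  fixes n :: int
  assumes q: "q < 0" and u: "u < 0" "0 < v" and c: "real_of_int n < c" "c \<le> c'" "c' < real_of_int n + 1"
  shows "left_loop_value (capacity_integrand q z) (c, u, v) = left_loop_value (capacity_integrand q z) (c', u, v)"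
proof -
  let ?f = "capacity_integrand q z"
  have H: "(LINT s:{..c'}|lborel. ?f (Complex s y)) = (LINT s:{..c}|lborel. ?f (Complex s y)) + (LINT s:{c..c'}|lborel. ?f (Complex s y))"
    if "y \<noteq> 0" for y
  proof -
    have "{..c'} = {..c} \<union> {c..c'}" using c by auto
    then show ?thesis
      using that q by (simp only:) (intro set_integral_split[where c = c] set_integrable_capacity_integrand_ray
          set_integrable_continuous_segment continuous_on_capacity_integrand_horizontal, auto)
  qed
  have "(LINT s:{c..c'}|lborel. ?f (Complex s u)) + \<i> * (LINT y:{u..v}|lborel. ?f (Complex c' y)) =
    \<i> * (LINT y:{u..v}|lborel. ?f (Complex c y)) + (LINT s:{c..c'}|lborel. ?f (Complex s v))"
    using c u by (intro rectangle_integral[OF holomorphic_capacity_integrand[OF Re_strip_Ints[of n]] convex_Re_strip open_Re_strip]) auto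
  then show ?thesis
    using u unfolding left_loop_value_def prod.case by (simp add: H algebra_simps)
qed

lemma left_loop_value_shift_ordinates:
  assumes q: "q < 0" and c: "c \<notin> \<int>" "1 + q * c > 0"
    and u: "u' \<le> u" "u < 0" "0 < v" "v \<le> v'"
  shows "left_loop_value (capacity_integrand q z) (c, u, v) = left_loop_value (capacity_integrand q z) (c, u', v')"
proof -
  let ?f = "capacity_integrand q z"
  obtain K1 where "\<forall>s\<le>c. \<forall>y. v \<le> \<bar>y\<bar> \<longrightarrow> \<bar>y\<bar> \<le> v' \<longrightarrow> norm (?f (Complex s y)) \<le> K1 * exp s"
    using capacity_integrand_strip_bound[OF q c(2) u(3), of v' z] by blast
  then have K1: "norm (?f (Complex s y)) \<le> K1 * exp s" if "s \<le> c" "v \<le> y" "y \<le> v'" for s y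
    using that u by auto
  have "- u > 0" using u by simp
  from capacity_integrand_strip_bound[OF q c(2) this, of "-u'" z]
  obtain K2 where "\<forall>s\<le>c. \<forall>y. - u \<le> \<bar>y\<bar> \<longrightarrow> \<bar>y\<bar> \<le> - u' \<longrightarrow> norm (?f (Complex s y)) \<le> K2 * exp s"
    by blast
  then have K2: "norm (?f (Complex s y)) \<le> K2 * exp s" if "s \<le> c" "u' \<le> y" "y \<le> u" for s y
    using that u by auto
  have hol: "?f holomorphic_on {t. Im t > 0}" "?f holomorphic_on {t. Im t < 0}"
    by (intro holomorphic_capacity_integrand; auto elim!: Ints_cases)+
  have V: "(LINT s:{..c}|lborel. ?f (Complex s v)) + \<i> * (LINT y:{v..v'}|lborel. ?f (Complex c y)) = (LINT s:{..c}|lborel. ?f (Complex s v'))"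
    using u K1 by (intro half_strip_integral[OF hol(1) convex_halfspace_Im_gt open_halfspace_Im_gt]) auto
  have U: "(LINT s:{..c}|lborel. ?f (Complex s u')) + \<i> * (LINT y:{u'..u}|lborel. ?f (Complex c y)) = (LINT s:{..c}|lborel. ?f (Complex s u))"
    using u K2 by (intro half_strip_integral[OF hol(2) convex_halfspace_Im_lt open_halfspace_Im_lt]) auto
  have sp: "{u'..v'} = ({u'..u} \<union> {u..v}) \<union> {v..v'}" using u by auto
  have i: "set_integrable lborel {a..b} (\<lambda>y. ?f (Complex c y))" for a b
    by (intro set_integrable_continuous_segment continuous_on_capacity_integrand_vertical c)
  have "(LINT y:({u'..u} \<union> {u..v}) \<union> {v..v'}|lborel. ?f (Complex c y)) =
      (LINT y:{u'..u} \<union> {u..v}|lborel. ?f (Complex c y)) + (LINT y:{v..v'}|lborel. ?f (Complex c y))"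
    using u by (intro set_integral_split[where c = v] set_integrable_combine i) auto
  moreover have "(LINT y:{u'..u} \<union> {u..v}|lborel. ?f (Complex c y)) =
      (LINT y:{u'..u}|lborel. ?f (Complex c y)) + (LINT y:{u..v}|lborel. ?f (Complex c y))"
    using u by (intro set_integral_split[where c = u] i) auto
  moreover note sp
  ultimately have "(LINT y:{u'..v'}|lborel. ?f (Complex c y)) = (LINT y:{u'..u}|lborel. ?f (Complex c y)) + (LINT y:{u..v}|lborel. ?f (Complex c y)) + (LINT y:{v..v'}|lborel. ?f (Complex c y))"
    by (simp only:)
  then show ?thesis
    unfolding left_loop_value_def prod.case U[symmetric] V[symmetric] by (simp add: algebra_simps)
qed

lemma left_loop_value_unique:
  fixes n :: int
  assumes q: "q < 0" and uv: "u < 0" "0 < v" and c: "real_of_int n < c" "c < real_of_int n + 1"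
    and c0: "real_of_int n < c0" "c0 < real_of_int n + 1" "1 + q * c0 > 0"
  shows "left_loop_value (capacity_integrand q z) (c, u, v) = left_loop_value (capacity_integrand q z) (c0, -1, 1)"
proof -
  have ni: "c0 \<notin> \<int>" using c0 by (auto elim!: Ints_cases)
  have "left_loop_value (capacity_integrand q z) (c, u, v) = left_loop_value (capacity_integrand q z) (c0, u, v)"
  proof (cases "c \<le> c0")
    case True
    then show ?thesis using c c0 by (intro left_loop_value_shift_abscissa[OF q uv, of n])
  next
    case False
    then show ?thesis using c c0 by (intro left_loop_value_shift_abscissa[OF q uv, of n, symmetric]) auto
  qed
  also have "left_loop_value (capacity_integrand q z) (c0, u, v) = left_loop_value (capacity_integrand q z) (c0, min u (-1), max v 1)"
    using uv by (intro left_loop_value_shift_ordinates q ni c0) auto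
  also have "\<dots> = left_loop_value (capacity_integrand q z) (c0, -1, 1)"
    by (rule left_loop_value_shift_ordinates[symmetric]) (use q ni c0 in auto)
  finally show ?thesis .
qed

section \<open>Laplace transforms of Mellin--Barnes integrals\<close>

lemma borel_measurable_Gamma_real [measurable (raw)]:
  assumes "f \<in> borel_measurable M"
  shows "(\<lambda>x. Gamma (f x :: real)) \<in> borel_measurable M"
proof -
  have "(\<lambda>x. Gamma (f x)) = (\<lambda>x. inverse (Re (rGamma (of_real (f x)))))"
    by (simp add: Gamma_def rGamma_complex_of_real)
  then show ?thesis using assms by simp
qed

lemma Gamma_Laplace_integral:
  fixes w :: complex and \<sigma> :: real
  assumes w: "Re w > -1" and \<sigma>: "\<sigma> > 0"
  shows "set_integrable lborel {0<..} (\<lambda>s. of_real (\<sigma> * exp (- s * \<sigma>)) * exp (w * of_real (ln s)))"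
    and "(LINT s:{0<..}|lborel. of_real (\<sigma> * exp (- s * \<sigma>)) * exp (w * of_real (ln s))) =
      Gamma (1 + w) * exp (- w * of_real (ln \<sigma>))"
proof -
  let ?g = "\<lambda>t. complex_of_real t powr (1 + w - 1) / of_real (exp t)"
  define f where "f = (\<lambda>t. indicat_real {0<..} t *\<^sub>R (exp (w * of_real (ln t)) / of_real (exp t)))"
  have [measurable]: "f \<in> borel_measurable borel" unfolding f_def by measurable
  have fg: "f = (\<lambda>t. indicat_real {0<..} t *\<^sub>R ?g t)"
    by (auto simp: f_def fun_eq_iff indicator_def powr_def Ln_of_real)
  have "integrable lebesgue f"
    using absolutely_integrable_Gamma_integral'[of "1 + w"] w unfolding fg set_integrable_def by simp
  then have fi: "integrable lborel f" by (subst (asm) integrable_completion) auto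
  then have sg: "set_integrable lborel {0<..} ?g" unfolding set_integrable_def fg .
  have "(LINT t|lborel. f t) = (LINT t:{0<..}|lborel. ?g t)" unfolding set_lebesgue_integral_def fg ..
  also have "\<dots> = integral {0<..} ?g" by (rule set_borel_integral_eq_integral(2)[OF sg])
  also have "\<dots> = Gamma (1 + w)" using w by (intro integral_unique Gamma_integral_complex') auto
  finally have vf: "(LINT t|lborel. f t) = Gamma (1 + w)" .
  define k where "k = exp (w * of_real (ln \<sigma>))"
  have e: "indicat_real {0<..} s *\<^sub>R (of_real (\<sigma> * exp (- s * \<sigma>)) * exp (w * of_real (ln s))) =
      of_real \<sigma> * exp (- w * of_real (ln \<sigma>)) * f (0 + \<sigma> * s)" for s
  proof (cases "s > 0")
    case True
    then have "ln (\<sigma> * s) = ln \<sigma> + ln s" using \<sigma> by (simp add: ln_mult)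
    then have "exp (- w * of_real (ln \<sigma>)) * exp (w * of_real (ln (\<sigma> * s))) = exp (w * of_real (ln s))"
      by (simp add: algebra_simps flip: exp_add)
    moreover have "complex_of_real (exp (- s * \<sigma>)) = inverse (of_real (exp (\<sigma> * s)))"
      by (simp add: exp_minus mult.commute)
    ultimately show ?thesis using True \<sigma> by (simp add: f_def divide_inverse mult_ac)
  qed (use \<sigma> in \<open>auto simp: f_def indicator_def zero_less_mult_iff\<close>)
  show "set_integrable lborel {0<..} (\<lambda>s. of_real (\<sigma> * exp (- s * \<sigma>)) * exp (w * of_real (ln s)))"
    unfolding set_integrable_def e using \<sigma> fi by (intro integrable_mult_right lborel_integrable_real_affine) auto
  have "Gamma (1 + w) = \<sigma> *\<^sub>R (LINT s|lborel. f (0 + \<sigma> * s))"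
    unfolding vf[symmetric] using \<sigma> by (subst lborel_integral_real_affine[where c = \<sigma> and t = 0]) auto
  then show "(LINT s:{0<..}|lborel. of_real (\<sigma> * exp (- s * \<sigma>)) * exp (w * of_real (ln s))) =
      Gamma (1 + w) * exp (- w * of_real (ln \<sigma>))"
    unfolding set_lebesgue_integral_def e by (simp add: scaleR_conv_of_real mult_ac)
qed

lemma Gamma_Laplace_integral_real:
  fixes a \<sigma> :: real
  assumes a: "a > -1" and \<sigma>: "\<sigma> > 0"
  shows "set_integrable lborel {0<..} (\<lambda>s. \<sigma> * exp (- s * \<sigma>) * exp (a * ln s))"
    and "(LINT s:{0<..}|lborel. \<sigma> * exp (- s * \<sigma>) * exp (a * ln s)) = Gamma (1 + a) * exp (- a * ln \<sigma>)"
proof -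
  have e: "complex_of_real (\<sigma> * exp (- s * \<sigma>)) * exp (of_real a * of_real (ln s)) =
      of_real (\<sigma> * exp (- s * \<sigma>) * exp (a * ln s))" for s
    by (simp add: exp_of_real[symmetric])
  have a': "Re (complex_of_real a) > -1" using a by simp
  note G = Gamma_Laplace_integral[OF a' \<sigma>, unfolded e]
  have i: "integrable lborel (\<lambda>s. complex_of_real (indicat_real {0<..} s *\<^sub>R (\<sigma> * exp (- s * \<sigma>) * exp (a * ln s))))"
    using G(1) by (simp add: set_integrable_def scaleR_conv_of_real)
  then show "set_integrable lborel {0<..} (\<lambda>s. \<sigma> * exp (- s * \<sigma>) * exp (a * ln s))"
    unfolding set_integrable_def complex_of_real_integrable_eq .
  have "complex_of_real (LINT s:{0<..}|lborel. \<sigma> * exp (- s * \<sigma>) * exp (a * ln s)) =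
    (LINT s:{0<..}|lborel. complex_of_real (\<sigma> * exp (- s * \<sigma>) * exp (a * ln s)))"
    by (rule set_integral_complex_of_real[symmetric])
  also have "\<dots> = Gamma (1 + of_real a) * exp (- of_real a * of_real (ln \<sigma>))" by (rule G(2))
  also have "\<dots> = complex_of_real (Gamma (1 + a) * exp (- a * ln \<sigma>))"
    by (simp flip: Gamma_complex_of_real exp_of_real)
  finally show "(LINT s:{0<..}|lborel. \<sigma> * exp (- s * \<sigma>) * exp (a * ln s)) = Gamma (1 + a) * exp (- a * ln \<sigma>)"
    by (simp only: of_real_eq_iff)
qed

lemma Laplace_transform_Mellin_integral:
  fixes T g :: "real \<Rightarrow> complex" and q \<sigma> b :: real
  assumes [measurable]: "T \<in> borel_measurable borel" "g \<in> borel_measurable borel" "A \<in> sets borel"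
    and \<sigma>: "\<sigma> > 0" and T: "\<And>y. y \<in> A \<Longrightarrow> q * Re (T y) > -1"
    and int: "set_integrable lborel A (\<lambda>y. of_real (Gamma (1 + q * Re (T y))) * g y * exp (- T y * of_real (b + q * ln \<sigma>)))"
  defines "F \<equiv> \<lambda>s. LINT y:A|lborel. g y * exp (- T y * of_real (b - q * ln s))"
  shows "F \<in> borel_measurable borel"
    and "set_integrable lborel {0<..} (\<lambda>s. of_real (\<sigma> * exp (- s * \<sigma>)) * F s)"
    and "(LINT s:{0<..}|lborel. of_real (\<sigma> * exp (- s * \<sigma>)) * F s) =
      (LINT y:A|lborel. g y * Gamma (1 + of_real q * T y) * exp (- T y * of_real (b + q * ln \<sigma>)))"
proof -
  define P where "P = (\<lambda>y s. indicat_real A y *\<^sub>R (indicat_real {0<..} s *\<^sub>R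
      (of_real (\<sigma> * exp (- s * \<sigma>)) * (g y * exp (- T y * of_real (b - q * ln s))))))"
  have [measurable]: "(\<lambda>(y, s). P y s) \<in> borel_measurable (lborel \<Otimes>\<^sub>M lborel)"
    unfolding P_def by measurable
  show "F \<in> borel_measurable borel"
    unfolding F_def set_lebesgue_integral_def by measurable
  have P: "P y s = indicat_real A y *\<^sub>R (g y * exp (- T y * of_real b) *
      (indicat_real {0<..} s *\<^sub>R (of_real (\<sigma> * exp (- s * \<sigma>)) * exp ((of_real q * T y) * of_real (ln s)))))" for y s
  proof -
    have "- T y * of_real (b - q * ln s) = - T y * of_real b + (of_real q * T y) * of_real (ln s)"
      by (simp add: algebra_simps)
    then have e: "exp (- T y * of_real (b - q * ln s)) = exp (- T y * of_real b) * exp ((of_real q * T y) * of_real (ln s))"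
      by (simp only: exp_add)
    show ?thesis unfolding P_def e by (simp only: mult_scaleR_right mult_ac)
  qed
  have nP: "norm (P y s) = indicat_real A y *\<^sub>R (norm (g y) * exp (- Re (T y) * b) *
      (indicat_real {0<..} s *\<^sub>R (\<sigma> * exp (- s * \<sigma>) * exp (q * Re (T y) * ln s))))" for y s
    using \<sigma> by (simp add: P norm_mult)
  have i1: "integrable lborel (\<lambda>s. P y s)" for y
  proof (cases "y \<in> A")
    case True
    then have "Re (of_real q * T y) > -1" using T by simp
    from Gamma_Laplace_integral(1)[OF this \<sigma>] show ?thesis
      unfolding P set_integrable_def by (intro integrable_scaleR_right integrable_mult_right)
  qed (simp add: P)
  have v1: "(LINT s|lborel. P y s) = indicat_real A y *\<^sub>R (g y * Gamma (1 + of_real q * T y) * exp (- T y * of_real (b + q * ln \<sigma>)))" for y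
  proof (cases "y \<in> A")
    case True
    then have "Re (of_real q * T y) > -1" using T by simp
    note G = Gamma_Laplace_integral(2)[OF this \<sigma>]
    have "(LINT s|lborel. P y s) = g y * exp (- T y * of_real b) * (Gamma (1 + of_real q * T y) * exp (- (of_real q * T y) * of_real (ln \<sigma>)))"
      unfolding P G[symmetric] set_lebesgue_integral_def using True
      by (simp only: indicator_simps scaleR_one integral_mult_right_zero)
    also have "\<dots> = g y * Gamma (1 + of_real q * T y) * (exp (- T y * of_real b) * exp (- (of_real q * T y) * of_real (ln \<sigma>)))"
      by simp
    also have "exp (- T y * of_real b) * exp (- (of_real q * T y) * of_real (ln \<sigma>)) = exp (- T y * of_real (b + q * ln \<sigma>))"
      by (simp add: algebra_simps flip: exp_add)
    finally show ?thesis using True by simp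
  qed (simp add: P)
  have vn: "(LINT s|lborel. norm (P y s)) =
      norm (indicat_real A y *\<^sub>R (of_real (Gamma (1 + q * Re (T y))) * g y * exp (- T y * of_real (b + q * ln \<sigma>))))" for y
  proof (cases "y \<in> A")
    case True
    then have a: "q * Re (T y) > -1" using T by simp
    then have G: "Gamma (1 + q * Re (T y)) > 0" by (intro Gamma_real_pos) auto
    have "(LINT s|lborel. norm (P y s)) = norm (g y) * exp (- Re (T y) * b) * (Gamma (1 + q * Re (T y)) * exp (- (q * Re (T y)) * ln \<sigma>))"
      unfolding nP Gamma_Laplace_integral_real(2)[OF a \<sigma>, symmetric] set_lebesgue_integral_def using True by simp
    also have "\<dots> = Gamma (1 + q * Re (T y)) * norm (g y) * (exp (- Re (T y) * b) * exp (- (q * Re (T y)) * ln \<sigma>))"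
      by simp
    also have "exp (- Re (T y) * b) * exp (- (q * Re (T y)) * ln \<sigma>) = exp (- Re (T y) * (b + q * ln \<sigma>))"
      by (simp add: algebra_simps flip: exp_add)
    finally show ?thesis using True G by (simp add: norm_mult)
  qed (simp add: P)
  have int2: "integrable (lborel \<Otimes>\<^sub>M lborel) (\<lambda>(y, s). P y s)"
  proof (rule lborel_pair.Fubini_integrable)
    show "integrable lborel (\<lambda>y. LINT s|lborel. norm (case (y, s) of (y, s) \<Rightarrow> P y s))"
      using int unfolding prod.case vn set_integrable_def by (rule integrable_norm)
  qed (auto simp: i1)
  have F: "(LINT y|lborel. P y s) = indicat_real {0<..} s *\<^sub>R (of_real (\<sigma> * exp (- s * \<sigma>)) * F s)" for s
  proof -
    have "(LINT y|lborel. P y s) = (LINT y|lborel. (of_real (indicat_real {0<..} s) * of_real (\<sigma> * exp (- s * \<sigma>))) *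
        (indicat_real A y *\<^sub>R (g y * exp (- T y * of_real (b - q * ln s)))))"
      unfolding P_def by (intro Bochner_Integration.integral_cong) (auto simp: scaleR_conv_of_real mult_ac)
    then show ?thesis unfolding integral_mult_right_zero F_def set_lebesgue_integral_def
      by (simp add: scaleR_conv_of_real mult_ac)
  qed
  show "set_integrable lborel {0<..} (\<lambda>s. of_real (\<sigma> * exp (- s * \<sigma>)) * F s)"
    using lborel_pair.integrable_snd[OF int2] unfolding set_integrable_def F .
  show "(LINT s:{0<..}|lborel. of_real (\<sigma> * exp (- s * \<sigma>)) * F s) =
      (LINT y:A|lborel. g y * Gamma (1 + of_real q * T y) * exp (- T y * of_real (b + q * ln \<sigma>)))"
    using lborel_pair.Fubini_integral[OF int2] unfolding set_lebesgue_integral_def F v1 .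
qed

lemma capacity_integrand_times_Gamma:
  assumes "q * Re t > -1"
  shows "mellin_log t * rGamma (1 + of_real q * t) * Gamma (1 + of_real q * t) * exp (- t * of_real (ln x)) =
    capacity_integrand 0 x t"
proof -
  have "1 + of_real q * t \<notin> \<int>\<^sub>\<le>\<^sub>0"
  proof
    assume "1 + of_real q * t \<in> \<int>\<^sub>\<le>\<^sub>0"
    then obtain n where "1 + of_real q * t = - of_nat n" by (auto elim: nonpos_Ints_cases')
    then have "Re (1 + of_real q * t) = Re (- of_nat n)" by (rule arg_cong)
    with assms show False by simp
  qed
  then have "rGamma (1 + of_real q * t) * Gamma (1 + of_real q * t) = 1"
    by (simp add: rGamma_inverse_Gamma Gamma_eq_zero_iff)
  then have "mellin_log t * (rGamma (1 + of_real q * t) * Gamma (1 + of_real q * t)) * exp (- t * of_real (ln x)) = capacity_integrand 0 x t"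
    by (simp add: capacity_integrand_def)
  then show ?thesis by (simp only: mult.assoc)
qed

lemma Laplace_transform_capacity_integrand:
  fixes T :: "real \<Rightarrow> complex" and q \<sigma> z :: real
  assumes [measurable]: "T \<in> borel_measurable borel" "A \<in> sets borel"
    and \<sigma>: "\<sigma> > 0" and z: "z > 0" and T: "\<And>y. y \<in> A \<Longrightarrow> q * Re (T y) > -1"
    and int: "set_integrable lborel A (\<lambda>y. of_real (Gamma (1 + q * Re (T y))) * capacity_integrand q (z * \<sigma> powr q) (T y))"
  defines "F \<equiv> \<lambda>s. LINT y:A|lborel. capacity_integrand q (z * s powr (- q)) (T y)"
  shows "set_integrable lborel {0<..} (\<lambda>s. of_real (\<sigma> * exp (- s * \<sigma>)) * F s)"
    and "(LINT s:{0<..}|lborel. of_real (\<sigma> * exp (- s * \<sigma>)) * F s) =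
      (LINT y:A|lborel. capacity_integrand 0 (z * \<sigma> powr q) (T y))"
proof -
  define g where "g = (\<lambda>y. mellin_log (T y) * rGamma (1 + of_real q * T y))"
  have [measurable]: "g \<in> borel_measurable borel" unfolding g_def mellin_log_def by measurable
  have l: "ln (z * \<sigma> powr q) = ln z + q * ln \<sigma>" using z \<sigma> by (simp add: ln_mult ln_powr)
  have F: "F s = (LINT y:A|lborel. g y * exp (- T y * of_real (ln z - q * ln s)))" if "s > 0" for s
  proof -
    have "ln (z * s powr (- q)) = ln z - q * ln s" using z that by (simp add: ln_mult ln_powr)
    then show ?thesis unfolding F_def capacity_integrand_def g_def by (simp only:)
  qed
  have int': "set_integrable lborel A (\<lambda>y. of_real (Gamma (1 + q * Re (T y))) * g y * exp (- T y * of_real (ln z + q * ln \<sigma>)))"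
    using int unfolding capacity_integrand_def l g_def by (simp only: mult.assoc)
  note L = Laplace_transform_Mellin_integral[OF _ _ _ \<sigma> T int']
  have cong: "indicat_real {0<..} s *\<^sub>R (of_real (\<sigma> * exp (- s * \<sigma>)) * F s) =
    indicat_real {0<..} s *\<^sub>R (of_real (\<sigma> * exp (- s * \<sigma>)) * (LINT y:A|lborel. g y * exp (- T y * of_real (ln z - q * ln s))))" for s
    using F[of s] by (cases "s > 0") auto
  show "set_integrable lborel {0<..} (\<lambda>s. of_real (\<sigma> * exp (- s * \<sigma>)) * F s)"
    unfolding set_integrable_def cong using L(2) by (simp add: set_integrable_def)
  have "(LINT s:{0<..}|lborel. of_real (\<sigma> * exp (- s * \<sigma>)) * F s) =
    (LINT y:A|lborel. g y * Gamma (1 + of_real q * T y) * exp (- T y * of_real (ln z + q * ln \<sigma>)))"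
    using L(3) unfolding set_lebesgue_integral_def cong by simp
  also have "\<dots> = (LINT y:A|lborel. capacity_integrand 0 (z * \<sigma> powr q) (T y))"
    unfolding l[symmetric] g_def using T
    by (intro set_lebesgue_integral_cong allI impI capacity_integrand_times_Gamma) auto
  finally show "(LINT s:{0<..}|lborel. of_real (\<sigma> * exp (- s * \<sigma>)) * F s) =
      (LINT y:A|lborel. capacity_integrand 0 (z * \<sigma> powr q) (T y))" .
qed

lemma Laplace_transform_measurable:
  fixes T :: "real \<Rightarrow> complex"
  assumes [measurable]: "T \<in> borel_measurable borel" "A \<in> sets borel"
  shows "(\<lambda>s. LINT y:A|lborel. capacity_integrand q (z * s powr (- q)) (T y)) \<in> borel_measurable borel"
  unfolding set_lebesgue_integral_def by measurable

lemma norm_Gamma_capacity_integrand: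
  assumes "q * a > -1"
  shows "norm (of_real (Gamma (1 + q * a)) * capacity_integrand q x (Complex a y)) =
    norm (mellin_log (Complex a y)) * rGamma_ratio (1 + q * a) (q * y) * exp (- a * ln x)"
proof -
  have G: "Gamma (1 + q * a) > 0" using assms by (intro Gamma_real_pos) auto
  have "norm (of_real (Gamma (1 + q * a)) * capacity_integrand q x (Complex a y)) =
    Gamma (1 + q * a) * (norm (mellin_log (Complex a y)) * (rGamma_ratio (1 + q * a) (q * y) / Gamma (1 + q * a)) * exp (- a * ln x))"
    unfolding norm_mult norm_capacity_integrand norm_of_real abs_of_pos[OF G]
    using assms by (subst norm_rGamma_eq) auto
  also have "\<dots> = norm (mellin_log (Complex a y)) * rGamma_ratio (1 + q * a) (q * y) * exp (- a * ln x)"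
    using G by (simp add: field_simps)
  finally show ?thesis .
qed

lemma Laplace_transform_left_loop:
  assumes q: "q < 0" and c: "c \<notin> \<int>" "1 + q * c > 0" and \<sigma>: "\<sigma> > 0" and z: "z > 0"
    and x: "z * \<sigma> powr q < 1"
  defines "F \<equiv> \<lambda>s. left_loop_value (capacity_integrand q (z * s powr (- q))) (c, -1, 1)"
  shows "set_integrable lborel {0<..} (\<lambda>s. of_real (\<sigma> * exp (- s * \<sigma>)) * F s)"
    and "(LINT s:{0<..}|lborel. of_real (\<sigma> * exp (- s * \<sigma>)) * F s) = line_value (capacity_integrand 0 (z * \<sigma> powr q)) c"
proof -
  let ?x = "z * \<sigma> powr q"
  have x0: "0 < ?x" using z \<sigma> by simp
  have pos: "q * a > -1" if "a \<le> c" for a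
  proof -
    have "q * c \<le> q * a" using that q by (intro mult_left_mono_neg) auto
    with c(2) show ?thesis by linarith
  qed
  have ray: "set_integrable lborel {..c} (\<lambda>a. of_real (Gamma (1 + q * Re (Complex a y))) * capacity_integrand q ?x (Complex a y))"
    if y: "y \<noteq> 0" for y
  proof (rule set_integrable_bound)
    define K where "K = pi / (\<bar>y\<bar> * sinh (pi * \<bar>y\<bar>)) * rGamma_ratio (1 + q * c) (q * y)"
    show "set_integrable lborel {..c} (\<lambda>a. K * exp (\<bar>ln ?x\<bar> * a))"
      using x x0 by (intro set_integrable_mult_right set_integrable_exp_atMost) auto
    have "norm (of_real (Gamma (1 + q * a)) * capacity_integrand q ?x (Complex a y)) \<le> K * exp (\<bar>ln ?x\<bar> * a)" if "a \<le> c" for a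
    proof -
      have "norm (mellin_log (Complex a y)) * rGamma_ratio (1 + q * a) (q * y) \<le> K"
        unfolding K_def using y q c pos[OF that] that
        by (intro mult_mono norm_mellin_log_le_sinh rGamma_ratio_mono rGamma_ratio_nonneg) (auto simp: mult_left_mono_neg)
      moreover have "exp (- a * ln ?x) = exp (\<bar>ln ?x\<bar> * a)" using x x0 by simp
      ultimately show ?thesis unfolding norm_Gamma_capacity_integrand[OF pos[OF that]] by (simp add: mult_right_mono)
    qed
    then show "AE a in lborel. a \<in> {..c} \<longrightarrow> norm (of_real (Gamma (1 + q * Re (Complex a y))) * capacity_integrand q ?x (Complex a y)) \<le> norm (K * exp (\<bar>ln ?x\<bar> * a))"
      by (intro AE_I2) (auto intro: order_trans[OF _ abs_ge_self])
  qed (simp add: set_borel_measurable_def)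
  have seg: "set_integrable lborel {-1..1} (\<lambda>y. of_real (Gamma (1 + q * Re (Complex c y))) * capacity_integrand q ?x (Complex c y))"
    by (simp only: complex.sel) (intro set_integrable_mult_right set_integrable_continuous_segment continuous_on_capacity_integrand_vertical c)
  note R = Laplace_transform_capacity_integrand[where q = q and z = z, OF _ _ \<sigma> z]
  have 1: "set_integrable lborel {0<..} (\<lambda>s. of_real (\<sigma> * exp (- s * \<sigma>)) * (LINT a:{..c}|lborel. capacity_integrand q (z * s powr (- q)) (Complex a (-1))))"
    "(LINT s:{0<..}|lborel. of_real (\<sigma> * exp (- s * \<sigma>)) * (LINT a:{..c}|lborel. capacity_integrand q (z * s powr (- q)) (Complex a (-1)))) =
      (LINT a:{..c}|lborel. capacity_integrand 0 ?x (Complex a (-1)))"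
    by (rule R; use ray[of "-1"] pos in simp)+
  have 2: "set_integrable lborel {0<..} (\<lambda>s. of_real (\<sigma> * exp (- s * \<sigma>)) * (LINT a:{..c}|lborel. capacity_integrand q (z * s powr (- q)) (Complex a 1)))"
    "(LINT s:{0<..}|lborel. of_real (\<sigma> * exp (- s * \<sigma>)) * (LINT a:{..c}|lborel. capacity_integrand q (z * s powr (- q)) (Complex a 1))) =
      (LINT a:{..c}|lborel. capacity_integrand 0 ?x (Complex a 1))"
    by (rule R; use ray[of 1] pos in simp)+
  have 3: "set_integrable lborel {0<..} (\<lambda>s. of_real (\<sigma> * exp (- s * \<sigma>)) * (LINT y:{-1..1}|lborel. capacity_integrand q (z * s powr (- q)) (Complex c y)))"
    "(LINT s:{0<..}|lborel. of_real (\<sigma> * exp (- s * \<sigma>)) * (LINT y:{-1..1}|lborel. capacity_integrand q (z * s powr (- q)) (Complex c y))) =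
      (LINT y:{-1..1}|lborel. capacity_integrand 0 ?x (Complex c y))"
    by (rule R; use seg pos[of c] in simp)+
  have F: "of_real (\<sigma> * exp (- s * \<sigma>)) * F s = 1 / (2 * of_real pi * \<i>) *
      (of_real (\<sigma> * exp (- s * \<sigma>)) * (LINT a:{..c}|lborel. capacity_integrand q (z * s powr (- q)) (Complex a (-1))) +
       \<i> * (of_real (\<sigma> * exp (- s * \<sigma>)) * (LINT y:{-1..1}|lborel. capacity_integrand q (z * s powr (- q)) (Complex c y))) -
       of_real (\<sigma> * exp (- s * \<sigma>)) * (LINT a:{..c}|lborel. capacity_integrand q (z * s powr (- q)) (Complex a 1)))" for s
    unfolding F_def left_loop_value_def prod.case by (simp only: distrib_left right_diff_distrib mult_ac)
  have lin: "set_integrable lborel {0<..} (\<lambda>s. k * (f s + \<i> * g s - h s))"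
    "(LINT s:{0<..}|lborel. k * (f s + \<i> * g s - h s)) =
      k * ((LINT s:{0<..}|lborel. f s) + \<i> * (LINT s:{0<..}|lborel. g s) - (LINT s:{0<..}|lborel. h s))"
    if "set_integrable lborel {0<..} f" "set_integrable lborel {0<..} g" "set_integrable lborel {0<..} h"
    for f g h :: "real \<Rightarrow> complex" and k
  proof -
    have g: "set_integrable lborel {0<..} (\<lambda>s. \<i> * g s)" using that by (intro set_integrable_mult_right)
    have fg: "set_integrable lborel {0<..} (\<lambda>s. f s + \<i> * g s)" using that g by (intro set_integral_add)
    show "set_integrable lborel {0<..} (\<lambda>s. k * (f s + \<i> * g s - h s))"
      using that fg by (intro set_integrable_mult_right set_integral_diff)
    show "(LINT s:{0<..}|lborel. k * (f s + \<i> * g s - h s)) =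
      k * ((LINT s:{0<..}|lborel. f s) + \<i> * (LINT s:{0<..}|lborel. g s) - (LINT s:{0<..}|lborel. h s))"
      unfolding set_integral_mult_right set_integral_diff(2)[OF fg that(3)] set_integral_add(2)[OF that(1) g] ..
  qed
  show "set_integrable lborel {0<..} (\<lambda>s. of_real (\<sigma> * exp (- s * \<sigma>)) * F s)"
    unfolding F by (rule lin(1)[OF 1(1) 3(1) 2(1)])
  have "(LINT s:{0<..}|lborel. of_real (\<sigma> * exp (- s * \<sigma>)) * F s) = left_loop_value (capacity_integrand 0 ?x) (c, -1, 1)"
    unfolding F lin(2)[OF 1(1) 3(1) 2(1)] left_loop_value_def prod.case 1(2) 2(2) 3(2) ..
  also have "\<dots> = line_value (capacity_integrand 0 ?x) c"
    using x x0 c by (intro left_loop_value_log) auto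
  finally show "(LINT s:{0<..}|lborel. of_real (\<sigma> * exp (- s * \<sigma>)) * F s) = line_value (capacity_integrand 0 ?x) c" .
qed

lemma measurable_left_loop:
  "(\<lambda>s. left_loop_value (capacity_integrand q (z * s powr (- q))) (c, u, v)) \<in> borel_measurable borel"
  unfolding left_loop_value_def prod.case
  by (intro borel_measurable_times borel_measurable_diff borel_measurable_add borel_measurable_const Laplace_transform_measurable) auto

lemma norm_mellin_log_le_exp_far:
  assumes "\<bar>y\<bar> \<ge> 1"
  shows "norm (mellin_log (Complex c y)) \<le> 4 * pi / \<bar>y\<bar> * exp (- (pi * \<bar>y\<bar>))"
proof -
  have "norm (mellin_log (Complex c y)) \<le> pi / (\<bar>y\<bar> * sinh (pi * \<bar>y\<bar>))"
    using assms by (intro norm_mellin_log_le_sinh) auto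
  also have "\<dots> \<le> pi / (\<bar>y\<bar> * (exp (pi * \<bar>y\<bar>) / 4))"
    using assms by (intro frac_le mult_left_mono sinh_ge_exp pi_abs_ge_1 mult_pos_pos) auto
  also have "\<dots> = 4 * pi / \<bar>y\<bar> * exp (- (pi * \<bar>y\<bar>))" by (simp add: exp_minus field_simps)
  finally show ?thesis .
qed

lemma norm_mellin_log_le_square:
  assumes "\<bar>c\<bar> \<le> 1 / 2" "c \<noteq> 0"
  shows "norm (mellin_log (Complex c y)) \<le> pi * inverse (c\<^sup>2 + y\<^sup>2)"
proof -
  have n0: "norm (Complex c y) > 0" using assms by (auto simp: complex_eq_iff)
  have "norm (Complex c y) * norm (Complex c y) \<le> norm (Complex c y) * norm (sin (of_real pi * Complex c y))"
    by (intro mult_left_mono norm_sin_pi_ge_linear assms) auto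
  then have "pi / (norm (Complex c y) * norm (sin (of_real pi * Complex c y))) \<le> pi / (norm (Complex c y) * norm (Complex c y))"
    using n0 by (intro frac_le) auto
  also have "norm (Complex c y) * norm (Complex c y) = c\<^sup>2 + y\<^sup>2"
    by (simp add: cmod_def flip: power2_eq_square)
  finally show ?thesis by (simp add: mellin_log_def norm_divide norm_mult norm_inverse divide_inverse)
qed

text \<open>
  On a line near the imaginary axis \<open>mellin_log\<close> contributes \<open>\<bar>y\<bar>\<^bsup>-1\<^esup> e\<^bsup>-\<pi>\<bar>y\<bar>\<^esup>\<close> and, for
  \<open>\<bar>q\<bar> \<le> 2\<close>, the reciprocal Gamma function at most \<open>\<bar>y\<bar>\<^bsup>-1/4\<^esup> e\<^bsup>\<pi>\<bar>y\<bar>\<^esup>\<close>.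
\<close>
definition tail_weight :: "real \<Rightarrow> real" where
  "tail_weight y = (if \<bar>y\<bar> \<ge> 1 then \<bar>y\<bar> powr (- 5 / 4) else 0)"

lemma tail_weight_nonneg: "0 \<le> tail_weight y"
  by (simp add: tail_weight_def)

lemma integrable_tail_weight: "integrable lborel tail_weight"
proof -
  have hi: "((\<lambda>y::real. y powr (- 5 / 4)) has_integral - (1 powr (- 5 / 4 + 1)) / (- 5 / 4 + 1)) {1..}"
    by (rule has_integral_powr_to_inf) auto
  then have "(\<lambda>y::real. y powr (- 5 / 4)) absolutely_integrable_on {1..}"
    by (intro nonnegative_absolutely_integrable_1) (auto simp: has_integral_integrable)
  then have "integrable lebesgue (\<lambda>y::real. indicat_real {1..} y *\<^sub>R y powr (- 5 / 4))"
    by (simp add: set_integrable_def)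
  then have i: "integrable lborel (\<lambda>y::real. indicat_real {1..} y *\<^sub>R y powr (- 5 / 4))"
    by (subst (asm) integrable_completion) auto
  have j: "integrable lborel (\<lambda>y::real. indicat_real {1..} (0 + (-1) * y) *\<^sub>R (0 + (-1) * y) powr (- 5 / 4))"
    using lborel_integrable_real_affine[OF i, of "-1" 0] by simp
  have "tail_weight = (\<lambda>y::real. indicat_real {1..} y *\<^sub>R y powr (- 5 / 4) +
      indicat_real {1..} (0 + (-1) * y) *\<^sub>R (0 + (-1) * y) powr (- 5 / 4))"
    by (auto simp: tail_weight_def fun_eq_iff indicator_def abs_if)
  then show ?thesis using Bochner_Integration.integrable_add[OF i j] by simp
qed

lemma capacity_integrand_weight_bound:
  assumes q: "\<bar>q\<bar> \<le> 2"
  shows "\<exists>K>0. \<forall>c y. -1/8 \<le> c \<longrightarrow> c < 0 \<longrightarrow>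
    norm (mellin_log (Complex c y)) * norm (rGamma (Complex (1 + q * c) (q * y))) \<le>
      K * (inverse (c\<^sup>2 + y\<^sup>2) + tail_weight y)"
proof -
  obtain K1 where K1: "K1 > 0" "\<And>a::real. 3/4 \<le> a \<Longrightarrow> a \<le> 5/4 \<Longrightarrow> 1 / Gamma a \<le> K1"
    using inverse_Gamma_bounded[of "3/4" "5/4"] by auto
  define K2 where "K2 = rGamma_ratio (3/4) 2"
  have K2: "K2 > 0" using rGamma_ratio_ge_1[of "3/4" 2] by (simp add: K2_def)
  define K where "K = K1 * (pi * K2 + 4 * pi)"
  show ?thesis
  proof (rule exI[of _ K], intro conjI allI impI)
    show "K > 0" using K1 K2 by (simp add: K_def add_pos_pos)
    fix c y :: real assume c: "-1/8 \<le> c" "c < 0"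
    have "\<bar>q * c\<bar> \<le> 2 * (1/8)" unfolding abs_mult using q c by (intro mult_mono) auto
    then have a: "3/4 \<le> 1 + q * c" "1 + q * c \<le> 5/4" by (auto simp: abs_le_iff)
    have "\<bar>q * y\<bar> \<le> \<bar>2 * y\<bar>" unfolding abs_mult using q by (intro mult_right_mono) auto
    then have r: "rGamma_ratio (1 + q * c) (q * y) \<le> rGamma_ratio (3/4) (2 * y)"
      using a by (intro rGamma_ratio_mono) auto
    have G: "Gamma (1 + q * c) > 0" using a by (intro Gamma_real_pos) auto
    have "norm (rGamma (Complex (1 + q * c) (q * y))) = rGamma_ratio (1 + q * c) (q * y) * (1 / Gamma (1 + q * c))"
      using a by (subst norm_rGamma_eq) auto
    also have "\<dots> \<le> rGamma_ratio (3/4) (2 * y) * K1"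
      using r K1(2)[OF a] G by (intro mult_mono rGamma_ratio_nonneg) auto
    finally have 1: "norm (rGamma (Complex (1 + q * c) (q * y))) \<le> rGamma_ratio (3/4) (2 * y) * K1" .
    show "norm (mellin_log (Complex c y)) * norm (rGamma (Complex (1 + q * c) (q * y))) \<le>
      K * (inverse (c\<^sup>2 + y\<^sup>2) + tail_weight y)"
    proof (cases "\<bar>y\<bar> \<ge> 1")
      case True
      have "rGamma_ratio (3/4) (2 * y) \<le> exp (pi * \<bar>2 * y\<bar> / 2) * \<bar>2 * y\<bar> powr (- 1/4)"
        using True by (intro rGamma_ratio_three_quarters_le) auto
      also have "\<bar>2 * y\<bar> powr (- 1/4) \<le> \<bar>y\<bar> powr (- 1/4)"
        using True by (intro powr_mono2') auto
      finally have "rGamma_ratio (3/4) (2 * y) \<le> exp (pi * \<bar>y\<bar>) * \<bar>y\<bar> powr (- 1/4)"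
        by (simp add: abs_mult mult_left_mono)
      then have 2: "rGamma_ratio (3/4) (2 * y) * K1 \<le> exp (pi * \<bar>y\<bar>) * \<bar>y\<bar> powr (- 1/4) * K1"
        using K1 by (intro mult_right_mono) auto
      have "norm (mellin_log (Complex c y)) * norm (rGamma (Complex (1 + q * c) (q * y))) \<le>
          (4 * pi / \<bar>y\<bar> * exp (- (pi * \<bar>y\<bar>))) * (exp (pi * \<bar>y\<bar>) * \<bar>y\<bar> powr (- 1/4) * K1)"
        using True 1 2 by (intro mult_mono norm_mellin_log_le_exp_far) auto
      also have "\<dots> = 4 * pi * K1 * (\<bar>y\<bar> powr (- 1/4) / \<bar>y\<bar>)" by (simp add: exp_minus)
      also have "\<bar>y\<bar> powr (- 1/4) / \<bar>y\<bar> = tail_weight y"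
        using True powr_diff[of "\<bar>y\<bar>" "-1/4" 1] by (simp add: tail_weight_def)
      also have "4 * pi * K1 * tail_weight y \<le> K * (inverse (c\<^sup>2 + y\<^sup>2) + tail_weight y)"
        using K1 K2 by (intro mult_mono) (auto simp: K_def distrib_left tail_weight_nonneg)
      finally show ?thesis .
    next
      case False
      have "rGamma_ratio (3/4) (2 * y) \<le> K2"
        unfolding K2_def using False by (intro rGamma_ratio_mono) auto
      then have 2: "rGamma_ratio (3/4) (2 * y) * K1 \<le> K2 * K1" using K1 by (intro mult_right_mono) auto
      have "norm (mellin_log (Complex c y)) * norm (rGamma (Complex (1 + q * c) (q * y))) \<le>
          (pi * inverse (c\<^sup>2 + y\<^sup>2)) * (K2 * K1)"
        using c 1 2 by (intro mult_mono norm_mellin_log_le_square) auto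
      also have "\<dots> = (pi * K2 * K1) * inverse (c\<^sup>2 + y\<^sup>2)" by simp
      also have "\<dots> \<le> K * (inverse (c\<^sup>2 + y\<^sup>2) + tail_weight y)"
        using K1 K2 by (intro mult_mono) (auto simp: K_def distrib_left tail_weight_nonneg)
      finally show ?thesis .
    qed
  qed
qed

lemma capacity_integrand_line_bound:
  assumes q: "\<bar>q\<bar> \<le> 2"
  obtains K where "K > 0"
    "\<And>c z. -1/8 \<le> c \<Longrightarrow> c < 0 \<Longrightarrow> integrable lborel (\<lambda>y. capacity_integrand q z (Complex c y))"
    "\<And>c z. -1/8 \<le> c \<Longrightarrow> c < 0 \<Longrightarrow> norm (LINT y|lborel. capacity_integrand q z (Complex c y)) \<le> K / \<bar>c\<bar> * exp (- c * ln z)"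
proof -
  obtain K where K: "K > 0" and le: "\<And>c y. -1/8 \<le> c \<Longrightarrow> c < 0 \<Longrightarrow>
    norm (mellin_log (Complex c y)) * norm (rGamma (Complex (1 + q * c) (q * y))) \<le>
      K * (inverse (c\<^sup>2 + y\<^sup>2) + tail_weight y)"
    using capacity_integrand_weight_bound[OF q] by blast
  define W where "W = (LINT y|lborel. tail_weight y)"
  have W: "W \<ge> 0" unfolding W_def by (rule Bochner_Integration.integral_nonneg) (rule tail_weight_nonneg)
  define b where "b = (\<lambda>c z y. K * exp (- c * ln z) * (inverse (c\<^sup>2 + y\<^sup>2) + tail_weight y))"
  have ib: "integrable lborel (b c z)" if "c < 0" for c z
    using that integrable_inverse_square_plus_square(1)[of "-c"] unfolding b_def
    by (intro integrable_mult_right Bochner_Integration.integrable_add integrable_tail_weight) auto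
  have fb: "norm (capacity_integrand q z (Complex c y)) \<le> b c z y" if c: "-1/8 \<le> c" "c < 0" for c z y
  proof -
    have "norm (capacity_integrand q z (Complex c y)) \<le> K * (inverse (c\<^sup>2 + y\<^sup>2) + tail_weight y) * exp (- c * ln z)"
      unfolding norm_capacity_integrand by (intro mult_right_mono le c) auto
    then show ?thesis by (simp add: b_def mult_ac)
  qed
  have int: "integrable lborel (\<lambda>y. capacity_integrand q z (Complex c y))" if c: "-1/8 \<le> c" "c < 0" for c z
    by (rule Bochner_Integration.integrable_bound[OF ib[OF c(2), of z]])
      (auto intro!: AE_I2 order_trans[OF fb[OF c]])
  show ?thesis
  proof (rule that[of "K * (pi + W)"])
    show "K * (pi + W) > 0" using K W by (simp add: add_pos_nonneg)
    fix c z :: real assume c: "-1/8 \<le> c" "c < 0"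
    show "integrable lborel (\<lambda>y. capacity_integrand q z (Complex c y))" by (rule int[OF c])
    have "norm (LINT y|lborel. capacity_integrand q z (Complex c y)) \<le> (LINT y|lborel. b c z y)"
      using int[OF c, of z] ib[OF c(2), of z] by (rule Bochner_Integration.integral_norm_bound_integral) (rule fb[OF c])
    also have "\<dots> = K * exp (- c * ln z) * (pi / \<bar>c\<bar> + W)"
      using c integrable_inverse_square_plus_square[of "-c"] integrable_tail_weight
      by (simp add: b_def W_def Bochner_Integration.integral_add)
    also have "\<dots> \<le> K * exp (- c * ln z) * (pi / \<bar>c\<bar> + W / \<bar>c\<bar>)"
    proof -
      have "0 < \<bar>c\<bar>" "\<bar>c\<bar> \<le> 1" using c by auto
      then have "W * 1 \<le> W * (1 / \<bar>c\<bar>)" using W by (intro mult_left_mono) (auto simp: pos_le_divide_eq)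
      then show ?thesis using K by (intro mult_left_mono add_left_mono) auto
    qed
    also have "\<dots> = K * (pi + W) / \<bar>c\<bar> * exp (- c * ln z)" by (simp add: add_divide_distrib algebra_simps)
    finally show "norm (LINT y|lborel. capacity_integrand q z (Complex c y)) \<le> K * (pi + W) / \<bar>c\<bar> * exp (- c * ln z)" .
  qed
qed

lemma norm_rGamma_le_all:
  fixes A :: real
  obtains K where "K > 0"
    "\<And>a y. -1 \<le> a \<Longrightarrow> a \<le> A \<Longrightarrow> norm (rGamma (Complex a y)) \<le> K * ((1 + \<bar>y\<bar>\<^sup>2) * exp (pi * \<bar>y\<bar> / 2))"
proof -
  obtain K1 where K1: "K1 > 0" "\<And>a y. -1 \<le> a \<Longrightarrow> a \<le> A \<Longrightarrow> \<bar>y\<bar> \<ge> 1 \<Longrightarrow>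
      norm (rGamma (Complex a y)) \<le> K1 * (\<bar>y\<bar>\<^sup>2 * exp (pi * \<bar>y\<bar> / 2))"
    using norm_rGamma_le_ge_minus_one[of A] by auto
  have "compact (rGamma ` cball (0::complex) (\<bar>A\<bar> + 2))"
    by (intro compact_continuous_image holomorphic_on_imp_continuous_on holomorphic_rGamma) auto
  then have "bounded (rGamma ` cball (0::complex) (\<bar>A\<bar> + 2))" by (rule compact_imp_bounded)
  then obtain K2 where "K2 > 0" "\<forall>w\<in>rGamma ` cball (0::complex) (\<bar>A\<bar> + 2). norm w \<le> K2"
    unfolding bounded_pos by blast
  then have K2: "K2 > 0" "\<And>t::complex. norm t \<le> \<bar>A\<bar> + 2 \<Longrightarrow> norm (rGamma t) \<le> K2"
    by auto
  show ?thesis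
  proof (rule that[of "K1 + K2"])
    fix a y :: real assume a: "-1 \<le> a" "a \<le> A"
    show "norm (rGamma (Complex a y)) \<le> (K1 + K2) * ((1 + \<bar>y\<bar>\<^sup>2) * exp (pi * \<bar>y\<bar> / 2))"
    proof (cases "\<bar>y\<bar> \<ge> 1")
      case True
      then have "norm (rGamma (Complex a y)) \<le> K1 * (\<bar>y\<bar>\<^sup>2 * exp (pi * \<bar>y\<bar> / 2))" by (intro K1 a)
      also have "\<dots> \<le> (K1 + K2) * ((1 + \<bar>y\<bar>\<^sup>2) * exp (pi * \<bar>y\<bar> / 2))"
        using K1 K2 by (intro mult_mono) auto
      finally show ?thesis .
    next
      case False
      have "norm (Complex a y) \<le> \<bar>a\<bar> + \<bar>y\<bar>" using cmod_le[of "Complex a y"] by simp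
      also have "\<dots> \<le> \<bar>A\<bar> + 2" using a False by linarith
      finally have "norm (rGamma (Complex a y)) \<le> K2 * 1" using K2 by simp
      also have "\<dots> \<le> (K1 + K2) * ((1 + \<bar>y\<bar>\<^sup>2) * exp (pi * \<bar>y\<bar> / 2))"
      proof (intro mult_mono)
        have "1 * 1 \<le> (1 + \<bar>y\<bar>\<^sup>2) * exp (pi * \<bar>y\<bar> / 2)" by (intro mult_mono) auto
        then show "1 \<le> (1 + \<bar>y\<bar>\<^sup>2) * exp (pi * \<bar>y\<bar> / 2)" by simp
      qed (use K1 K2 in auto)
      finally show ?thesis .
    qed
  qed (use K1 K2 in auto)
qed

lemma capacity_integrand_far_bound:
  assumes q: "\<bar>q\<bar> < 2 \<or> \<bar>q\<bar> = 2 \<and> 1 + q * c \<ge> 0 \<and> 1 + q * c' \<ge> 0" and c: "-1 < c" "c' < 0"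
  obtains b where "(b \<longlongrightarrow> 0) at_top"
    "\<And>a y. c \<le> a \<Longrightarrow> a \<le> c' \<Longrightarrow> \<bar>y\<bar> \<ge> 1 \<Longrightarrow> norm (capacity_integrand q z (Complex a y)) \<le> b \<bar>y\<bar>"
proof -
  define E where "E = exp \<bar>ln z\<bar>"
  have e: "exp (- a * ln z) \<le> E" if "c \<le> a" "a \<le> c'" for a
  proof -
    have "- a * ln z \<le> \<bar>a\<bar> * \<bar>ln z\<bar>" by (metis abs_ge_self abs_minus abs_mult)
    also have "\<dots> \<le> 1 * \<bar>ln z\<bar>" using that c by (intro mult_right_mono) auto
    finally show ?thesis by (simp add: E_def)
  qed
  have f: "norm (capacity_integrand q z (Complex a y)) \<le> (4 * pi / \<bar>y\<bar> * exp (- (pi * \<bar>y\<bar>))) * R * E"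
    if "norm (rGamma (Complex (1 + q * a) (q * y))) \<le> R" "c \<le> a" "a \<le> c'" "\<bar>y\<bar> \<ge> 1" for a y R
  proof -
    have "0 \<le> R" using that(1) norm_ge_zero order_trans by blast
    then show ?thesis
      unfolding norm_capacity_integrand using that e
      by (intro mult_mono norm_mellin_log_le_exp_far mult_nonneg_nonneg) auto
  qed
  consider "\<bar>q\<bar> < 2" | "\<bar>q\<bar> = 2" "1 + q * c \<ge> 0" "1 + q * c' \<ge> 0" using q by blast
  then show ?thesis
  proof cases
    case 1
    obtain K where K: "K > 0"
      "\<And>a y. -1 \<le> a \<Longrightarrow> a \<le> 3 \<Longrightarrow> norm (rGamma (Complex a y)) \<le> K * ((1 + \<bar>y\<bar>\<^sup>2) * exp (pi * \<bar>y\<bar> / 2))"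
      using norm_rGamma_le_all[of 3] by auto
    define d where "d = pi * (1 - \<bar>q\<bar> / 2)"
    have d: "d > 0" using 1 by (simp add: d_def)
    show ?thesis
    proof (rule that[of "\<lambda>y. 4 * pi * K * E * ((1 + q\<^sup>2 * y\<^sup>2) * exp (- (d * y)) / y)"])
      have "((\<lambda>y. C * ((1 + Q * y\<^sup>2) * exp (- (d * y)) / y)) \<longlongrightarrow> 0) at_top" for C Q :: real
        using d by real_asymp
      then show "((\<lambda>y. 4 * pi * K * E * ((1 + q\<^sup>2 * y\<^sup>2) * exp (- (d * y)) / y)) \<longlongrightarrow> 0) at_top" .
      fix a y :: real assume a: "c \<le> a" "a \<le> c'" and y: "\<bar>y\<bar> \<ge> 1"
      have "\<bar>q * a\<bar> \<le> 2 * 1" unfolding abs_mult using 1 a c by (intro mult_mono) auto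
      then have "-1 \<le> 1 + q * a" "1 + q * a \<le> 3" by (auto simp: abs_le_iff)
      from f[OF K(2)[OF this] a y]
      have "norm (capacity_integrand q z (Complex a y)) \<le> 4 * pi / \<bar>y\<bar> * exp (- (pi * \<bar>y\<bar>)) *
          (K * ((1 + \<bar>q * y\<bar>\<^sup>2) * exp (pi * \<bar>q * y\<bar> / 2))) * E" .
      also have "\<dots> = 4 * pi * K * E * ((1 + q\<^sup>2 * \<bar>y\<bar>\<^sup>2) * (exp (- (pi * \<bar>y\<bar>)) * exp (pi * \<bar>q * y\<bar> / 2)) / \<bar>y\<bar>)"
        by (simp add: power_mult_distrib)
      also have "exp (- (pi * \<bar>y\<bar>)) * exp (pi * \<bar>q * y\<bar> / 2) = exp (- (d * \<bar>y\<bar>))"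
        by (simp add: d_def abs_mult algebra_simps flip: exp_add)
      finally show "norm (capacity_integrand q z (Complex a y)) \<le> 4 * pi * K * E * ((1 + q\<^sup>2 * \<bar>y\<bar>\<^sup>2) * exp (- (d * \<bar>y\<bar>)) / \<bar>y\<bar>)" .
    qed
  next
    case 2
    obtain K where K: "K > 0"
      "\<And>a y. 0 \<le> a \<Longrightarrow> a \<le> 3 \<Longrightarrow> \<bar>y\<bar> \<ge> 1 \<Longrightarrow> norm (rGamma (Complex a y)) \<le> K * (sqrt \<bar>y\<bar> * exp (pi * \<bar>y\<bar> / 2))"
      using norm_rGamma_le_nonneg[of 3] by auto
    show ?thesis
    proof (rule that[of "\<lambda>y. 4 * pi * K * E * (sqrt (2 * y) / y)"])
      have "((\<lambda>y::real. C * (sqrt (2 * y) / y)) \<longlongrightarrow> 0) at_top" for C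
        by real_asymp
      then show "((\<lambda>y. 4 * pi * K * E * (sqrt (2 * y) / y)) \<longlongrightarrow> 0) at_top" .
      fix a y :: real assume a: "c \<le> a" "a \<le> c'" and y: "\<bar>y\<bar> \<ge> 1"
      have "\<bar>q * a\<bar> \<le> 2 * 1" unfolding abs_mult using 2 a c by (intro mult_mono) auto
      then have a3: "1 + q * a \<le> 3" by (auto simp: abs_le_iff)
      have a0: "0 \<le> 1 + q * a"
      proof (cases "q \<ge> 0")
        case True
        then have "q * c \<le> q * a" using a by (intro mult_left_mono) auto
        then show ?thesis using 2 by linarith
      next
        case False
        then have "q * c' \<le> q * a" using a by (intro mult_left_mono_neg) auto
        then show ?thesis using 2 by linarith
      qed
      have qy: "\<bar>q * y\<bar> = 2 * \<bar>y\<bar>" using 2 by (simp add: abs_mult)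
      have "\<bar>q * y\<bar> \<ge> 1" using qy y by simp
      from f[OF K(2)[OF a0 a3 this] a y]
      have "norm (capacity_integrand q z (Complex a y)) \<le> 4 * pi / \<bar>y\<bar> * exp (- (pi * \<bar>y\<bar>)) *
          (K * (sqrt (2 * \<bar>y\<bar>) * exp (pi * (2 * \<bar>y\<bar>) / 2))) * E" unfolding qy .
      also have "\<dots> = 4 * pi * K * E * (sqrt (2 * \<bar>y\<bar>) / \<bar>y\<bar>)"
        by (simp add: exp_minus)
      finally show "norm (capacity_integrand q z (Complex a y)) \<le> 4 * pi * K * E * (sqrt (2 * \<bar>y\<bar>) / \<bar>y\<bar>)" .
    qed
  qed
qed

lemma capacity_integrand_line_shift:
  assumes q: "\<bar>q\<bar> < 2 \<or> \<bar>q\<bar> = 2 \<and> 1 + q * c \<ge> 0 \<and> 1 + q * c' \<ge> 0"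
    and c: "-1 < c" "c < 0" "-1 < c'" "c' < 0"
    and i: "integrable lborel (\<lambda>y. capacity_integrand q z (Complex c y))"
      "integrable lborel (\<lambda>y. capacity_integrand q z (Complex c' y))"
  shows "(LINT y|lborel. capacity_integrand q z (Complex c' y)) = (LINT y|lborel. capacity_integrand q z (Complex c y))"
proof -
  have *: "(LINT y|lborel. capacity_integrand q z (Complex c2 y)) = (LINT y|lborel. capacity_integrand q z (Complex c1 y))"
    if q: "\<bar>q\<bar> < 2 \<or> \<bar>q\<bar> = 2 \<and> 1 + q * c1 \<ge> 0 \<and> 1 + q * c2 \<ge> 0" and c: "-1 < c1" "c2 < 0" "c1 \<le> c2"
      and i: "integrable lborel (\<lambda>y. capacity_integrand q z (Complex c1 y))"
      "integrable lborel (\<lambda>y. capacity_integrand q z (Complex c2 y))" for c1 c2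
  proof -
    obtain b where b: "(b \<longlongrightarrow> 0) at_top"
      "\<And>a y. c1 \<le> a \<Longrightarrow> a \<le> c2 \<Longrightarrow> \<bar>y\<bar> \<ge> 1 \<Longrightarrow> norm (capacity_integrand q z (Complex a y)) \<le> b \<bar>y\<bar>"
      using capacity_integrand_far_bound[OF q c(1,2)] by blast
    have S: "capacity_integrand q z holomorphic_on {t. -1 < Re t \<and> Re t < 0}"
      using Re_strip_Ints[of "-1"] by (intro holomorphic_capacity_integrand) simp
    show ?thesis
      by (rule line_integral_shift[OF S convex_Re_strip open_Re_strip c(3) _ b(2) b(1) i]) (use c in auto)
  qed
  show ?thesis using *[of c c'] *[of c' c] q c i by (cases "c \<le> c'") auto
qed

section \<open>Contours on which the integral diverges\<close>

lemma not_integrable_inverse: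
  fixes f :: "real \<Rightarrow> complex"
  assumes K: "K > 0" and ev: "eventually (\<lambda>y. K / y \<le> norm (f y)) at_top"
  shows "\<not> integrable lborel f"
proof
  assume int: "integrable lborel f"
  obtain Y0 where Y0: "\<And>y. y \<ge> Y0 \<Longrightarrow> K / y \<le> norm (f y)"
    using ev unfolding eventually_at_top_linorder by blast
  define Y where "Y = max Y0 1"
  define J where "J = (LINT y|lborel. norm (f y))"
  define T where "T = Y * exp ((J + 1) / K)"
  have J: "J \<ge> 0" unfolding J_def by (rule Bochner_Integration.integral_nonneg) simp
  have Y: "Y \<ge> 1" by (simp add: Y_def)
  have "1 \<le> exp ((J + 1) / K)" using J K by simp
  then have T: "Y \<le> T" unfolding T_def using Y by simp
  have "(LINT y|lborel. indicat_real {Y..T} y *\<^sub>R (K / y)) = K * ln T - K * ln Y"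
  proof (rule integral_FTC_atLeastAtMost[OF T])
    fix y assume "Y \<le> y" "y \<le> T"
    then show "((\<lambda>y. K * ln y) has_vector_derivative K / y) (at y within {Y..T})"
      using Y by (auto intro!: derivative_eq_intros simp: has_real_derivative_iff_has_vector_derivative[symmetric])
  qed (use Y in \<open>auto intro!: continuous_intros\<close>)
  moreover have "(LINT y|lborel. indicat_real {Y..T} y *\<^sub>R (K / y)) \<le> J"
    unfolding J_def
  proof (rule integral_mono')
    show "integrable lborel (\<lambda>y. norm (f y))" using int by (rule integrable_norm)
    show "indicat_real {Y..T} y *\<^sub>R (K / y) \<le> norm (f y)" for y
      using Y0[of y] by (cases "y \<in> {Y..T}") (auto simp: Y_def)
  qed auto
  moreover have "ln T = ln Y + (J + 1) / K" using Y by (simp add: T_def ln_mult)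
  ultimately have "K * ((J + 1) / K) \<le> J" by (simp add: algebra_simps)
  then show False using K by simp
qed

lemma norm_mellin_log_ge:
  assumes "y \<noteq> 0"
  shows "pi / ((\<bar>x\<bar> + \<bar>y\<bar>) * exp (pi * \<bar>y\<bar>)) \<le> norm (mellin_log (Complex x y))"
proof -
  have "cosh (pi * y) = cosh (pi * \<bar>y\<bar>)" by (cases "y \<ge> 0") auto
  also have "\<dots> \<le> exp (pi * \<bar>y\<bar>)" by (simp add: cosh_def)
  finally have "norm (sin (of_real pi * Complex x y)) \<le> exp (pi * \<bar>y\<bar>)"
    using norm_sin_pi_le_cosh order_trans by blast
  moreover have "norm (Complex x y) \<le> \<bar>x\<bar> + \<bar>y\<bar>" using cmod_le[of "Complex x y"] by simp
  ultimately have "norm (Complex x y) * norm (sin (of_real pi * Complex x y)) \<le> (\<bar>x\<bar> + \<bar>y\<bar>) * exp (pi * \<bar>y\<bar>)"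
    by (intro mult_mono) auto
  moreover have "0 < norm (Complex x y) * norm (sin (of_real pi * Complex x y))"
  proof -
    have "sin (of_real pi * Complex x y) \<noteq> 0"
      using assms unfolding sin_pi_eq_0_iff by (intro Complex_notin_Ints) auto
    moreover have "Complex x y \<noteq> 0" using assms by (auto simp: complex_eq_iff)
    ultimately show ?thesis by simp
  qed
  ultimately have "pi / ((\<bar>x\<bar> + \<bar>y\<bar>) * exp (pi * \<bar>y\<bar>)) \<le> pi / (norm (Complex x y) * norm (sin (of_real pi * Complex x y)))"
    by (intro frac_le) auto
  then show ?thesis by (simp add: mellin_log_def norm_divide norm_mult)
qed

lemma norm_mellin_log_ge_pos:
  assumes "y \<ge> 1"
  shows "pi / (\<bar>c\<bar> + 1) / (y * exp (pi * y)) \<le> norm (mellin_log (Complex c y))"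
proof -
  have "\<bar>c\<bar> * 1 \<le> \<bar>c\<bar> * y" using assms by (intro mult_left_mono) auto
  then have "\<bar>c\<bar> + \<bar>y\<bar> \<le> (\<bar>c\<bar> + 1) * y" using assms by (simp add: distrib_right)
  then have "pi / ((\<bar>c\<bar> + 1) * y * exp (pi * y)) \<le> pi / ((\<bar>c\<bar> + \<bar>y\<bar>) * exp (pi * \<bar>y\<bar>))"
    using assms by (intro frac_le mult_mono) (auto intro!: mult_pos_pos)
  also have "\<dots> \<le> norm (mellin_log (Complex c y))" using assms by (intro norm_mellin_log_ge) auto
  finally show ?thesis by (simp add: mult.assoc)
qed

lemma not_integrable_line_2:
  assumes c: "-1 < c" "c < -1/2"
  shows "\<not> integrable lborel (\<lambda>y. capacity_integrand 2 z (Complex c y))"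
proof -
  obtain K where K: "K > 0" "\<And>y. \<bar>y\<bar> \<ge> 1 \<Longrightarrow> K * (sqrt \<bar>y\<bar> * exp (pi * \<bar>y\<bar> / 2)) \<le> norm (rGamma (Complex (1 + 2 * c) y))"
    using norm_rGamma_ge_neg[of "1 + 2 * c"] c by auto
  define D where "D = pi / (\<bar>c\<bar> + 1) * K * exp (- c * ln z)"
  have D: "D > 0" using K by (simp add: D_def add_nonneg_pos)
  show ?thesis
  proof (rule not_integrable_inverse[OF D])
    show "\<forall>\<^sub>F y in at_top. D / y \<le> norm (capacity_integrand 2 z (Complex c y))"
      using eventually_ge_at_top[of 1]
    proof eventually_elim
      case (elim y)
      have "K * (1 * exp (pi * y)) \<le> K * (sqrt \<bar>2 * y\<bar> * exp (pi * \<bar>2 * y\<bar> / 2))"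
        using elim K by (intro mult_left_mono mult_mono) auto
      also have "\<dots> \<le> norm (rGamma (Complex (1 + 2 * c) (2 * y)))" using elim by (intro K) auto
      finally have 1: "K * exp (pi * y) \<le> norm (rGamma (Complex (1 + 2 * c) (2 * y)))" by simp
      have "D / y = pi / (\<bar>c\<bar> + 1) / (y * exp (pi * y)) * (K * exp (pi * y)) * exp (- c * ln z)"
        by (simp add: D_def)
      also have "\<dots> \<le> norm (mellin_log (Complex c y)) * norm (rGamma (Complex (1 + 2 * c) (2 * y))) * exp (- c * ln z)"
        using elim 1 K norm_mellin_log_ge_pos[OF elim, of c] by (intro mult_right_mono mult_mono) auto
      finally show ?case unfolding norm_capacity_integrand .
    qed
  qed
qed

lemma not_integrable_line_gt_2:
  assumes q: "\<bar>q\<bar> > 2"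
  shows "\<not> integrable lborel (\<lambda>y. capacity_integrand q z (Complex c y))"
proof -
  obtain K n where K: "K > 0" "\<And>y. \<bar>y\<bar> \<ge> 1 \<Longrightarrow> K * (exp (pi * \<bar>y\<bar> / 2) / \<bar>y\<bar> ^ n) \<le> norm (rGamma (Complex (1 + q * c) y))"
    using norm_rGamma_ge[of "1 + q * c"] by blast
  define D where "D = pi / (\<bar>c\<bar> + 1) * K * exp (- c * ln z)"
  have D: "D > 0" using K by (simp add: D_def add_nonneg_pos)
  define d where "d = pi * (\<bar>q\<bar> / 2 - 1)"
  have d: "d > 0" using q by (simp add: d_def)
  have "((\<lambda>y. (\<bar>q\<bar> / d) ^ n * ((d * y) ^ n / exp (d * y))) \<longlongrightarrow> (\<bar>q\<bar> / d) ^ n * 0) at_top"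
    by (intro tendsto_intros filterlim_compose[OF tendsto_power_div_exp_0] filterlim_tendsto_pos_mult_at_top[OF tendsto_const d filterlim_ident])
  then have "\<forall>\<^sub>F y in at_top. (\<bar>q\<bar> / d) ^ n * ((d * y) ^ n / exp (d * y)) < 1"
    by (rule order_tendstoD) simp
  then have ev: "\<forall>\<^sub>F y in at_top. (\<bar>q\<bar> * y) ^ n \<le> exp (d * y)"
  proof eventually_elim
    case (elim y)
    have "(\<bar>q\<bar> / d) ^ n * ((d * y) ^ n / exp (d * y)) = (\<bar>q\<bar> * y) ^ n / exp (d * y)"
      using d by (simp add: power_divide power_mult_distrib)
    with elim show ?case by (simp add: divide_less_eq)
  qed
  show ?thesis
  proof (rule not_integrable_inverse[OF D])
    show "\<forall>\<^sub>F y in at_top. D / y \<le> norm (capacity_integrand q z (Complex c y))"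
      using ev eventually_ge_at_top[of 1]
    proof eventually_elim
      case (elim y)
      have "1 * 1 \<le> \<bar>q\<bar> * \<bar>y\<bar>" using elim q by (intro mult_mono) auto
      then have qy: "\<bar>q * y\<bar> \<ge> 1" by (simp add: abs_mult)
      have a: "\<bar>q * y\<bar> = \<bar>q\<bar> * y" using elim by (simp add: abs_mult)
      have p: "0 < (\<bar>q\<bar> * y) ^ n" using q elim by simp
      have "exp (pi * y) * (\<bar>q\<bar> * y) ^ n \<le> exp (pi * y) * exp (d * y)" using elim by (intro mult_left_mono) auto
      also have "\<dots> = exp (pi * (\<bar>q\<bar> * y) / 2)" by (simp add: d_def algebra_simps flip: exp_add)
      finally have "exp (pi * y) \<le> exp (pi * (\<bar>q\<bar> * y) / 2) / (\<bar>q\<bar> * y) ^ n" using p by (simp add: pos_le_divide_eq)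
      then have "K * exp (pi * y) \<le> K * (exp (pi * (\<bar>q\<bar> * y) / 2) / (\<bar>q\<bar> * y) ^ n)" using K by (intro mult_left_mono) auto
      also have "\<dots> \<le> norm (rGamma (Complex (1 + q * c) (q * y)))" using K(2)[OF qy] unfolding a .
      finally have 1: "K * exp (pi * y) \<le> norm (rGamma (Complex (1 + q * c) (q * y)))" .
      have "D / y = pi / (\<bar>c\<bar> + 1) / (y * exp (pi * y)) * (K * exp (pi * y)) * exp (- c * ln z)"
        by (simp add: D_def)
      also have "\<dots> \<le> norm (mellin_log (Complex c y)) * norm (rGamma (Complex (1 + q * c) (q * y))) * exp (- c * ln z)"
        using elim 1 K norm_mellin_log_ge_pos[OF elim(2), of c] by (intro mult_right_mono mult_mono) auto
      finally show ?case unfolding norm_capacity_integrand .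
    qed
  qed
qed

lemma not_integrable_left_ray:
  assumes q: "q > 0" and u: "u \<noteq> 0"
  shows "\<not> set_integrable lborel {..c} (\<lambda>x. capacity_integrand q z (Complex x u))"
proof
  assume "set_integrable lborel {..c} (\<lambda>x. capacity_integrand q z (Complex x u))"
  then have "integrable lborel (\<lambda>x. indicat_real {..c} (0 + (-1) * x) *\<^sub>R capacity_integrand q z (Complex (0 + (-1) * x) u))"
    unfolding set_integrable_def by (rule lborel_integrable_real_affine) simp
  then have int: "integrable lborel (\<lambda>x. indicat_real {..c} (- x) *\<^sub>R capacity_integrand q z (Complex (- x) u))" by simp
  define R where "R = rGamma_ratio 1 (q * u)"
  define b where "b = - ln z / q"
  define S where "S = sinh (pi * \<bar>q * u\<bar>)"
  define D where "D = pi / (2 * exp (pi * \<bar>u\<bar>)) * (S / (pi * R) * (exp (- b) / exp (exp b + 1)))"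
  have R: "R > 0" using rGamma_ratio_ge_1[of 1 "q * u"] by (simp add: R_def)
  have S: "S > 0" using q u by (simp add: S_def)
  have D: "D > 0" unfolding D_def using R S by simp
  have "\<forall>\<^sub>F x in at_top. D / x \<le> norm (indicat_real {..c} (- x) *\<^sub>R capacity_integrand q z (Complex (- x) u))"
    using eventually_ge_at_top[of "- c"] eventually_ge_at_top[of "1 / q"] eventually_ge_at_top[of "\<bar>u\<bar>"] eventually_ge_at_top[of 1]
  proof eventually_elim
    case (elim x)
    have qx: "q * x \<ge> 1" using elim(2) q by (simp add: field_simps)
    have G: "Gamma (q * x) > 0" using qx by (intro Gamma_real_pos) auto
    let ?w = "Complex (1 + q * (- x)) (q * u)"
    have w1: "1 - ?w = Complex (q * x) (- (q * u))" by (simp add: complex_eq_iff)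
    have "rGamma_ratio (q * x) (- (q * u)) \<le> R" unfolding R_def using qx by (intro rGamma_ratio_mono) auto
    then have r: "norm (rGamma (1 - ?w)) \<le> R / Gamma (q * x)"
      unfolding w1 using qx G by (subst norm_rGamma_eq) (auto intro!: divide_right_mono)
    have "S \<le> norm (sin (of_real pi * ?w))" unfolding S_def by (rule norm_sin_pi_ge_sinh)
    then have "S / pi \<le> norm (sin (of_real pi * ?w) / of_real pi)" by (simp add: norm_divide divide_right_mono)
    also have "\<dots> = norm (rGamma ?w) * norm (rGamma (1 - ?w))"
      unfolding rGamma_reflection_complex[of ?w, symmetric] norm_mult ..
    also have "\<dots> \<le> norm (rGamma ?w) * (R / Gamma (q * x))" by (intro mult_left_mono r) auto
    finally have "S / pi * (Gamma (q * x) / R) \<le> norm (rGamma ?w) * (R / Gamma (q * x)) * (Gamma (q * x) / R)"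
      using R G by (intro mult_right_mono) auto
    then have 1: "S / (pi * R) * Gamma (q * x) \<le> norm (rGamma ?w)" using R G by simp
    have "exp (b * (q * x - 1)) \<le> exp (exp b + 1) * Gamma (1 + (q * x - 1))" using qx by (intro Gamma_ge_exp) auto
    then have "exp (b * (q * x - 1)) / exp (exp b + 1) \<le> Gamma (q * x)" by (simp add: pos_divide_le_eq mult.commute)
    then have "S / (pi * R) * (exp (b * (q * x - 1)) / exp (exp b + 1)) \<le> S / (pi * R) * Gamma (q * x)"
      using S R by (intro mult_left_mono) auto
    with 1 have 2: "S / (pi * R) * (exp (b * (q * x - 1)) / exp (exp b + 1)) \<le> norm (rGamma ?w)" by simp
    have "pi / ((2 * x) * exp (pi * \<bar>u\<bar>)) \<le> pi / ((\<bar>- x\<bar> + \<bar>u\<bar>) * exp (pi * \<bar>u\<bar>))"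
      using elim by (intro frac_le mult_right_mono) (auto intro!: mult_pos_pos)
    also have "\<dots> \<le> norm (mellin_log (Complex (- x) u))" by (intro norm_mellin_log_ge u)
    finally have 3: "pi / ((2 * x) * exp (pi * \<bar>u\<bar>)) \<le> norm (mellin_log (Complex (- x) u))" .
    have e: "exp (b * (q * x - 1)) * exp (- (- x) * ln z) = exp (- b)"
      using q by (simp add: b_def field_simps flip: exp_add)
    have "D / x = pi / ((2 * x) * exp (pi * \<bar>u\<bar>)) * (S / (pi * R) * ((exp (b * (q * x - 1)) * exp (- (- x) * ln z)) / exp (exp b + 1)))"
      unfolding e D_def by simp
    also have "\<dots> = pi / ((2 * x) * exp (pi * \<bar>u\<bar>)) * (S / (pi * R) * (exp (b * (q * x - 1)) / exp (exp b + 1))) * exp (- (- x) * ln z)"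
      by simp
    also have "\<dots> \<le> norm (mellin_log (Complex (- x) u)) * norm (rGamma ?w) * exp (- (- x) * ln z)"
      using 2 3 S R elim by (intro mult_right_mono mult_mono) auto
    finally show ?case using elim by (simp add: norm_capacity_integrand)
  qed
  from not_integrable_inverse[OF D this] int show False by simp
qed

section \<open>Evaluation of the H-function\<close>

lemma Complex_line_notin_Ints: "-1 < c \<Longrightarrow> c < 0 \<Longrightarrow> Complex c y \<notin> \<int>"
  using notin_Ints_unit(1) by (intro Complex_notin_Ints) auto

lemma right_loop_value_uminus:
  "right_loop_value f (c, u, v) = left_loop_value (\<lambda>t. f (- t)) (- c, - v, - u)"
proof -
  have H: "(LINT x:{c..}|lborel. f (Complex x y)) = (LINT x:{..- c}|lborel. f (- Complex x (- y)))" for y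
  proof -
    have "(LINT x:{c..}|lborel. f (Complex x y)) = (LINT x|lborel. indicat_real {c..} (0 + (-1) * x) *\<^sub>R f (Complex (0 + (-1) * x) y))"
      unfolding set_lebesgue_integral_def by (subst lborel_integral_real_affine[where c = "-1" and t = 0]) auto
    also have "\<dots> = (LINT x:{..- c}|lborel. f (- Complex x (- y)))"
      unfolding set_lebesgue_integral_def
      by (intro Bochner_Integration.integral_cong) (auto simp: indicator_def uminus_complex.code)
    finally show ?thesis .
  qed
  have V: "(LINT y:{u..v}|lborel. f (Complex c y)) = (LINT y:{- v..- u}|lborel. f (- Complex (- c) y))"
  proof -
    have "(LINT y:{u..v}|lborel. f (Complex c y)) = (LINT y|lborel. indicat_real {u..v} (0 + (-1) * y) *\<^sub>R f (Complex c (0 + (-1) * y)))"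
      unfolding set_lebesgue_integral_def by (subst lborel_integral_real_affine[where c = "-1" and t = 0]) auto
    also have "\<dots> = (LINT y:{- v..- u}|lborel. f (- Complex (- c) y))"
      unfolding set_lebesgue_integral_def
      by (intro Bochner_Integration.integral_cong) (auto simp: indicator_def uminus_complex.code)
    finally show ?thesis .
  qed
  show ?thesis
    unfolding right_loop_value_def left_loop_value_def prod.case H V by simp
qed

context
  fixes q z :: real and f :: "complex \<Rightarrow> complex" and A B :: "complex set"
  assumes z: "z > 0"
  defines "f \<equiv> fox_H_integrand 1 2 [(1, 1), (1, 1), (1, (\<bar>q\<bar> + q) / 2)] [(1, 1), (0, 1), (0, (\<bar>q\<bar> - q) / 2)] (of_real z)"
    and "A \<equiv> fox_H_left_poles 1 [(1, 1), (0, 1), (0, (\<bar>q\<bar> - q) / 2)]"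
    and "B \<equiv> fox_H_right_poles 2 [(1, 1), (1, 1), (1, (\<bar>q\<bar> + q) / 2)]"
begin

lemma fox_integrand: "t \<notin> \<int> \<Longrightarrow> f t = capacity_integrand q z t"
  unfolding f_def using z by (rule fox_H_integrand_eq)

lemma fox_poles:
  shows "-1 \<in> A" "0 \<in> B" "t \<in> A \<Longrightarrow> Re t \<le> -1" "t \<in> A \<Longrightarrow> Im t = 0" "t \<in> B \<Longrightarrow> Re t \<ge> 0" "t \<in> B \<Longrightarrow> Im t = 0"
  using fox_H_poles_cases[of "of_real ((\<bar>q\<bar> - q) / 2)" "of_real ((\<bar>q\<bar> + q) / 2)"] fox_H_poles_cases
  unfolding A_def B_def by metis+

lemma fox_line_integrand: "-1 < c \<Longrightarrow> c < 0 \<Longrightarrow> f (Complex c y) = capacity_integrand q z (Complex c y)"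
  by (intro fox_integrand Complex_line_notin_Ints)

lemma fox_ray_integrand: "u \<noteq> 0 \<Longrightarrow> f (Complex x u) = capacity_integrand q z (Complex x u)"
  by (intro fox_integrand Complex_notin_Ints) auto

lemma fox_line_admissible_iff:
  "line_admissible f A B c \<longleftrightarrow> -1 < c \<and> c < 0 \<and> integrable lborel (\<lambda>y. capacity_integrand q z (Complex c y))"
proof -
  have "(\<forall>t\<in>A. Re t < c) \<longleftrightarrow> -1 < c" using fox_poles(1,3) by force
  moreover have "(\<forall>t\<in>B. c < Re t) \<longleftrightarrow> c < 0" using fox_poles(2,5) by force
  ultimately show ?thesis unfolding line_admissible_def using fox_line_integrand by auto
qed

lemma fox_left_loop_admissible_iff:
  "left_loop_admissible f A B (c, u, v) \<longleftrightarrow> -1 < c \<and> c < 0 \<and> u < 0 \<and> 0 < v \<and>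
     set_integrable lborel {..c} (\<lambda>x. capacity_integrand q z (Complex x u)) \<and>
     set_integrable lborel {..c} (\<lambda>x. capacity_integrand q z (Complex x v))"
proof -
  have a: "(\<forall>t\<in>A. Re t < c \<and> u < Im t \<and> Im t < v) \<longleftrightarrow> -1 < c \<and> u < 0 \<and> 0 < v"
    using fox_poles(1,3,4) by force
  have b: "(\<forall>t\<in>B. \<not> (Re t \<le> c \<and> u \<le> Im t \<and> Im t \<le> v)) \<longleftrightarrow> c < 0" if "u < 0" "0 < v"
    using fox_poles(2,5,6) that by force
  show ?thesis
    unfolding left_loop_admissible_def prod.case a using b fox_ray_integrand[of u] fox_ray_integrand[of v] by auto
qed

lemma fox_right_loop_admissible_iff:
  "right_loop_admissible f A B (c, u, v) \<longleftrightarrow> -1 < c \<and> c < 0 \<and> u < 0 \<and> 0 < v \<and>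
     set_integrable lborel {c..} (\<lambda>x. capacity_integrand q z (Complex x u)) \<and>
     set_integrable lborel {c..} (\<lambda>x. capacity_integrand q z (Complex x v))"
proof -
  have b: "(\<forall>t\<in>B. c < Re t \<and> u < Im t \<and> Im t < v) \<longleftrightarrow> c < 0 \<and> u < 0 \<and> 0 < v"
    using fox_poles(2,5,6) by force
  have a: "(\<forall>t\<in>A. \<not> (c \<le> Re t \<and> u \<le> Im t \<and> Im t \<le> v)) \<longleftrightarrow> -1 < c" if "u < 0" "0 < v"
    using fox_poles(1,3,4) that by force
  show ?thesis
    unfolding right_loop_admissible_def prod.case b using a fox_ray_integrand[of u] fox_ray_integrand[of v] by auto
qed

lemma fox_H_unfold:
  "fox_H 1 2 [(1, 1), (1, 1), (1, (\<bar>q\<bar> + q) / 2)] [(1, 1), (0, 1), (0, (\<bar>q\<bar> - q) / 2)] (of_real z) =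
     (if \<exists>c. line_admissible f A B c then line_value f (SOME c. line_admissible f A B c)
      else if \<exists>k. left_loop_admissible f A B k then left_loop_value f (SOME k. left_loop_admissible f A B k)
      else if \<exists>k. right_loop_admissible f A B k then right_loop_value f (SOME k. right_loop_admissible f A B k)
      else 0)"
  unfolding fox_H_def Let_def f_def A_def B_def ..

lemma fox_H_eq_line:
  assumes q: "\<bar>q\<bar> \<le> 2"
  shows "fox_H 1 2 [(1, 1), (1, 1), (1, (\<bar>q\<bar> + q) / 2)] [(1, 1), (0, 1), (0, (\<bar>q\<bar> - q) / 2)] (of_real z) =
    line_value (capacity_integrand q z) (-1/8)"
proof -
  obtain K where i: "\<And>c z. -1/8 \<le> c \<Longrightarrow> c < 0 \<Longrightarrow> integrable lborel (\<lambda>y. capacity_integrand q z (Complex c y))"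
    using capacity_integrand_line_bound[OF q] by metis
  define c where "c = (SOME c. line_admissible f A B c)"
  have ex: "line_admissible f A B (-1/8)" unfolding fox_line_admissible_iff using i by auto
  then have "line_admissible f A B c" unfolding c_def by (rule someI)
  then have c: "-1 < c" "c < 0" "integrable lborel (\<lambda>y. capacity_integrand q z (Complex c y))"
    unfolding fox_line_admissible_iff by auto
  have cond: "\<bar>q\<bar> < 2 \<or> \<bar>q\<bar> = 2 \<and> 1 + q * (-1/8) \<ge> 0 \<and> 1 + q * c \<ge> 0"
  proof (cases "\<bar>q\<bar> < 2")
    case False
    then consider "q = 2" | "q = -2" using q by linarith
    then show ?thesis
    proof cases
      case 1
      have "\<not> c < -1/2" using c not_integrable_line_2[of c z] 1 by auto
      then show ?thesis using 1 by auto
    qed (use c in auto)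
  qed simp
  have "(LINT y|lborel. capacity_integrand q z (Complex c y)) = (LINT y|lborel. capacity_integrand q z (Complex (-1/8) y))"
    by (rule capacity_integrand_line_shift[OF cond]) (use c i in auto)
  moreover have "line_value f c = line_value (capacity_integrand q z) c"
    unfolding line_value_def using fox_line_integrand[OF c(1,2)] by simp
  ultimately have "line_value f c = line_value (capacity_integrand q z) (-1/8)"
    by (simp add: line_value_def)
  then show ?thesis using ex unfolding fox_H_unfold c_def by auto
qed

lemma no_fox_line:
  assumes "\<bar>q\<bar> > 2"
  shows "\<not> (\<exists>c. line_admissible f A B c)"
  unfolding fox_line_admissible_iff using not_integrable_line_gt_2[OF assms] by blast

lemma fox_H_eq_left_loop:
  assumes q: "q < -2"
  shows "fox_H 1 2 [(1, 1), (1, 1), (1, (\<bar>q\<bar> + q) / 2)] [(1, 1), (0, 1), (0, (\<bar>q\<bar> - q) / 2)] (of_real z) =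
    left_loop_value (capacity_integrand q z) (-1/2, -1, 1)"
proof -
  obtain c u v where k: "(SOME k. left_loop_admissible f A B k) = (c, u, v)" by (metis surj_pair)
  have ex: "left_loop_admissible f A B (-1/2, -1, 1)"
    unfolding fox_left_loop_admissible_iff using q by (auto intro!: set_integrable_capacity_integrand_ray)
  then have "left_loop_admissible f A B (c, u, v)" unfolding k[symmetric] by (rule someI)
  then have c: "-1 < c" "c < 0" "u < 0" "0 < v" unfolding fox_left_loop_admissible_iff by auto
  have "left_loop_value f (c, u, v) = left_loop_value (capacity_integrand q z) (c, u, v)"
    unfolding left_loop_value_def prod.case using fox_line_integrand[OF c(1,2)] fox_ray_integrand c by simp
  also have "\<dots> = left_loop_value (capacity_integrand q z) (-1/2, -1, 1)"
    using c q by (intro left_loop_value_unique[where n = "-1"]) auto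
  finally show ?thesis using no_fox_line q ex unfolding fox_H_unfold k by auto
qed

lemma fox_H_eq_right_loop:
  assumes q: "q > 2"
  shows "fox_H 1 2 [(1, 1), (1, 1), (1, (\<bar>q\<bar> + q) / 2)] [(1, 1), (0, 1), (0, (\<bar>q\<bar> - q) / 2)] (of_real z) =
    left_loop_value (capacity_integrand (- q) (1 / z)) (1 / (2 * q), -1, 1)"
proof -
  have nl: "\<not> (\<exists>k. left_loop_admissible f A B k)"
  proof
    assume "\<exists>k. left_loop_admissible f A B k"
    then obtain c u v where "left_loop_admissible f A B (c, u, v)" by auto
    then show False unfolding fox_left_loop_admissible_iff using not_integrable_left_ray[of q u c z] q by auto
  qed
  obtain c u v where k: "(SOME k. right_loop_admissible f A B k) = (c, u, v)" by (metis surj_pair)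
  have ray: "set_integrable lborel {-1/2..} (\<lambda>x. capacity_integrand q z (Complex x y))" if y: "y \<noteq> 0" for y
  proof -
    have "set_integrable lborel {..1/2} (\<lambda>x. capacity_integrand (- q) (1 / z) (Complex x (- y)))"
      using q y by (intro set_integrable_capacity_integrand_ray) auto
    then have "integrable lborel (\<lambda>x. indicat_real {..1/2} (0 + (-1) * x) *\<^sub>R capacity_integrand (- q) (1 / z) (Complex (0 + (-1) * x) (- y)))"
      unfolding set_integrable_def by (rule lborel_integrable_real_affine) simp
    also have "(\<lambda>x. indicat_real {..1/2} (0 + (-1) * x) *\<^sub>R capacity_integrand (- q) (1 / z) (Complex (0 + (-1) * x) (- y))) =
      (\<lambda>x. indicat_real {-1/2..} x *\<^sub>R capacity_integrand q z (Complex x y))"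
    proof
      fix x
      have "capacity_integrand (- q) (1 / z) (Complex (0 + (-1) * x) (- y)) = capacity_integrand q z (Complex x y)"
        using capacity_integrand_uminus[OF z, of q "Complex (- x) (- y)"] by (simp add: uminus_complex.code)
      then show "indicat_real {..1/2} (0 + (-1) * x) *\<^sub>R capacity_integrand (- q) (1 / z) (Complex (0 + (-1) * x) (- y)) =
        indicat_real {-1/2..} x *\<^sub>R capacity_integrand q z (Complex x y)" by (simp add: indicator_def)
    qed
    finally show ?thesis unfolding set_integrable_def .
  qed
  have ex: "right_loop_admissible f A B (-1/2, -1, 1)"
    unfolding fox_right_loop_admissible_iff using ray by auto
  then have "right_loop_admissible f A B (c, u, v)" unfolding k[symmetric] by (rule someI)
  then have c: "-1 < c" "c < 0" "u < 0" "0 < v" unfolding fox_right_loop_admissible_iff by auto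
  have "right_loop_value f (c, u, v) = right_loop_value (capacity_integrand q z) (c, u, v)"
    unfolding right_loop_value_def prod.case using fox_line_integrand[OF c(1,2)] fox_ray_integrand c by simp
  also have "\<dots> = left_loop_value (capacity_integrand (- q) (1 / z)) (- c, - v, - u)"
    unfolding right_loop_value_uminus capacity_integrand_uminus[OF z] ..
  also have "\<dots> = left_loop_value (capacity_integrand (- q) (1 / z)) (1 / (2 * q), -1, 1)"
    using c q by (intro left_loop_value_unique[where n = 0]) (auto simp: field_simps)
  finally show ?thesis using no_fox_line nl q ex unfolding fox_H_unfold k by auto
qed

end

section \<open>Holomorphy of exponential transforms\<close>

lemma norm_exp_diff_le:
  fixes w w' :: complex and a x :: real
  assumes "a \<le> Re w" "a \<le> Re w'" "0 \<le> x"
  shows "norm (exp (- w' * of_real x) - exp (- w * of_real x)) \<le> x * exp (- a * x) * norm (w' - w)"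
proof (rule field_differentiable_bound[where S = "{w. a \<le> Re w}" and f' = "\<lambda>w. - of_real x * exp (- w * of_real x)"])
  show "convex {w. a \<le> Re w}" by (rule convex_halfspace_Re_ge)
  show "((\<lambda>w. exp (- w * of_real x)) has_field_derivative - of_real x * exp (- z * of_real x)) (at z within {w. a \<le> Re w})" for z
    by (auto intro!: derivative_eq_intros)
  show "norm (- complex_of_real x * exp (- z * of_real x)) \<le> x * exp (- a * x)" if "z \<in> {w. a \<le> Re w}" for z
  proof -
    have "a * x \<le> Re z * x" using that assms by (intro mult_right_mono) auto
    then have "x * exp (- (Re z * x)) \<le> x * exp (- a * x)" using assms by (intro mult_left_mono) auto
    moreover have "norm (- complex_of_real x * exp (- z * of_real x)) = x * exp (- (Re z * x))"
      using assms by (simp add: norm_mult)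
    ultimately show ?thesis by simp
  qed
qed (use assms in auto)

lemma exp_transform_has_field_derivative:
  fixes g :: "'a \<Rightarrow> complex" and X :: "'a \<Rightarrow> real" and \<sigma> :: real
  assumes [measurable]: "g \<in> borel_measurable M" "X \<in> borel_measurable M"
    and X: "\<And>\<omega>. \<omega> \<in> space M \<Longrightarrow> 0 \<le> X \<omega>"
    and int: "integrable M (\<lambda>\<omega>. g \<omega> * exp (- of_real \<sigma> * of_real (X \<omega>)))"
    and w: "Re w > \<sigma>"
  shows "integrable M (\<lambda>\<omega>. g \<omega> * of_real (X \<omega>) * exp (- w * of_real (X \<omega>)))"
    and "((\<lambda>w. \<integral>\<omega>. g \<omega> * exp (- w * of_real (X \<omega>)) \<partial>M) has_field_derivative
      - (\<integral>\<omega>. g \<omega> * of_real (X \<omega>) * exp (- w * of_real (X \<omega>)) \<partial>M)) (at w)"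
proof -
  define \<delta> where "\<delta> = (Re w - \<sigma>) / 2"
  have \<delta>: "\<delta> > 0" using w by (simp add: \<delta>_def)
  define b where "b = (\<lambda>\<omega>. norm (g \<omega> * exp (- of_real \<sigma> * of_real (X \<omega>))) * (1 / \<delta>))"
  have ib: "integrable M b" unfolding b_def by (intro integrable_mult_left integrable_norm int)
  have key: "norm (g \<omega>) * (X \<omega> * exp (- (\<sigma> + \<delta>) * X \<omega>)) \<le> b \<omega>" if "\<omega> \<in> space M" for \<omega>
  proof -
    have "\<delta> * X \<omega> \<le> exp (\<delta> * X \<omega>)" using exp_ge_add_one_self[of "\<delta> * X \<omega>"] by linarith
    then have "\<delta> * X \<omega> * exp (- (\<delta> * X \<omega>)) \<le> exp (\<delta> * X \<omega>) * exp (- (\<delta> * X \<omega>))" by (rule mult_right_mono) simp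
    also have "\<dots> = 1" by (simp only: exp_minus_inverse)
    finally have "X \<omega> * exp (- (\<delta> * X \<omega>)) \<le> 1 / \<delta>"
      unfolding pos_le_divide_eq[OF \<delta>] by (simp only: mult_ac)
    then have "(norm (g \<omega>) * exp (- \<sigma> * X \<omega>)) * (X \<omega> * exp (- (\<delta> * X \<omega>))) \<le> (norm (g \<omega>) * exp (- \<sigma> * X \<omega>)) * (1 / \<delta>)"
      by (intro mult_left_mono) auto
    moreover have "exp (- (\<sigma> + \<delta>) * X \<omega>) = exp (- \<sigma> * X \<omega>) * exp (- (\<delta> * X \<omega>))"
    proof -
      have "- (\<sigma> + \<delta>) * X \<omega> = - \<sigma> * X \<omega> + - (\<delta> * X \<omega>)" by (simp add: algebra_simps)
      then show ?thesis by (simp only: exp_add)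
    qed
    moreover have "norm (g \<omega> * exp (- of_real \<sigma> * of_real (X \<omega>))) = norm (g \<omega>) * exp (- \<sigma> * X \<omega>)"
      by (simp add: norm_mult)
    ultimately show ?thesis unfolding b_def by (simp only: mult_ac)
  qed
  have exp_le: "norm (g \<omega> * exp (- w' * of_real (X \<omega>))) \<le> norm (g \<omega> * exp (- of_real \<sigma> * of_real (X \<omega>)))"
    if "\<sigma> \<le> Re w'" "\<omega> \<in> space M" for w' \<omega>
  proof -
    have "\<sigma> * X \<omega> \<le> Re w' * X \<omega>" using that X by (intro mult_right_mono) auto
    then have "norm (g \<omega>) * exp (- (Re w' * X \<omega>)) \<le> norm (g \<omega>) * exp (- (\<sigma> * X \<omega>))" by (intro mult_left_mono) auto
    then show ?thesis by (simp add: norm_mult)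
  qed
  have iw: "integrable M (\<lambda>\<omega>. g \<omega> * exp (- w' * of_real (X \<omega>)))" if "\<sigma> \<le> Re w'" for w'
    by (rule Bochner_Integration.integrable_bound[OF int]) (use exp_le[OF that] in \<open>auto intro!: AE_I2\<close>)
  have le1: "norm (g \<omega> * of_real (X \<omega>) * exp (- w * of_real (X \<omega>))) \<le> b \<omega>" if "\<omega> \<in> space M" for \<omega>
  proof -
    have "\<sigma> + \<delta> \<le> Re w" using w by (simp add: \<delta>_def field_simps)
    then have "(\<sigma> + \<delta>) * X \<omega> \<le> Re w * X \<omega>" using X[OF that] by (intro mult_right_mono)
    then have "norm (g \<omega>) * (X \<omega> * exp (- Re w * X \<omega>)) \<le> norm (g \<omega>) * (X \<omega> * exp (- (\<sigma> + \<delta>) * X \<omega>))"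
      using X[OF that] by (intro mult_left_mono) (auto simp: algebra_simps)
    also note key[OF that]
    finally show ?thesis using X[OF that] by (simp add: norm_mult mult.assoc)
  qed
  have b0: "0 \<le> b \<omega>" for \<omega> using \<delta> by (simp add: b_def)
  show "integrable M (\<lambda>\<omega>. g \<omega> * of_real (X \<omega>) * exp (- w * of_real (X \<omega>)))"
    by (rule Bochner_Integration.integrable_bound[OF ib]) (use le1 b0 in \<open>auto intro!: AE_I2\<close>)
  define S where "S = {w. \<sigma> + \<delta> < Re w}"
  have S: "open S" "w \<in> S"
    unfolding S_def by (rule open_halfspace_Re_gt) (use w in \<open>simp add: \<delta>_def field_simps\<close>)
  let ?F = "\<lambda>w. \<integral>\<omega>. g \<omega> * exp (- w * of_real (X \<omega>)) \<partial>M"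
  let ?D = "- (\<integral>\<omega>. g \<omega> * of_real (X \<omega>) * exp (- w * of_real (X \<omega>)) \<partial>M)"
  have "((\<lambda>y. (?F y - ?F w) / (y - w)) \<longlongrightarrow> ?D) (at w within S)"
    unfolding tendsto_at_iff_sequentially comp_def
  proof (intro allI impI)
    fix Y :: "nat \<Rightarrow> complex" assume Y: "\<forall>i. Y i \<in> S - {w}" "Y \<longlonglongrightarrow> w"
    let ?q = "\<lambda>i \<omega>. g \<omega> * ((exp (- Y i * of_real (X \<omega>)) - exp (- w * of_real (X \<omega>))) / (Y i - w))"
    have eq: "(?F (Y i) - ?F w) / (Y i - w) = (\<integral>\<omega>. ?q i \<omega> \<partial>M)" for i
    proof -
      have "\<sigma> \<le> Re (Y i)" using Y(1) \<delta> by (auto simp: S_def dest!: spec[of _ i])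
      then have "?F (Y i) - ?F w = (\<integral>\<omega>. g \<omega> * exp (- Y i * of_real (X \<omega>)) - g \<omega> * exp (- w * of_real (X \<omega>)) \<partial>M)"
        using w by (intro Bochner_Integration.integral_diff[symmetric] iw) auto
      then have "(?F (Y i) - ?F w) / (Y i - w) = (\<integral>\<omega>. (g \<omega> * exp (- Y i * of_real (X \<omega>)) - g \<omega> * exp (- w * of_real (X \<omega>))) / (Y i - w) \<partial>M)"
        by (simp only: integral_divide_zero)
      then show ?thesis by (simp add: right_diff_distrib)
    qed
    have "(\<lambda>i. \<integral>\<omega>. ?q i \<omega> \<partial>M) \<longlonglongrightarrow> (\<integral>\<omega>. g \<omega> * (- of_real (X \<omega>) * exp (- w * of_real (X \<omega>))) \<partial>M)"
    proof (rule integral_dominated_convergence[where w = b])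
      show "AE \<omega> in M. (\<lambda>i. ?q i \<omega>) \<longlonglongrightarrow> g \<omega> * (- of_real (X \<omega>) * exp (- w * of_real (X \<omega>)))"
      proof (rule AE_I2)
        fix \<omega>
        have "((\<lambda>w. exp (- w * of_real (X \<omega>))) has_field_derivative - of_real (X \<omega>) * exp (- w * of_real (X \<omega>))) (at w within S)"
          by (auto intro!: derivative_eq_intros)
        then have "((\<lambda>y. (exp (- y * of_real (X \<omega>)) - exp (- w * of_real (X \<omega>))) / (y - w)) \<longlongrightarrow> - of_real (X \<omega>) * exp (- w * of_real (X \<omega>))) (at w within S)"
          unfolding has_field_derivative_iff .
        then have "(\<lambda>i. (exp (- Y i * of_real (X \<omega>)) - exp (- w * of_real (X \<omega>))) / (Y i - w)) \<longlonglongrightarrow> - of_real (X \<omega>) * exp (- w * of_real (X \<omega>))"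
          using Y unfolding tendsto_at_iff_sequentially comp_def by blast
        then show "(\<lambda>i. ?q i \<omega>) \<longlonglongrightarrow> g \<omega> * (- of_real (X \<omega>) * exp (- w * of_real (X \<omega>)))"
          by (rule tendsto_mult_left)
      qed
      show "AE \<omega> in M. norm (?q i \<omega>) \<le> b \<omega>" for i
      proof (rule AE_I2)
        fix \<omega> assume \<omega>: "\<omega> \<in> space M"
        have Yi: "\<sigma> + \<delta> \<le> Re (Y i)" "Y i \<noteq> w" using Y(1) by (auto simp: S_def dest!: spec[of _ i])
        have "norm (exp (- Y i * of_real (X \<omega>)) - exp (- w * of_real (X \<omega>))) \<le> X \<omega> * exp (- (\<sigma> + \<delta>) * X \<omega>) * norm (Y i - w)"
          using S X[OF \<omega>] Yi by (intro norm_exp_diff_le) (auto simp: S_def)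
        then have "norm ((exp (- Y i * of_real (X \<omega>)) - exp (- w * of_real (X \<omega>))) / (Y i - w)) \<le> X \<omega> * exp (- (\<sigma> + \<delta>) * X \<omega>)"
          using Yi by (simp add: norm_divide pos_divide_le_eq)
        then have "norm (?q i \<omega>) \<le> norm (g \<omega>) * (X \<omega> * exp (- (\<sigma> + \<delta>) * X \<omega>))"
          unfolding norm_mult by (intro mult_left_mono) auto
        also note key[OF \<omega>]
        finally show "norm (?q i \<omega>) \<le> b \<omega>" .
      qed
    qed (use ib in measurable)
    moreover have "(\<integral>\<omega>. g \<omega> * (- of_real (X \<omega>) * exp (- w * of_real (X \<omega>))) \<partial>M) = ?D"
      by (simp add: mult.assoc)
    ultimately show "(\<lambda>i. (?F (Y i) - ?F w) / (Y i - w)) \<longlonglongrightarrow> ?D" unfolding eq by simp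
  qed
  then show "(?F has_field_derivative ?D) (at w)"
    unfolding has_field_derivative_iff at_within_open[OF S(2,1)] .
qed

section \<open>The Laplace transform of the kernel\<close>

lemma integrable_capacity_integrand_line:
  assumes "\<bar>q\<bar> \<le> 2" "-1/8 \<le> c" "c < 0"
  shows "integrable lborel (\<lambda>y. capacity_integrand q z (Complex c y))"
  by (rule capacity_integrand_line_bound[OF assms(1)]) (use assms(2,3) in blast)

lemma capacity_kernel_eq:
  fixes q s \<eta> :: real
  assumes "s > 0" "\<eta> > 0" "L \<ge> 1"
  defines "z \<equiv> \<eta> / real L powr q * s powr (- q)"
  shows "\<bar>q\<bar> \<le> 2 \<Longrightarrow> capacity_kernel L \<eta> q s = - line_value (capacity_integrand q z) (-1/8)"
    and "q < -2 \<Longrightarrow> capacity_kernel L \<eta> q s = - left_loop_value (capacity_integrand q z) (-1/2, -1, 1)"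
    and "q > 2 \<Longrightarrow> capacity_kernel L \<eta> q s = - left_loop_value (capacity_integrand (- q) (1 / z)) (1 / (2 * q), -1, 1)"
proof -
  have z: "z > 0" using assms by (simp add: z_def)
  have e: "\<eta> / (real L powr q * s powr q) = z" by (simp add: z_def powr_minus divide_inverse)
  show "\<bar>q\<bar> \<le> 2 \<Longrightarrow> capacity_kernel L \<eta> q s = - line_value (capacity_integrand q z) (-1/8)"
    unfolding capacity_kernel_def e by (simp only: fox_H_eq_line[OF z])
  show "q < -2 \<Longrightarrow> capacity_kernel L \<eta> q s = - left_loop_value (capacity_integrand q z) (-1/2, -1, 1)"
    unfolding capacity_kernel_def e by (simp only: fox_H_eq_left_loop[OF z])
  show "q > 2 \<Longrightarrow> capacity_kernel L \<eta> q s = - left_loop_value (capacity_integrand (- q) (1 / z)) (1 / (2 * q), -1, 1)"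
    unfolding capacity_kernel_def e by (simp only: fox_H_eq_right_loop[OF z])
qed

lemma line_value_bound:
  assumes q: "\<bar>q\<bar> \<le> 2"
  obtains K where "K > 0" "\<And>z. z > 0 \<Longrightarrow> norm (line_value (capacity_integrand q z) (-1/8)) \<le> K * (1 + ln (1 + z))"
proof -
  obtain K where K: "K > 0"
    and int: "\<And>c z. -1/8 \<le> c \<Longrightarrow> c < 0 \<Longrightarrow> integrable lborel (\<lambda>y. capacity_integrand q z (Complex c y))"
    and le: "\<And>c z. -1/8 \<le> c \<Longrightarrow> c < 0 \<Longrightarrow> norm (LINT y|lborel. capacity_integrand q z (Complex c y)) \<le> K / \<bar>c\<bar> * exp (- c * ln z)"
    using capacity_integrand_line_bound[OF q] by blast
  show ?thesis
  proof (rule that[of "8 * K * exp 1"])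
    fix z :: real assume z: "z > 0"
    \<comment> \<open>The abscissa balances \<open>1 / \<bar>c\<bar>\<close>, the effect of the double pole at 0, against \<open>z\<^bsup>-c\<^esup>\<close>.\<close>
    define c where "c = (if z \<ge> 1 then - 1 / (8 * (1 + ln z)) else - 1 / 8)"
    have c: "-1/8 \<le> c" "c < 0" and b: "1 / \<bar>c\<bar> \<le> 8 * (1 + ln (1 + z))" and e: "exp (- c * ln z) \<le> exp 1"
    proof -
      show "-1/8 \<le> c"
      proof (cases "z \<ge> 1")
        case True
        then have "1 / (8 * (1 + ln z)) \<le> 1 / (8 * 1)" by (intro frac_le) auto
        then show ?thesis using True by (simp add: c_def)
      qed (simp add: c_def)
      show "c < 0" by (auto simp: c_def field_simps add_pos_nonneg)
      show "1 / \<bar>c\<bar> \<le> 8 * (1 + ln (1 + z))"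
      proof (cases "z \<ge> 1")
        case True
        define l where "l = ln z"
        have "0 \<le> l" using True by (simp add: l_def)
        then have "1 / \<bar>c\<bar> = 8 * (1 + ln z)" using True by (simp add: c_def flip: l_def)
        also have "\<dots> \<le> 8 * (1 + ln (1 + z))" using True by simp
        finally show ?thesis .
      next
        case False
        then have "1 / \<bar>c\<bar> = 8" by (simp add: c_def)
        also have "\<dots> \<le> 8 * (1 + ln (1 + z))" using z by simp
        finally show ?thesis .
      qed
      have "- c * ln z \<le> 1"
      proof (cases "z \<ge> 1")
        case True
        define l where "l = ln z"
        have "0 \<le> l" using True by (simp add: l_def)
        then show ?thesis using True by (simp add: c_def field_simps flip: l_def)
      next
        case False
        then have l: "ln z \<le> 0" using z by simp
        show ?thesis using False by (simp add: c_def) (use l in linarith)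
      qed
      then show "exp (- c * ln z) \<le> exp 1" by simp
    qed
    have "\<bar>q * c\<bar> \<le> 2 * (1/8)" unfolding abs_mult using q c by (intro mult_mono) auto
    moreover have "\<bar>q * (-1/8)\<bar> \<le> 2 * (1/8)" unfolding abs_mult using q by (intro mult_mono) auto
    ultimately have "\<bar>q\<bar> < 2 \<or> \<bar>q\<bar> = 2 \<and> 1 + q * c \<ge> 0 \<and> 1 + q * (-1/8) \<ge> 0"
      using q by (auto simp: abs_le_iff)
    then have "(LINT y|lborel. capacity_integrand q z (Complex (-1/8) y)) = (LINT y|lborel. capacity_integrand q z (Complex c y))"
      by (rule capacity_integrand_line_shift) (use c int in auto)
    then have "norm (line_value (capacity_integrand q z) (-1/8)) = 1 / (2 * pi) * norm (LINT y|lborel. capacity_integrand q z (Complex c y))"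
      by (simp add: line_value_def norm_mult norm_divide)
    also have "\<dots> \<le> 1 * (K / \<bar>c\<bar> * exp (- c * ln z))"
      using pi_gt3 le[OF c] by (intro mult_mono) auto
    also have "\<dots> = K * (1 / \<bar>c\<bar>) * exp (- c * ln z)" by simp
    also have "\<dots> \<le> K * (8 * (1 + ln (1 + z))) * exp 1"
      using K b e z by (intro mult_mono) (auto intro!: mult_nonneg_nonneg add_nonneg_nonneg)
    finally show "norm (line_value (capacity_integrand q z) (-1/8)) \<le> 8 * K * exp 1 * (1 + ln (1 + z))" by (simp add: mult_ac)
  qed (use K in auto)
qed

context
  fixes L :: nat and \<eta> q z1 :: real
  assumes L: "L \<ge> 1" and \<eta>: "\<eta> > 0"
  defines "z1 \<equiv> \<eta> / real L powr q"
begin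

lemma z1_pos: "z1 > 0"
  using L \<eta> by (simp add: z1_def)

lemmas kernel = capacity_kernel_eq[OF _ \<eta> L, where q = q, folded z1_def]

lemma measurable_capacity_kernel:
  "(\<lambda>s. indicat_real {0<..} s *\<^sub>R capacity_kernel L \<eta> q s) \<in> borel_measurable borel"
proof -
  have *: ?thesis if "k \<in> borel_measurable borel" "\<And>s. s > 0 \<Longrightarrow> capacity_kernel L \<eta> q s = k s" for k
  proof -
    have "indicat_real {0<..} s *\<^sub>R capacity_kernel L \<eta> q s = indicat_real {0<..} s *\<^sub>R k s" for s
      using that(2)[of s] by (cases "s > 0") auto
    then have "(\<lambda>s. indicat_real {0<..} s *\<^sub>R capacity_kernel L \<eta> q s) = (\<lambda>s. indicat_real {0<..} s *\<^sub>R k s)"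
      by (rule ext)
    moreover have "(\<lambda>s. indicat_real {0<..} s *\<^sub>R k s) \<in> borel_measurable borel"
      using that(1) by simp
    ultimately show ?thesis by (simp only:)
  qed
  consider "\<bar>q\<bar> \<le> 2" | "q < -2" | "q > 2" by linarith
  then show ?thesis
  proof cases
    case 1
    show ?thesis
      by (rule *[OF _ kernel(1)[OF _ 1]]) (use 1 in \<open>simp_all add: line_value_def\<close>)
  next
    case 2
    show ?thesis
      by (rule *[OF _ kernel(2)[OF _ 2]]) (use measurable_left_loop in \<open>auto intro!: borel_measurable_uminus\<close>)
  next
    case 3
    have e: "1 / (z1 * s powr (- q)) = (1 / z1) * s powr (- (- q))" for s
      by (simp add: powr_minus divide_inverse)
    show ?thesis
      by (rule *[OF _ kernel(3)[OF _ 3, unfolded e]])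
        (use measurable_left_loop[of "- q" "1 / z1"] in \<open>auto intro!: borel_measurable_uminus\<close>)
  qed
qed

lemma Laplace_capacity_kernel_line:
  assumes q: "\<bar>q\<bar> \<le> 2" and \<sigma>: "\<sigma> > 0"
  shows "set_integrable lborel {0<..} (\<lambda>s. of_real (\<sigma> * exp (- s * \<sigma>)) * capacity_kernel L \<eta> q s)"
    and "(LINT s:{0<..}|lborel. of_real (\<sigma> * exp (- s * \<sigma>)) * capacity_kernel L \<eta> q s) = - of_real (ln (1 + z1 * \<sigma> powr q))"
proof -
  note int = integrable_capacity_integrand_line[OF q]
  define F where "F = (\<lambda>s. LINT y:UNIV|lborel. capacity_integrand q (z1 * s powr (- q)) (Complex (-1/8) y))"
  have pos: "q * Re (Complex (-1/8) y) > -1" for y using q by simp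
  have i: "set_integrable lborel UNIV (\<lambda>y. of_real (Gamma (1 + q * Re (Complex (-1/8) y))) * capacity_integrand q (z1 * \<sigma> powr q) (Complex (-1/8) y))"
    using int by (simp add: set_integrable_def)
  have A: "set_integrable lborel {0<..} (\<lambda>s. of_real (\<sigma> * exp (- s * \<sigma>)) * F s)"
    unfolding F_def by (rule Laplace_transform_capacity_integrand(1)[OF _ _ \<sigma> z1_pos pos i]) auto
  have B: "(LINT s:{0<..}|lborel. of_real (\<sigma> * exp (- s * \<sigma>)) * F s) = (LINT y:UNIV|lborel. capacity_integrand 0 (z1 * \<sigma> powr q) (Complex (-1/8) y))"
    unfolding F_def by (rule Laplace_transform_capacity_integrand(2)[OF _ _ \<sigma> z1_pos pos i]) auto
  have k: "capacity_kernel L \<eta> q s = - (1 / (2 * of_real pi)) * F s" if "s > 0" for s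
    unfolding kernel(1)[OF that q] F_def line_value_def set_lebesgue_integral_def by simp
  have cong: "indicat_real {0<..} s *\<^sub>R (of_real (\<sigma> * exp (- s * \<sigma>)) * capacity_kernel L \<eta> q s) =
      (- (1 / (2 * of_real pi))) * (indicat_real {0<..} s *\<^sub>R (of_real (\<sigma> * exp (- s * \<sigma>)) * F s))" for s
    using k[of s] by (cases "s > 0") auto
  show "set_integrable lborel {0<..} (\<lambda>s. of_real (\<sigma> * exp (- s * \<sigma>)) * capacity_kernel L \<eta> q s)"
    unfolding set_integrable_def cong by (rule integrable_mult_right) (rule A[unfolded set_integrable_def])
  have "(LINT s:{0<..}|lborel. of_real (\<sigma> * exp (- s * \<sigma>)) * capacity_kernel L \<eta> q s) =
      (- (1 / (2 * of_real pi))) * (LINT y|lborel. capacity_integrand 0 (z1 * \<sigma> powr q) (Complex (-1/8) y))"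
    using B unfolding set_lebesgue_integral_def cong integral_mult_right_zero indicator_UNIV scaleR_one by (simp only:)
  also have "\<dots> = - line_value (capacity_integrand 0 (z1 * \<sigma> powr q)) (-1/8)" by (simp add: line_value_def)
  also have "\<dots> = - of_real (ln (1 + z1 * \<sigma> powr q))"
    using z1_pos \<sigma> by (subst line_value_log_neg) auto
  finally show "(LINT s:{0<..}|lborel. of_real (\<sigma> * exp (- s * \<sigma>)) * capacity_kernel L \<eta> q s) = - of_real (ln (1 + z1 * \<sigma> powr q))" .
qed

lemma Laplace_capacity_kernel_bound:
  assumes q: "\<bar>q\<bar> \<le> 2"
  shows "\<exists>K>0. \<forall>\<sigma>>0. (LINT s:{0<..}|lborel. \<sigma> * exp (- s * \<sigma>) * norm (capacity_kernel L \<eta> q s)) \<le> K * (1 + ln (1 + z1 * \<sigma> powr q))"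
proof -
  obtain K where K: "K > 0" "\<And>z. z > 0 \<Longrightarrow> norm (line_value (capacity_integrand q z) (-1/8)) \<le> K * (1 + ln (1 + z))"
    using line_value_bound[OF q] by blast
  have a: "- q / 4 > -1" using q by (simp add: abs_le_iff)
  have G: "Gamma (1 - q / 4) > 0" using a by (intro Gamma_real_pos) auto
  define K' where "K' = K + 4 * K * Gamma (1 - q / 4)"
  show ?thesis
  proof (rule exI[of _ K'], intro conjI allI impI)
    show "K' > 0" using K G by (simp add: K'_def add_pos_pos)
    fix \<sigma> :: real assume \<sigma>: "\<sigma> > 0"
    define x where "x = z1 * \<sigma> powr q"
    have x: "x > 0" using z1_pos \<sigma> by (simp add: x_def)
    let ?b = "\<lambda>s. K * (1 + ln (1 + x)) * (\<sigma> * exp (- s * \<sigma>) * exp (0 * ln s)) +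
        4 * K * exp (- q / 4 * ln \<sigma>) * (\<sigma> * exp (- s * \<sigma>) * exp (- q / 4 * ln s))"
    have le: "\<sigma> * exp (- s * \<sigma>) * norm (capacity_kernel L \<eta> q s) \<le> ?b s" if s: "s > 0" for s
    proof -
      define v where "v = (s * \<sigma>) powr (- q)"
      have v: "v > 0" using s \<sigma> by (simp add: v_def)
      have z: "z1 * s powr (- q) = x * v"
        using s \<sigma> by (simp add: x_def v_def powr_mult powr_minus field_simps)
      have "1 + x * v \<le> (1 + x) * (1 + v)" using x v by (simp add: algebra_simps)
      then have "ln (1 + x * v) \<le> ln ((1 + x) * (1 + v))" using x v by (simp add: add_pos_pos)
      also have "\<dots> = ln (1 + x) + ln (1 + v)" using x v by (simp add: ln_mult)
      also have "ln (1 + v) \<le> 4 * v powr (1/4)"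
      proof -
        have p: "0 < 1 + v powr (1/4)" by (simp add: add_pos_nonneg)
        have "1 + v \<le> (1 + v powr (1/4)) ^ 4"
        proof -
          have "v = (v powr (1/4)) ^ 4" using v by (simp add: powr_powr flip: powr_realpow)
          moreover have "1 + r ^ 4 \<le> (1 + r) ^ 4" if "r \<ge> 0" for r :: real
            using that by (simp add: power4_eq_xxxx algebra_simps)
          ultimately show ?thesis by (metis powr_ge_zero)
        qed
        then have "ln (1 + v) \<le> ln ((1 + v powr (1/4)) ^ 4)" using v p by (subst ln_le_cancel_iff) auto
        also have "\<dots> = 4 * ln (1 + v powr (1/4))" using p by (simp add: ln_realpow)
        also have "\<dots> \<le> 4 * v powr (1/4)" using ln_add_one_self_le_self[of "v powr (1/4)"] by simp
        finally show ?thesis .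
      qed
      also have "v powr (1/4) = exp (- q / 4 * ln \<sigma>) * exp (- q / 4 * ln s)"
        using s \<sigma> by (simp add: v_def powr_def ln_mult algebra_simps flip: exp_add)
      finally have l: "ln (1 + x * v) \<le> ln (1 + x) + 4 * (exp (- q / 4 * ln \<sigma>) * exp (- q / 4 * ln s))" by simp
      have "norm (capacity_kernel L \<eta> q s) \<le> K * (1 + ln (1 + x * v))"
        unfolding kernel(1)[OF s q] norm_minus_cancel z using x v by (intro K) auto
      also have "\<dots> \<le> K * (1 + (ln (1 + x) + 4 * (exp (- q / 4 * ln \<sigma>) * exp (- q / 4 * ln s))))"
        using l K by (intro mult_left_mono add_left_mono) auto
      finally have "\<sigma> * exp (- s * \<sigma>) * norm (capacity_kernel L \<eta> q s) \<le>
          \<sigma> * exp (- s * \<sigma>) * (K * (1 + (ln (1 + x) + 4 * (exp (- q / 4 * ln \<sigma>) * exp (- q / 4 * ln s)))))"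
        using \<sigma> by (intro mult_left_mono) auto
      also have "\<dots> = ?b s" by (simp add: algebra_simps)
      finally show ?thesis .
    qed
    have i0: "set_integrable lborel {0<..} (\<lambda>s. K * (1 + ln (1 + x)) * (\<sigma> * exp (- s * \<sigma>) * exp (0 * ln s)))"
      using \<sigma> by (intro set_integrable_mult_right Gamma_Laplace_integral_real) auto
    have i1: "set_integrable lborel {0<..} (\<lambda>s. 4 * K * exp (- q / 4 * ln \<sigma>) * (\<sigma> * exp (- s * \<sigma>) * exp (- q / 4 * ln s)))"
      using \<sigma> a by (intro set_integrable_mult_right Gamma_Laplace_integral_real) auto
    have "(LINT s:{0<..}|lborel. \<sigma> * exp (- s * \<sigma>) * norm (capacity_kernel L \<eta> q s)) \<le> (LINT s:{0<..}|lborel. ?b s)"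
      unfolding set_lebesgue_integral_def
    proof (rule integral_mono')
      show "integrable lborel (\<lambda>s. indicat_real {0<..} s *\<^sub>R ?b s)"
        using set_integral_add(1)[OF i0 i1] unfolding set_integrable_def .
      show "indicat_real {0<..} s *\<^sub>R (\<sigma> * exp (- s * \<sigma>) * norm (capacity_kernel L \<eta> q s)) \<le> indicat_real {0<..} s *\<^sub>R ?b s" for s
        using le[of s] by (cases "s > 0") auto
      show "0 \<le> indicat_real {0<..} s *\<^sub>R ?b s" for s
        using K x \<sigma> by (auto intro!: mult_nonneg_nonneg add_nonneg_nonneg)
    qed
    also have "\<dots> = K * (1 + ln (1 + x)) + 4 * K * Gamma (1 - q / 4)"
    proof -
      have "(LINT s:{0<..}|lborel. \<sigma> * exp (- s * \<sigma>) * exp (0 * ln s)) = 1"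
        using Gamma_Laplace_integral_real(2)[of 0 \<sigma>] \<sigma> by simp
      moreover have "exp (- q / 4 * ln \<sigma>) * (LINT s:{0<..}|lborel. \<sigma> * exp (- s * \<sigma>) * exp (- q / 4 * ln s)) = Gamma (1 - q / 4)"
        unfolding Gamma_Laplace_integral_real(2)[OF a \<sigma>] by (simp add: exp_minus)
      ultimately show ?thesis unfolding set_integral_add(2)[OF i0 i1] set_integral_mult_right by (simp add: mult.assoc)
    qed
    also have "\<dots> \<le> K * (1 + ln (1 + x)) + 4 * K * Gamma (1 - q / 4) * (1 + ln (1 + x))"
      using K G x by simp
    also have "\<dots> = K' * (1 + ln (1 + x))" by (simp add: K'_def distrib_right)
    finally show "(LINT s:{0<..}|lborel. \<sigma> * exp (- s * \<sigma>) * norm (capacity_kernel L \<eta> q s)) \<le> K' * (1 + ln (1 + z1 * \<sigma> powr q))"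
      unfolding x_def .
  qed
qed

lemma Laplace_capacity_kernel_large:
  assumes q: "\<bar>q\<bar> > 2"
  shows "\<exists>R>0. \<forall>\<sigma>>R. set_integrable lborel {0<..} (\<lambda>s. of_real (\<sigma> * exp (- s * \<sigma>)) * capacity_kernel L \<eta> q s) \<and>
    (LINT s:{0<..}|lborel. of_real (\<sigma> * exp (- s * \<sigma>)) * capacity_kernel L \<eta> q s) = - of_real (ln (1 + z1 * \<sigma> powr q))"
proof -
  have ex: "\<exists>R>0. \<forall>\<sigma>>R. Z * \<sigma> powr r < 1" if "r < 0" for Z r :: real
  proof -
    have "((\<lambda>\<sigma>. Z * \<sigma> powr r) \<longlongrightarrow> 0) at_top" using that by real_asymp
    then have "eventually (\<lambda>\<sigma>. Z * \<sigma> powr r < 1) at_top" by (rule order_tendstoD) simp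
    then obtain R where "\<And>\<sigma>. \<sigma> \<ge> R \<Longrightarrow> Z * \<sigma> powr r < 1" unfolding eventually_at_top_linorder by blast
    then show ?thesis by (intro exI[of _ "max R 1"]) auto
  qed
  have fin: ?thesis
    if r: "r < 0" and Z: "Z > 0" and c: "c \<notin> \<int>" "1 + r * c > 0"
      and k: "\<And>s. s > 0 \<Longrightarrow> capacity_kernel L \<eta> q s = - left_loop_value (capacity_integrand r (Z * s powr (- r))) (c, -1, 1)"
      and v: "\<And>\<sigma>. \<sigma> > 0 \<Longrightarrow> line_value (capacity_integrand 0 (Z * \<sigma> powr r)) c = of_real (ln (1 + z1 * \<sigma> powr q))" for r Z c
  proof -
    obtain R where R: "R > 0" "\<And>\<sigma>. \<sigma> > R \<Longrightarrow> Z * \<sigma> powr r < 1" using ex[OF r] by blast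
    show ?thesis
    proof (intro exI[of _ R] conjI allI impI)
      fix \<sigma> assume "R < \<sigma>"
      with R have \<sigma>: "\<sigma> > 0" and lt: "Z * \<sigma> powr r < 1" by auto
      note LL = Laplace_transform_left_loop[OF r c \<sigma> Z lt]
      have cong: "indicat_real {0<..} s *\<^sub>R (of_real (\<sigma> * exp (- s * \<sigma>)) * capacity_kernel L \<eta> q s) =
        - (indicat_real {0<..} s *\<^sub>R (of_real (\<sigma> * exp (- s * \<sigma>)) * left_loop_value (capacity_integrand r (Z * s powr (- r))) (c, -1, 1)))" for s
        using k[of s] by (cases "s > 0") auto
      show "set_integrable lborel {0<..} (\<lambda>s. of_real (\<sigma> * exp (- s * \<sigma>)) * capacity_kernel L \<eta> q s)"
        unfolding set_integrable_def cong using LL(1) by (intro integrable_minus) (simp add: set_integrable_def)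
      show "(LINT s:{0<..}|lborel. of_real (\<sigma> * exp (- s * \<sigma>)) * capacity_kernel L \<eta> q s) = - of_real (ln (1 + z1 * \<sigma> powr q))"
        using LL(2) unfolding v[OF \<sigma>] set_lebesgue_integral_def cong integral_minus by simp
    qed (rule R)
  qed
  consider "q < -2" | "q > 2" using q by linarith
  then show ?thesis
  proof cases
    case 1
    show ?thesis
    proof (rule fin[of q z1 "-1/2"])
      show "line_value (capacity_integrand 0 (z1 * \<sigma> powr q)) (- 1 / 2) = of_real (ln (1 + z1 * \<sigma> powr q))" if "\<sigma> > 0" for \<sigma>
        using that z1_pos by (intro line_value_log_neg) auto
    qed (use 1 z1_pos half_notin_Ints kernel(2)[OF _ 1] in auto)
  next
    case 2
    have e: "1 / (z1 * s powr (- q)) = (1 / z1) * s powr (- (- q))" for s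
      by (simp add: powr_minus divide_inverse)
    show ?thesis
    proof (rule fin[of "- q" "1 / z1" "1 / (2 * q)"])
      show "line_value (capacity_integrand 0 (1 / z1 * \<sigma> powr (- q))) (1 / (2 * q)) = of_real (ln (1 + z1 * \<sigma> powr q))" if "\<sigma> > 0" for \<sigma>
      proof -
        have "1 / (1 / z1 * \<sigma> powr (- q)) = z1 * \<sigma> powr q" by (simp add: powr_minus divide_inverse)
        then show ?thesis using that z1_pos 2 by (subst line_value_log_pos) auto
      qed
      show "capacity_kernel L \<eta> q s = - left_loop_value (capacity_integrand (- q) (1 / z1 * s powr (- (- q)))) (1 / (2 * q), -1, 1)" if "s > 0" for s
        using kernel(3)[OF that 2] unfolding e .
      show "1 / (2 * q) \<notin> \<int>" using 2 by (intro notin_Ints_unit) auto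
    qed (use 2 z1_pos in \<open>auto simp: field_simps\<close>)
  qed
qed

lemma Laplace_capacity_kernel:
  assumes \<sigma>: "\<sigma> > 0"
    and int: "set_integrable lborel {0<..} (\<lambda>s. of_real (\<sigma> * exp (- s * \<sigma>)) * capacity_kernel L \<eta> q s)"
  shows "(LINT s:{0<..}|lborel. of_real (\<sigma> * exp (- s * \<sigma>)) * capacity_kernel L \<eta> q s) = - of_real (ln (1 + z1 * \<sigma> powr q))"
proof (cases "\<bar>q\<bar> \<le> 2")
  case True
  then show ?thesis by (rule Laplace_capacity_kernel_line(2)[OF _ \<sigma>])
next
  case False
  define g where "g = (\<lambda>s. indicat_real {0<..} s *\<^sub>R capacity_kernel L \<eta> q s)"
  have [measurable]: "g \<in> borel_measurable borel" unfolding g_def by (rule measurable_capacity_kernel)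
  define X where "X = (\<lambda>s::real. max s 0)"
  have [measurable]: "X \<in> borel_measurable borel" unfolding X_def by measurable
  define D where "D = (\<lambda>w. LINT s|lborel. g s * exp (- w * of_real (X s)))"
  have tr: "indicat_real {0<..} s *\<^sub>R (of_real (\<tau> * exp (- s * \<tau>)) * capacity_kernel L \<eta> q s) =
      of_real \<tau> * (g s * exp (- of_real \<tau> * of_real (X s)))" for \<tau> s
    by (cases "s > 0") (auto simp: g_def X_def mult_ac simp flip: exp_of_real)
  have DL: "(LINT s:{0<..}|lborel. of_real (\<tau> * exp (- s * \<tau>)) * capacity_kernel L \<eta> q s) = of_real \<tau> * D (of_real \<tau>)" for \<tau>
    unfolding set_lebesgue_integral_def tr D_def by simp
  have int': "integrable lborel (\<lambda>s. g s * exp (- of_real \<sigma> * of_real (X s)))"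
  proof -
    have "integrable lborel (\<lambda>s. of_real (1 / \<sigma>) * (of_real \<sigma> * (g s * exp (- of_real \<sigma> * of_real (X s)))))"
      using int unfolding set_integrable_def tr by (rule integrable_mult_right)
    moreover have "complex_of_real (1 / \<sigma>) * (of_real \<sigma> * x) = x" for x using \<sigma> by simp
    ultimately show ?thesis by (simp only:)
  qed
  have hol: "(D has_field_derivative - (LINT s|lborel. g s * of_real (X s) * exp (- w * of_real (X s)))) (at w)" if "Re w > \<sigma>" for w
    unfolding D_def by (rule exp_transform_has_field_derivative(2)[OF _ _ _ int' that]) (auto simp: X_def)
  obtain R where R: "R > 0" "\<And>\<tau>. \<tau> > R \<Longrightarrow> of_real \<tau> * D (of_real \<tau>) = - of_real (ln (1 + z1 * \<tau> powr q))"
    using Laplace_capacity_kernel_large False unfolding DL by (metis not_le)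
  define H where "H = {w. \<sigma> < Re w}"
  define k where "k = (\<lambda>w. 1 + of_real z1 * exp (of_real q * Ln w))"
  have Hn: "w \<notin> \<real>\<^sub>\<le>\<^sub>0" if "w \<in> H" for w using that \<sigma> by (auto simp: H_def complex_nonpos_Reals_iff)
  have kc: "k holomorphic_on H" unfolding k_def by (intro holomorphic_intros) (use Hn in auto)
  define S0 where "S0 = H \<inter> k -` (- \<real>\<^sub>\<le>\<^sub>0)"
  have H: "open H" unfolding H_def by (rule open_halfspace_Re_gt)
  have S0: "open S0" unfolding S0_def
    by (rule continuous_open_preimage[OF holomorphic_on_imp_continuous_on[OF kc] H]) (simp add: open_Compl)
  have kr: "k (of_real \<tau>) = of_real (1 + z1 * \<tau> powr q)" if "\<tau> > 0" for \<tau>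
  proof -
    have "exp (of_real q * Ln (of_real \<tau>)) = complex_of_real (\<tau> powr q)"
      using that by (simp add: Ln_of_real powr_def flip: exp_of_real)
    then show ?thesis by (simp add: k_def)
  qed
  have kp: "1 + z1 * \<tau> powr q > 0" for \<tau> using z1_pos by (simp add: add_pos_nonneg)
  have ray: "of_real ` {\<sigma><..} \<subseteq> S0"
  proof
    fix w assume "w \<in> complex_of_real ` {\<sigma><..}"
    then obtain \<tau> where \<tau>: "w = of_real \<tau>" "\<tau> > \<sigma>" by auto
    have "k w \<notin> \<real>\<^sub>\<le>\<^sub>0" unfolding \<tau>(1) using kr[of \<tau>] kp[of \<tau>] \<tau> \<sigma> by (simp add: complex_nonpos_Reals_iff)
    then show "w \<in> S0" using \<tau> by (simp add: S0_def H_def)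
  qed
  define \<xi> where "\<xi> = max R \<sigma> + 1"
  define S where "S = connected_component_set S0 (of_real \<xi>)"
  have \<xi>: "\<xi> > \<sigma>" "\<xi> > R" by (auto simp: \<xi>_def)
  have rayS: "of_real ` {\<sigma><..} \<subseteq> S"
    unfolding S_def by (rule connected_component_maximal[OF _ _ ray]) (use \<xi> in \<open>auto intro!: connected_continuous_image continuous_intros\<close>)
  have SS: "S \<subseteq> S0" unfolding S_def by (rule connected_component_subset)
  define \<phi> where "\<phi> = (\<lambda>w. w * D w + Ln (k w))"
  have D: "D holomorphic_on S0"
    unfolding holomorphic_on_def field_differentiable_def
  proof
    fix w assume "w \<in> S0"
    then have "\<sigma> < Re w" by (simp add: S0_def H_def)
    from has_field_derivative_at_within[OF hol[OF this]]
    show "\<exists>f'. (D has_field_derivative f') (at w within S0)" by blast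
  qed
  have \<phi>: "\<phi> holomorphic_on S"
  proof (rule holomorphic_on_subset[OF _ SS])
    show "\<phi> holomorphic_on S0"
      unfolding \<phi>_def using kc D by (intro holomorphic_intros) (auto simp: S0_def intro: holomorphic_on_subset)
  qed
  have \<phi>r: "\<phi> (of_real \<tau>) = of_real \<tau> * D (of_real \<tau>) + of_real (ln (1 + z1 * \<tau> powr q))" if "\<tau> > 0" for \<tau>
    unfolding \<phi>_def kr[OF that] Ln_of_real[OF kp] ..
  have zero: "\<phi> (of_real \<tau>) = 0" if \<tau>: "\<tau> > \<sigma>" for \<tau>
  proof (rule analytic_continuation[OF \<phi>, of "of_real ` {max R \<sigma><..}" "of_real \<xi>"])
    show "open S" "connected S" unfolding S_def using S0 by (auto intro: open_connected_component)
    show "of_real ` {max R \<sigma><..} \<subseteq> S" using rayS by auto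
    show "of_real \<xi> \<in> S" "of_real \<tau> \<in> S" using rayS \<xi> \<tau> by auto
    show "complex_of_real \<xi> islimpt of_real ` {max R \<sigma><..}"
    proof (rule connected_imp_perfect)
      show "connected (complex_of_real ` {max R \<sigma><..})" by (intro connected_continuous_image continuous_intros) auto
      show "complex_of_real \<xi> \<in> of_real ` {max R \<sigma><..}" by (rule imageI) (simp add: \<xi>_def)
      show "complex_of_real ` {max R \<sigma><..} \<noteq> {a}" for a
      proof
        assume "complex_of_real ` {max R \<sigma><..} = {a}"
        moreover have "complex_of_real \<xi> \<in> of_real ` {max R \<sigma><..}" "complex_of_real (\<xi> + 1) \<in> of_real ` {max R \<sigma><..}"
          by (rule imageI, simp add: \<xi>_def)+
        ultimately have "complex_of_real \<xi> = complex_of_real (\<xi> + 1)" by (metis singletonD)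
        then show False by simp
      qed
    qed
    show "\<phi> z = 0" if "z \<in> of_real ` {max R \<sigma><..}" for z
      using that \<sigma> R(2) by (auto simp: \<phi>r)
  qed
  define \<tau> where "\<tau> = (\<lambda>n. \<sigma> + 1 / real (Suc n))"
  have \<tau>: "\<tau> n > \<sigma>" "\<tau> n > 0" for n using \<sigma> by (auto simp: \<tau>_def add_pos_pos)
  have \<tau>lim: "\<tau> \<longlonglongrightarrow> \<sigma>" unfolding \<tau>_def by real_asymp
  have Dlim: "(\<lambda>n. D (of_real (\<tau> n))) \<longlonglongrightarrow> D (of_real \<sigma>)"
    unfolding D_def
  proof (rule integral_dominated_convergence[where w = "\<lambda>s. norm (g s * exp (- of_real \<sigma> * of_real (X s)))"])
    show "AE s in lborel. (\<lambda>n. g s * exp (- of_real (\<tau> n) * of_real (X s))) \<longlonglongrightarrow> g s * exp (- of_real \<sigma> * of_real (X s))"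
      using \<tau>lim by (intro AE_I2 tendsto_intros)
    show "AE s in lborel. norm (g s * exp (- of_real (\<tau> n) * of_real (X s))) \<le> norm (g s * exp (- of_real \<sigma> * of_real (X s)))" for n
    proof (rule AE_I2)
      fix s :: real
      have "\<sigma> * X s \<le> \<tau> n * X s" using \<tau>[of n] by (intro mult_right_mono) (auto simp: X_def)
      then have "norm (g s) * exp (- (\<tau> n * X s)) \<le> norm (g s) * exp (- (\<sigma> * X s))" by (intro mult_left_mono) auto
      then show "norm (g s * exp (- of_real (\<tau> n) * of_real (X s))) \<le> norm (g s * exp (- of_real \<sigma> * of_real (X s)))"
        by (simp add: norm_mult)
    qed
  qed (use int' in \<open>auto intro: integrable_norm\<close>)
  have "(\<lambda>n. of_real (\<tau> n) * D (of_real (\<tau> n)) + of_real (ln (1 + z1 * \<tau> n powr q))) \<longlonglongrightarrow>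
      of_real \<sigma> * D (of_real \<sigma>) + of_real (ln (1 + z1 * \<sigma> powr q))"
    using \<sigma> kp[of \<sigma>] by (intro tendsto_intros \<tau>lim Dlim) auto
  moreover have "of_real (\<tau> n) * D (of_real (\<tau> n)) + complex_of_real (ln (1 + z1 * \<tau> n powr q)) = 0" for n
    using zero[OF \<tau>(1)] \<phi>r[OF \<tau>(2)] by simp
  ultimately have "of_real \<sigma> * D (of_real \<sigma>) + of_real (ln (1 + z1 * \<sigma> powr q)) = 0"
    by (simp add: LIMSEQ_const_iff)
  then show ?thesis unfolding DL by (simp add: eq_neg_iff_add_eq_0)
qed

end

section \<open>Moment generating functions and the expectation\<close>

lemma mgf_derivative:
  assumes "prob_space M" and [measurable]: "X \<in> borel_measurable M"
    and X: "\<And>\<omega>. \<omega> \<in> space M \<Longrightarrow> X \<omega> > 0" and s: "s > 0"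
  shows "integrable M (\<lambda>\<omega>. X \<omega> * exp (- s * X \<omega>))"
    and "(mgf M X has_real_derivative - (\<integral>\<omega>. X \<omega> * exp (- s * X \<omega>) \<partial>M)) (at s)"
proof -
  interpret prob_space M by fact
  define F where "F = (\<lambda>w. \<integral>\<omega>. 1 * exp (- w * complex_of_real (X \<omega>)) \<partial>M)"
  have X0: "0 \<le> X \<omega>" if "\<omega> \<in> space M" for \<omega> using X[OF that] by simp
  have i: "integrable M (\<lambda>\<omega>. 1 * exp (- complex_of_real 0 * of_real (X \<omega>)))" by simp
  have w: "Re (complex_of_real s) > 0" using s by simp
  have D: "integrable M (\<lambda>\<omega>. 1 * of_real (X \<omega>) * exp (- complex_of_real s * of_real (X \<omega>)))"
    "((\<lambda>w. \<integral>\<omega>. 1 * exp (- w * complex_of_real (X \<omega>)) \<partial>M) has_field_derivative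
      - (\<integral>\<omega>. 1 * of_real (X \<omega>) * exp (- complex_of_real s * of_real (X \<omega>)) \<partial>M)) (at (of_real s))"
    by (rule exp_transform_has_field_derivative[OF _ _ X0 i w]; simp)+
  have e: "exp (- complex_of_real t * of_real (X \<omega>)) = of_real (exp (- t * X \<omega>))" for t \<omega>
    by (simp flip: exp_of_real)
  have e2: "complex_of_real (X \<omega>) * of_real (exp (- s * X \<omega>)) = of_real (X \<omega> * exp (- s * X \<omega>))" for \<omega>
    by simp
  have "integrable M (\<lambda>\<omega>. complex_of_real (X \<omega> * exp (- s * X \<omega>)))"
    using D(1) by (simp only: mult_1 e e2)
  then show "integrable M (\<lambda>\<omega>. X \<omega> * exp (- s * X \<omega>))" by (simp only: complex_of_real_integrable_eq)
  have Fr: "F (of_real t) = of_real (mgf M X t)" for t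
    unfolding F_def mult_1 e mgf_def by (rule integral_complex_of_real)
  have "(F has_field_derivative - of_real (\<integral>\<omega>. X \<omega> * exp (- s * X \<omega>) \<partial>M)) (at (of_real s))"
    using D(2)[folded F_def] by (simp only: mult_1 e e2 integral_complex_of_real)
  then have "((\<lambda>t. F (of_real t)) has_vector_derivative - of_real (\<integral>\<omega>. X \<omega> * exp (- s * X \<omega>) \<partial>M)) (at s)"
    by (rule has_vector_derivative_real_field)
  then have "((\<lambda>t. Re (F (of_real t))) has_vector_derivative Re (- of_real (\<integral>\<omega>. X \<omega> * exp (- s * X \<omega>) \<partial>M))) (at s)"
    by (rule bounded_linear.has_vector_derivative[OF bounded_linear_Re])
  then show "(mgf M X has_real_derivative - (\<integral>\<omega>. X \<omega> * exp (- s * X \<omega>) \<partial>M)) (at s)"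
    unfolding Fr has_real_derivative_iff_has_vector_derivative by simp
qed

lemma mgf_sum_indep:
  fixes Y :: "nat \<Rightarrow> 'a \<Rightarrow> real"
  assumes "prob_space M" and indep: "prob_space.indep_vars M (\<lambda>_. borel) Y I" and I: "finite I"
    and Y: "\<And>l \<omega>. l \<in> I \<Longrightarrow> \<omega> \<in> space M \<Longrightarrow> Y l \<omega> > 0" and s: "s > 0"
  shows "mgf M (\<lambda>\<omega>. \<Sum>l\<in>I. Y l \<omega>) s = (\<Prod>l\<in>I. mgf M (Y l) s)"
proof -
  interpret prob_space M by fact
  have [measurable]: "Y l \<in> borel_measurable M" if "l \<in> I" for l
    using indep that by (auto simp: indep_vars_def)
  have "indep_vars (\<lambda>_. borel) (\<lambda>l \<omega>. exp (- s * Y l \<omega>)) I"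
    by (rule indep_vars_compose2[OF indep]) measurable
  moreover have "integrable M (\<lambda>\<omega>. exp (- s * Y l \<omega>))" if "l \<in> I" for l
  proof (rule Bochner_Integration.integrable_bound[of _ "\<lambda>_. 1 :: real"])
    show "AE \<omega> in M. norm (exp (- s * Y l \<omega>)) \<le> norm (1::real)"
      using Y[OF that] s by (intro AE_I2) (auto simp: less_imp_le)
  qed (use that in auto)
  ultimately have "(\<integral>\<omega>. (\<Prod>l\<in>I. exp (- s * Y l \<omega>)) \<partial>M) = (\<Prod>l\<in>I. \<integral>\<omega>. exp (- s * Y l \<omega>) \<partial>M)"
    using I by (intro indep_vars_lebesgue_integral) auto
  then show ?thesis
    using I by (simp add: mgf_def sum_distrib_left flip: exp_sum)
qed

lemma sum_deriv_mgf_prod: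
  fixes Y :: "nat \<Rightarrow> 'a \<Rightarrow> real"
  assumes M: "prob_space M" and indep: "prob_space.indep_vars M (\<lambda>_. borel) Y I" and I: "finite I" "I \<noteq> {}"
    and Y: "\<And>l \<omega>. l \<in> I \<Longrightarrow> \<omega> \<in> space M \<Longrightarrow> Y l \<omega> > 0" and s: "s > 0"
  shows "(\<Sum>l\<in>I. deriv (mgf M (Y l)) s * (\<Prod>k\<in>I - {l}. mgf M (Y k) s)) =
    - (\<integral>\<omega>. (\<Sum>l\<in>I. Y l \<omega>) * exp (- s * (\<Sum>l\<in>I. Y l \<omega>)) \<partial>M)"
proof -
  interpret prob_space M by fact
  have m: "Y l \<in> borel_measurable M" if "l \<in> I" for l
    using indep that by (auto simp: indep_vars_def)
  have "((\<lambda>u. \<Prod>l\<in>I. mgf M (Y l) u) has_real_derivative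
      (\<Sum>l\<in>I. deriv (mgf M (Y l)) s * (\<Prod>k\<in>I - {l}. mgf M (Y k) s))) (at s)"
  proof (rule has_field_derivative_prod)
    fix l assume "l \<in> I"
    from mgf_derivative(2)[OF M m[OF this] Y[OF this] s]
    show "(mgf M (Y l) has_real_derivative deriv (mgf M (Y l)) s) (at s)"
      using DERIV_imp_deriv by metis
  qed
  moreover have "((\<lambda>u. \<Prod>l\<in>I. mgf M (Y l) u) has_real_derivative
      - (\<integral>\<omega>. (\<Sum>l\<in>I. Y l \<omega>) * exp (- s * (\<Sum>l\<in>I. Y l \<omega>)) \<partial>M)) (at s)"
  proof (rule DERIV_cong_ev[THEN iffD1])
    show "\<forall>\<^sub>F u in nhds s. mgf M (\<lambda>\<omega>. \<Sum>l\<in>I. Y l \<omega>) u = (\<Prod>l\<in>I. mgf M (Y l) u)"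
      using eventually_nhds_in_open[of "{0<..}" s] s
      by (auto elim!: eventually_mono simp: mgf_sum_indep[OF M indep I(1) Y])
    show "(mgf M (\<lambda>\<omega>. \<Sum>l\<in>I. Y l \<omega>) has_real_derivative
        - (\<integral>\<omega>. (\<Sum>l\<in>I. Y l \<omega>) * exp (- s * (\<Sum>l\<in>I. Y l \<omega>)) \<partial>M)) (at s)"
      using m Y I by (intro mgf_derivative[OF M _ _ s] borel_measurable_sum sum_pos) auto
  qed auto
  ultimately show ?thesis by (rule DERIV_unique)
qed

context
  fixes M :: "'a measure" and S :: "'a \<Rightarrow> real" and L :: nat and \<eta> q :: real and G :: "real \<Rightarrow> complex"
  assumes M: "prob_space M" and S_measurable [measurable]: "S \<in> borel_measurable M"
    and S_pos: "\<And>\<omega>. \<omega> \<in> space M \<Longrightarrow> S \<omega> > 0" and L: "L \<ge> 1" and \<eta>: "\<eta> > 0"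
    and G: "\<And>s. s > 0 \<Longrightarrow> G s = capacity_kernel L \<eta> q s * of_real (- (\<integral>\<omega>. S \<omega> * exp (- s * S \<omega>) \<partial>M))"
begin

definition joint_integrand :: "real \<Rightarrow> 'a \<Rightarrow> complex" where
  "joint_integrand s \<omega> = (indicat_real {0<..} s *\<^sub>R capacity_kernel L \<eta> q s) * of_real (S \<omega> * exp (- s * S \<omega>))"

lemma measurable_joint_integrand [measurable]:
  "(\<lambda>(s, \<omega>). joint_integrand s \<omega>) \<in> borel_measurable (lborel \<Otimes>\<^sub>M M)"
  "(\<lambda>(\<omega>, s). joint_integrand s \<omega>) \<in> borel_measurable (M \<Otimes>\<^sub>M lborel)"
proof -
  have [measurable]: "(\<lambda>s. indicat_real {0<..} s *\<^sub>R capacity_kernel L \<eta> q s) \<in> borel_measurable borel"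
    by (rule measurable_capacity_kernel[OF L \<eta>])
  show "(\<lambda>(s, \<omega>). joint_integrand s \<omega>) \<in> borel_measurable (lborel \<Otimes>\<^sub>M M)"
    "(\<lambda>(\<omega>, s). joint_integrand s \<omega>) \<in> borel_measurable (M \<Otimes>\<^sub>M lborel)"
    unfolding joint_integrand_def by measurable
qed

lemma joint_integrand_swap:
  "joint_integrand s \<omega> = indicat_real {0<..} s *\<^sub>R (of_real (S \<omega> * exp (- s * S \<omega>)) * capacity_kernel L \<eta> q s)"
  by (simp add: joint_integrand_def mult.commute)

lemma joint_integrand_moment:
  shows "integrable M (\<lambda>\<omega>. joint_integrand s \<omega>)"
    and "(\<integral>\<omega>. joint_integrand s \<omega> \<partial>M) = - (indicat_real {0<..} s *\<^sub>R G s)"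
    and "(\<integral>\<omega>. norm (joint_integrand s \<omega>) \<partial>M) = norm (indicat_real {0<..} s *\<^sub>R G s)"
proof -
  have "integrable M (\<lambda>\<omega>. joint_integrand s \<omega>) \<and> (\<integral>\<omega>. joint_integrand s \<omega> \<partial>M) = - (indicat_real {0<..} s *\<^sub>R G s) \<and>
    (\<integral>\<omega>. norm (joint_integrand s \<omega>) \<partial>M) = norm (indicat_real {0<..} s *\<^sub>R G s)"
  proof (cases "s > 0")
    case True
    define m where "m = (\<integral>\<omega>. S \<omega> * exp (- s * S \<omega>) \<partial>M)"
    have i: "integrable M (\<lambda>\<omega>. S \<omega> * exp (- s * S \<omega>))" using M S_pos True by (intro mgf_derivative) auto
    have P: "joint_integrand s \<omega> = capacity_kernel L \<eta> q s * of_real (S \<omega> * exp (- s * S \<omega>))" for \<omega>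
      using True by (simp add: joint_integrand_def)
    have Gm: "G s = capacity_kernel L \<eta> q s * of_real (- m)" unfolding m_def by (rule G[OF True])
    have m: "0 \<le> m" unfolding m_def using S_pos by (intro Bochner_Integration.integral_nonneg) (auto simp: less_imp_le)
    have "(\<integral>\<omega>. norm (joint_integrand s \<omega>) \<partial>M) = (\<integral>\<omega>. norm (capacity_kernel L \<eta> q s) * (S \<omega> * exp (- s * S \<omega>)) \<partial>M)"
      using S_pos by (intro Bochner_Integration.integral_cong refl) (auto simp: P norm_mult less_imp_le)
    also have "\<dots> = norm (capacity_kernel L \<eta> q s) * m" by (simp add: m_def)
    also have "\<dots> = norm (indicat_real {0<..} s *\<^sub>R G s)"
      using True m by (simp add: Gm norm_mult)
    finally have 3: "(\<integral>\<omega>. norm (joint_integrand s \<omega>) \<partial>M) = norm (indicat_real {0<..} s *\<^sub>R G s)" .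
    have 1: "integrable M (\<lambda>\<omega>. joint_integrand s \<omega>)"
      unfolding P by (intro integrable_mult_right integrable_of_real i)
    have "(\<integral>\<omega>. joint_integrand s \<omega> \<partial>M) = capacity_kernel L \<eta> q s * of_real m"
      unfolding P integral_mult_right_zero integral_complex_of_real m_def ..
    then have 2: "(\<integral>\<omega>. joint_integrand s \<omega> \<partial>M) = - (indicat_real {0<..} s *\<^sub>R G s)"
      using True by (simp add: Gm)
    show ?thesis using 1 2 3 by blast
  qed (simp add: joint_integrand_def)
  then show "integrable M (\<lambda>\<omega>. joint_integrand s \<omega>)"
    and "(\<integral>\<omega>. joint_integrand s \<omega> \<partial>M) = - (indicat_real {0<..} s *\<^sub>R G s)"
    and "(\<integral>\<omega>. norm (joint_integrand s \<omega>) \<partial>M) = norm (indicat_real {0<..} s *\<^sub>R G s)" by blast+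
qed

lemma kernel_integrable_imp:
  assumes int: "set_integrable lborel {0<..} G"
  shows "integrable M (\<lambda>\<omega>. ln (1 + \<eta> / real L powr q * S \<omega> powr q))"
    and "(LINT s:{0<..}|lborel. G s) = of_real (\<integral>\<omega>. ln (1 + \<eta> / real L powr q * S \<omega> powr q) \<partial>M)"
proof -
  interpret prob_space M by (rule M)
  interpret pair_sigma_finite lborel M ..
  let ?l = "\<lambda>\<omega>. ln (1 + \<eta> / real L powr q * S \<omega> powr q)"
  have int2: "integrable (lborel \<Otimes>\<^sub>M M) (\<lambda>(s, \<omega>). joint_integrand s \<omega>)"
  proof (rule Fubini_integrable)
    show "integrable lborel (\<lambda>s. \<integral>\<omega>. norm (case (s, \<omega>) of (s, \<omega>) \<Rightarrow> joint_integrand s \<omega>) \<partial>M)"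
      using int unfolding prod.case joint_integrand_moment(3) set_integrable_def by (rule integrable_norm)
  qed (auto simp: joint_integrand_moment(1))
  have ae: "AE \<omega> in M. (LINT s|lborel. joint_integrand s \<omega>) = - of_real (?l \<omega>)"
    using AE_integrable_snd[OF int2] AE_space
  proof eventually_elim
    case (elim \<omega>)
    have "set_integrable lborel {0<..} (\<lambda>s. of_real (S \<omega> * exp (- s * S \<omega>)) * capacity_kernel L \<eta> q s)"
      using elim(1) unfolding joint_integrand_swap set_integrable_def .
    from Laplace_capacity_kernel[OF L \<eta> S_pos[OF elim(2)] this]
    show ?case unfolding joint_integrand_swap set_lebesgue_integral_def .
  qed
  have "integrable M (\<lambda>\<omega>. LINT s|lborel. joint_integrand s \<omega>)" by (rule integrable_snd[OF int2])
  then have "integrable M (\<lambda>\<omega>. - complex_of_real (?l \<omega>))"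
    by (rule integrable_cong_AE_imp) (use ae in \<open>auto simp: eq_commute\<close>)
  from Bochner_Integration.integrable_minus[OF this] have "integrable M (\<lambda>\<omega>. complex_of_real (?l \<omega>))"
    by (simp only: minus_minus)
  then show i: "integrable M ?l" by (simp only: complex_of_real_integrable_eq)
  have "- (LINT s:{0<..}|lborel. G s) = (LINT s|lborel. (\<integral>\<omega>. joint_integrand s \<omega> \<partial>M))"
    unfolding joint_integrand_moment(2) set_lebesgue_integral_def by simp
  also have "\<dots> = (\<integral>\<omega>. (LINT s|lborel. joint_integrand s \<omega>) \<partial>M)"
    by (rule Fubini_integral[OF int2, symmetric])
  also have "\<dots> = (\<integral>\<omega>. - complex_of_real (?l \<omega>) \<partial>M)"
    using ae by (intro integral_cong_AE) auto
  also have "\<dots> = - of_real (\<integral>\<omega>. ?l \<omega> \<partial>M)" by simp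
  finally show "(LINT s:{0<..}|lborel. G s) = of_real (\<integral>\<omega>. ?l \<omega> \<partial>M)" by simp
qed

lemma kernel_integrable_if:
  assumes q: "\<bar>q\<bar> \<le> 2" and int: "integrable M (\<lambda>\<omega>. ln (1 + \<eta> / real L powr q * S \<omega> powr q))"
  shows "set_integrable lborel {0<..} G"
proof -
  interpret prob_space M by (rule M)
  interpret pair_sigma_finite M lborel ..
  let ?l = "\<lambda>\<omega>. ln (1 + \<eta> / real L powr q * S \<omega> powr q)"
  obtain K where K: "K > 0" "\<And>\<sigma>. \<sigma> > 0 \<Longrightarrow> (LINT s:{0<..}|lborel. \<sigma> * exp (- s * \<sigma>) * norm (capacity_kernel L \<eta> q s)) \<le>
      K * (1 + ln (1 + \<eta> / real L powr q * \<sigma> powr q))"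
    using Laplace_capacity_kernel_bound[OF L \<eta> q] by blast
  have "integrable (M \<Otimes>\<^sub>M lborel) (\<lambda>(\<omega>, s). joint_integrand s \<omega>)"
  proof (rule Fubini_integrable)
    show "integrable M (\<lambda>\<omega>. LINT s|lborel. norm (case (\<omega>, s) of (\<omega>, s) \<Rightarrow> joint_integrand s \<omega>))"
    proof (rule Bochner_Integration.integrable_bound)
      show "integrable M (\<lambda>\<omega>. K * (1 + ?l \<omega>))" using int by simp
      show "AE \<omega> in M. norm (LINT s|lborel. norm (case (\<omega>, s) of (\<omega>, s) \<Rightarrow> joint_integrand s \<omega>)) \<le> norm (K * (1 + ?l \<omega>))"
      proof (rule AE_I2)
        fix \<omega> assume "\<omega> \<in> space M"
        note \<sigma> = S_pos[OF this]
        have "(LINT s|lborel. norm (joint_integrand s \<omega>)) = (LINT s:{0<..}|lborel. S \<omega> * exp (- s * S \<omega>) * norm (capacity_kernel L \<eta> q s))"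
          unfolding set_lebesgue_integral_def using \<sigma>
          by (intro Bochner_Integration.integral_cong) (auto simp: joint_integrand_def norm_mult)
        also have "\<dots> \<le> K * (1 + ?l \<omega>)" by (rule K(2)[OF \<sigma>])
        finally have le: "(LINT s|lborel. norm (joint_integrand s \<omega>)) \<le> K * (1 + ?l \<omega>)" .
        have "0 \<le> (LINT s|lborel. norm (joint_integrand s \<omega>))" by (rule Bochner_Integration.integral_nonneg) simp
        with le show "norm (LINT s|lborel. norm (case (\<omega>, s) of (\<omega>, s) \<Rightarrow> joint_integrand s \<omega>)) \<le> norm (K * (1 + ?l \<omega>))"
          by simp
      qed
    qed measurable
    show "AE \<omega> in M. integrable lborel (\<lambda>s. case (\<omega>, s) of (\<omega>, s) \<Rightarrow> joint_integrand s \<omega>)"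
      using Laplace_capacity_kernel_line(1)[OF L \<eta> q S_pos]
      by (intro AE_I2) (simp add: joint_integrand_swap set_integrable_def)
  qed measurable
  from integrable_snd[OF this] show ?thesis
    unfolding joint_integrand_moment(2) set_integrable_def by simp
qed

end

theorem corollary1:
  fixes M :: "'a measure" and L :: nat and W \<eta> p q :: real
    and \<gamma> :: "nat \<Rightarrow> 'a \<Rightarrow> real" and G :: "real \<Rightarrow> complex"
  defines "G \<equiv> \<lambda>s. capacity_kernel L \<eta> q s *
    of_real (\<Sum>l=1..L. deriv (mgf M (\<lambda>\<omega>. \<gamma> l \<omega> powr p)) s *
      (\<Prod>k\<in>{1..L} - {l}. mgf M (\<lambda>\<omega>. \<gamma> k \<omega> powr p) s))"
  assumes "prob_space M"
    and "L \<ge> 1" and "W > 0" and "\<eta> > 0"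
    and indep: "prob_space.indep_vars M (\<lambda>_. borel) \<gamma> {1..L}"
    and pos: "\<And>l \<omega>. l \<in> {1..L} \<Longrightarrow> \<omega> \<in> space M \<Longrightarrow> \<gamma> l \<omega> > 0"
    and density: "\<And>l. l \<in> {1..L} \<Longrightarrow> \<exists>f. distributed M lborel (\<gamma> l) f"
    and convergence: "\<bar>q\<bar> \<le> 2 \<or> set_integrable lborel {0<..} G"
  shows "of_real (ergodic_capacity M W (end_snr L \<eta> p q \<gamma>)) =
           of_real (W / ln 2) * (LINT s:{0<..}|lborel. G s) \<and>
         (integrable M (\<lambda>\<omega>. W * log 2 (1 + end_snr L \<eta> p q \<gamma> \<omega>)) \<longleftrightarrow>
           set_integrable lborel {0<..} G)"
proof -
  interpret prob_space M by fact
  define Y where "Y = (\<lambda>l \<omega>. \<gamma> l \<omega> powr p)"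
  define S where "S = (\<lambda>\<omega>. \<Sum>l=1..L. Y l \<omega>)"
  define l where "l = (\<lambda>\<omega>. ln (1 + \<eta> / real L powr q * S \<omega> powr q))"
  have indepY: "indep_vars (\<lambda>_. borel) Y {1..L}"
    unfolding Y_def by (rule indep_vars_compose2[OF indep]) measurable
  have Y_pos: "Y l \<omega> > 0" if "l \<in> {1..L}" "\<omega> \<in> space M" for l \<omega>
    using pos[OF that] by (simp add: Y_def)
  have S_pos: "S \<omega> > 0" if "\<omega> \<in> space M" for \<omega>
    unfolding S_def using Y_pos that \<open>L \<ge> 1\<close> by (intro sum_pos) auto
  have "Y l \<in> borel_measurable M" if "l \<in> {1..L}" for l
    using indepY that by (auto simp: indep_vars_def)
  then have S_meas: "S \<in> borel_measurable M" unfolding S_def by (intro borel_measurable_sum) auto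
  have G: "G s = capacity_kernel L \<eta> q s * of_real (- (\<integral>\<omega>. S \<omega> * exp (- s * S \<omega>) \<partial>M))" if "s > 0" for s
    using sum_deriv_mgf_prod[OF \<open>prob_space M\<close> indepY _ _ Y_pos that] \<open>L \<ge> 1\<close>
    unfolding G_def S_def Y_def by simp
  note ctx = \<open>prob_space M\<close> S_meas S_pos \<open>L \<ge> 1\<close> \<open>\<eta> > 0\<close> G
  have rate: "W * log 2 (1 + end_snr L \<eta> p q \<gamma> \<omega>) = W / ln 2 * l \<omega>" if "\<omega> \<in> space M" for \<omega>
  proof -
    have "end_snr L \<eta> p q \<gamma> \<omega> = \<eta> * (S \<omega> / real L) powr q"
      by (simp add: end_snr_def S_def Y_def)
    also have "\<dots> = \<eta> / real L powr q * S \<omega> powr q"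
      using S_pos[OF that] by (simp add: powr_divide)
    finally show ?thesis by (simp add: log_def l_def)
  qed
  have rate_integrable: "integrable M (\<lambda>\<omega>. W * log 2 (1 + end_snr L \<eta> p q \<gamma> \<omega>)) \<longleftrightarrow> integrable M l"
  proof -
    have "integrable M (\<lambda>\<omega>. W * log 2 (1 + end_snr L \<eta> p q \<gamma> \<omega>)) \<longleftrightarrow> integrable M (\<lambda>\<omega>. W / ln 2 * l \<omega>)"
      using rate by (intro Bochner_Integration.integrable_cong) auto
    then show ?thesis unfolding integrable_mult_left_iff using \<open>W > 0\<close> by simp
  qed
  have capacity: "ergodic_capacity M W (end_snr L \<eta> p q \<gamma>) = W / ln 2 * (\<integral>\<omega>. l \<omega> \<partial>M)"
  proof -
    have "ergodic_capacity M W (end_snr L \<eta> p q \<gamma>) = (\<integral>\<omega>. W / ln 2 * l \<omega> \<partial>M)"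
      unfolding ergodic_capacity_def using rate by (intro Bochner_Integration.integral_cong) auto
    then show ?thesis by simp
  qed
  show ?thesis
  proof (cases "set_integrable lborel {0<..} G")
    case True
    have "integrable M l" "(LINT s:{0<..}|lborel. G s) = of_real (\<integral>\<omega>. l \<omega> \<partial>M)"
      using kernel_integrable_imp[OF ctx True] unfolding l_def by blast+
    then show ?thesis using True unfolding rate_integrable capacity by simp
  next
    case False
    then have "\<not> integrable M l"
      using convergence kernel_integrable_if[OF ctx] unfolding l_def by blast
    moreover have "(LINT s:{0<..}|lborel. G s) = 0"
      using False unfolding set_lebesgue_integral_def set_integrable_def by (rule not_integrable_integral_eq)
    ultimately show ?thesis using False unfolding rate_integrable capacity by (simp add: not_integrable_integral_eq)
  qed
qed

end
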